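(* Up to equivalence, there is exactly one configuration of two closed curves on the $2$-sphere $S^2$ having exactly $4$ intersection points. That is, $N(4)=1$.
   Context: A configuration is a pair of simple closed curves (closed curves without self-intersections) $C_1, C_2$ on the $2$-sphere $S^2 \subset \mathbb{R}^3$ that intersect each other transversally in finitely many points. Two configurations $(C_1,C_2)$ and $(C_1',C_2')$ are equivalent if there is a homeomorphism $h\colon S^2\to S^2$ with $h(C_1\cup C_2)=C_1'\cup C_2'$ (the homeomorphism is allowed to map $C_1$ to $C_2'$ and $C_2$ to $C_1'$). $N(2n)$ denotes the number of equivalence classes of configurations in which the two curves have exactly $2n$ intersection points. *)

theory Defs
  imports "HOL-Analysis.Analysis"
begin

definition S2 :: "(real^3) set" where
  "S2 = sphere 0 1"

definition simple_closed_curve :: "(real^3) set \<Rightarrow> bool" where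
  "simple_closed_curve C \<longleftrightarrow> C \<subseteq> S2 \<and> C homeomorphic (sphere (0::complex) 1)"

definition transversal_at :: "(real^3) set \<Rightarrow> (real^3) set \<Rightarrow> real^3 \<Rightarrow> bool" where
  "transversal_at C1 C2 p \<longleftrightarrow>
     (\<exists>U \<phi> \<psi>. openin (top_of_set S2) U \<and> p \<in> U \<and>
        homeomorphism U (ball (0::complex) 1) \<phi> \<psi> \<and> \<phi> p = 0 \<and>
        \<phi> ` (C1 \<inter> U) = {z \<in> ball 0 1. Im z = 0} \<and>
        \<phi> ` (C2 \<inter> U) = {z \<in> ball 0 1. Re z = 0})"

definition configurations :: "nat \<Rightarrow> ((real^3) set \<times> (real^3) set) set" where
  "configurations k = {(C1, C2). simple_closed_curve C1 \<and> simple_closed_curve C2 \<and>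
      finite (C1 \<inter> C2) \<and> card (C1 \<inter> C2) = k \<and>
      (\<forall>p \<in> C1 \<inter> C2. transversal_at C1 C2 p)}"

definition config_equiv :: "nat \<Rightarrow> (((real^3) set \<times> (real^3) set) \<times> ((real^3) set \<times> (real^3) set)) set" where
  "config_equiv k = {((C1, C2), (D1, D2)). (C1, C2) \<in> configurations k \<and> (D1, D2) \<in> configurations k \<and>
      (\<exists>h h'. homeomorphism S2 S2 h h' \<and> h ` (C1 \<union> C2) = D1 \<union> D2)}"

definition N :: "nat \<Rightarrow> nat" where
  "N k = card (configurations k // config_equiv k)"

end

theory Submission
  imports Defs "HOL-Complex_Analysis.Complex_Analysis"
begin

text \<open>
  Let the four crossings be met in the order \<open>q0, q1, q2, q3\<close> along \<open>C2\<close>, and let \<open>B0, \<dots>, B3\<close>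
  be the arcs of \<open>C2\<close> between them. The curve \<open>C1\<close> cuts the sphere into two closed discs, and
  transversality forces the arcs \<open>Bi\<close> to lie alternately in the one and in the other. Two disjoint
  chords of a disc do not have interlaced endpoints, so \<open>C1\<close> meets the crossings in the same cyclic
  order as \<open>C2\<close>, up to reversal. Hence for two configurations there is a homeomorphism
  \<open>C1 \<rightarrow> C1'\<close> that respects the labels of the crossings; it extends over each of the two discs so that
  the two chords in it go to the corresponding chords, because chords cut a disc into discs and
  every homeomorphism of boundary circles extends radially.

  That the pieces really are discs is the Schoenflies theorem. It is obtained from the Riemann map
  \<open>g\<close> of the inside of a Jordan curve onto the unit disc: Koebe's argument with products over rotations
  and reflections shows that \<open>g\<close> extends continuously to the boundary; the fibres of the extension over
  the unit circle are nested intersections of continua, and a second product over rotations shows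
  that the extension is not constant on a piece of the boundary, so that it is injective.
\<close>

section \<open>Koebe's boundary estimate\<close>

text \<open>The obstacle is the behaviour of the Riemann map at the boundary. If \<open>g\<close>
  oscillated by at least e near a point w of the curve, local connectedness of the inside at w would
  supply a small continuum near w whose image under \<open>g\<close> spans an angle of at least pi/n
  at 0, with n depending on e alone. On that image f - w is tiny, and the rotated and reflected
  copies of the image form a ring around 0. The product of the corresponding copies of f - w is tiny
  on the ring, because one factor is tiny while the number and the size of the others were fixed
  beforehand; by the maximum principle f 0 - w is too small. On the sphere a projection from q shows
  as a bounded region only the side of the curve away from q, so the two discs come from two
  projections, and it takes a separate argument that the sides found are complementary. Finally, any
  two configurations being equivalent shows only that there is at most one class; an explicit
  configuration, from two crossed rectangles, supplies the class.\<close>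

text \<open>If \<open>0\<close> were not enclosed, \<open>K\<close> would carry a continuous argument; under the rotation it grows by a
  constant congruent to \<open>2\<pi>/n\<close>, although \<open>n\<close> rotations make the identity.\<close>

lemma rotation_invariant_separates_zero:
  fixes K :: "complex set" and n :: nat
  assumes "compact K" "connected K" "K \<noteq> {}" "0 \<notin> K" "2 \<le> n"
    and rot: "\<And>z. z \<in> K \<Longrightarrow> cis (2 * pi / n) * z \<in> K"
  shows "0 \<in> inside K"
proof (rule ccontr)
  define \<theta> where "\<theta> = 2 * pi / n"
  assume "0 \<notin> inside K"
  then have "\<not> bounded (connected_component_set (- K) 0)"
    using \<open>0 \<notin> K\<close> by (auto simp: inside_def)
  \<comment> \<open>Borsuk's criterion: from a point in the unbounded component of the complement
    the direction map to the circle is inessential, and an inessential map lifts to a continuous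
    real argument \<open>g\<close>.\<close>
  then have "\<exists>c. homotopic_with_canon (\<lambda>x. True) K (sphere 0 1)
                   (\<lambda>x. inverse (norm (x - 0)) *\<^sub>R (x - 0)) (\<lambda>x. c)"
    using Borsuk_map_essential_bounded_component[OF \<open>compact K\<close> \<open>0 \<notin> K\<close>] by blast
  then obtain g :: "complex \<Rightarrow> real" where contg: "continuous_on K g"
    and g: "\<And>x. x \<in> K \<Longrightarrow> inverse (norm x) *\<^sub>R x = exp (\<i> * of_real (g x))"
    unfolding inessential_eq_continuous_logarithm_circle by auto
  have sgn_g: "sgn x = cis (g x)" if "x \<in> K" for x
    using g[OF that] by (simp add: sgn_div_norm divide_inverse cis_conv_exp mult.commute scaleR_conv_of_real)
  define d where "d z = g (cis \<theta> * z) - g z - \<theta>" for z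
  have contd: "continuous_on K d"
    unfolding d_def using rot
    by (intro continuous_intros contg continuous_on_compose2[OF contg]) (auto simp: \<theta>_def)
  have dint: "\<exists>m::int. d z = 2 * pi * of_int m" if "z \<in> K" for z
  proof -
    have "cis (g (cis \<theta> * z)) = cis \<theta> * cis (g z)"
      using sgn_g[OF that] sgn_g[OF rot[OF that]] by (simp add: sgn_mult \<theta>_def)
    then have "cis (d z) = 1"
      by (simp add: d_def cis_divide[symmetric])
    then show ?thesis
      by (auto simp: complex_eq_iff cos_one_2pi_int mult_ac)
  qed
  have "d constant_on K"
  proof (rule continuous_discrete_range_constant[OF \<open>connected K\<close> contd])
    fix x assume x: "x \<in> K"
    have "2 * pi \<le> norm (d y - d x)" if y: "y \<in> K" "d y \<noteq> d x" for y
    proof -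
      obtain m k :: int where mk: "d y = 2 * pi * of_int m" "d x = 2 * pi * of_int k"
        using dint x y by blast
      then have "1 \<le> \<bar>m - k\<bar>" using y by auto
      then have "1 \<le> \<bar>real_of_int m - of_int k\<bar>" by linarith
      moreover have "\<bar>2 * pi * real_of_int m - 2 * pi * real_of_int k\<bar> = 2 * pi * \<bar>real_of_int m - of_int k\<bar>"
        by (simp add: abs_mult flip: right_diff_distrib)
      ultimately show ?thesis unfolding mk by simp
    qed
    then show "\<exists>e>0. \<forall>y. y \<in> K \<and> d y \<noteq> d x \<longrightarrow> e \<le> norm (d y - d x)"
      by (intro exI[of _ "2 * pi"]) auto
  qed
  then obtain c where c: "\<And>z. z \<in> K \<Longrightarrow> d z = c"
    by (auto simp: constant_on_def)
  obtain z where z: "z \<in> K" using \<open>K \<noteq> {}\<close> by blast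
  have iter: "cis (k * \<theta>) * z \<in> K \<and> g (cis (k * \<theta>) * z) = g z + k * (c + \<theta>)" for k :: nat
  proof (induction k)
    case (Suc k)
    have eq: "cis (Suc k * \<theta>) * z = cis \<theta> * (cis (k * \<theta>) * z)"
      by (simp add: cis_mult algebra_simps)
    have "g (cis \<theta> * (cis (k * \<theta>) * z)) = g (cis (k * \<theta>) * z) + (c + \<theta>)"
      using c[of "cis (k * \<theta>) * z"] Suc by (simp add: d_def)
    moreover have "cis \<theta> * (cis (k * \<theta>) * z) \<in> K"
      using rot Suc by (simp add: \<theta>_def)
    ultimately show ?case
      unfolding eq using Suc by (simp add: algebra_simps)
  qed (use z in auto)
  have "cis (n * \<theta>) = 1"
    using \<open>2 \<le> n\<close> by (simp add: \<theta>_def complex_eq_iff)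
  then have nc: "n * (c + \<theta>) = 0"
    using iter[of n] by simp
  obtain m :: int where "c = 2 * pi * of_int m" using dint c z by force
  then have "n * (c + \<theta>) = 2 * pi * real_of_int (m * int n + 1)"
    using \<open>2 \<le> n\<close> by (simp add: \<theta>_def field_simps)
  then have "real_of_int (m * int n + 1) = 0" using nc by simp
  then have "m * int n = -1" by linarith
  then have "int n dvd 1" by (metis dvd_minus_iff dvd_triv_right)
  with \<open>2 \<le> n\<close> show False by simp
qed

text \<open>Modulus and cosine of the argument leave only the sign of the imaginary part open. So a
  set closed under conjugation that meets one of the rays of angle \<open>a\<close> and
  \<open>- a\<close> meets both, at the same radius.\<close>

lemma two_polar_points:
  assumes "Re z = norm z * cos a"
  shows "{norm z * cis a, norm z * cis (- a)} = {z, cnj z}"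
proof -
  define r where "r = norm z"
  have R: "Re z = r * cos a" using assms by (simp add: r_def)
  have "(Im z)^2 = (r * sin a)^2"
  proof -
    have "r^2 = (Re z)^2 + (Im z)^2" by (simp add: norm_complex_def r_def)
    also have "(Re z)^2 = r^2 * (1 - (sin a)^2)"
      by (simp add: R power_mult_distrib cos_squared_eq)
    finally show ?thesis by (simp add: algebra_simps power_mult_distrib)
  qed
  then have "Im z = r * sin a \<or> Im z = - (r * sin a)"
    by (simp add: power2_eq_iff)
  then have "{r * cis a, r * cis (- a)} = {z, cnj z}"
  proof
    assume "Im z = r * sin a"
    with R have "z = r * cis a" "cnj z = r * cis (- a)"
      by (simp_all add: complex_eq_iff)
    then show ?thesis by (simp del: complex_cnj_mult)
  next
    assume "Im z = - (r * sin a)"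
    with R have "z = r * cis (- a)" "cnj z = r * cis a"
      by (simp_all add: complex_eq_iff)
    then show ?thesis by (metis insert_commute)
  qed
  then show ?thesis by (simp add: r_def)
qed

text \<open>The set \<sigma> leads from the positive real axis to a ray of angle pi/n or -pi/n. With
  its mirror image it spans a sector of angle 2 pi/n, so the n rotates close up to a ring
  \<open>K\<close> around 0. At each point of the ring one of the n factors of \<open>H\<close> is
  at most \<epsilon> * M and the other n - 1 are at most M^2; the maximum principle on the inside of
  the ring carries this bound to \<open>H 0\<close>, where all 2 n elementary factors have the norm
  of \<open>f 0\<close>.\<close>

lemma norm_at_centre_le_of_small_on_sector_crossing:
  fixes f :: "complex \<Rightarrow> complex" and n :: nat
  assumes hol: "f holomorphic_on ball 0 1" and M: "\<And>z. z \<in> ball 0 1 \<Longrightarrow> norm (f z) \<le> M"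
    and n: "2 \<le> n" and \<sigma>: "compact \<sigma>" "connected \<sigma>" "\<sigma> \<subseteq> ball 0 1" "0 \<notin> \<sigma>"
    and small: "\<And>z. z \<in> \<sigma> \<Longrightarrow> norm (f z) \<le> \<epsilon>"
    and e1: "e1 \<in> \<sigma>" "Im e1 = 0" "Re e1 > 0"
    and e2: "e2 \<in> \<sigma>" "Re e2 / norm e2 \<le> cos (pi / n)"
  shows "norm (f 0) ^ (2 * n) \<le> \<epsilon> * M * (M^2) ^ (n - 1)"
proof -
  define \<omega> where "\<omega> = cis (2 * pi / n)"
  define S where "S = \<sigma> \<union> cnj ` \<sigma>"
  define K where "K = (\<Union>k<n. (\<lambda>z. \<omega> ^ k * z) ` S)"
  have \<omega>n: "\<omega> ^ n = 1" using n by (simp add: \<omega>_def Complex.DeMoivre)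
  have norm\<omega>: "norm (\<omega> ^ k * z) = norm z" for k z
    by (simp add: norm_mult norm_power \<omega>_def)
  have S01: "S \<subseteq> ball 0 1" "0 \<notin> S" using \<sigma> by (auto simp: S_def)
  have compS: "compact S"
    unfolding S_def by (intro compact_Un compact_continuous_image continuous_intros \<sigma>)
  have "e1 = cnj e1" using e1 by (simp add: complex_eq_iff)
  then have "e1 \<in> \<sigma> \<inter> cnj ` \<sigma>" using e1 by (metis IntI imageI)
  then have connS: "connected S"
    unfolding S_def by (intro connected_Un connected_continuous_image continuous_intros \<sigma>) auto
  \<comment> \<open>The cosine of the argument is continuous on the connected set \<sigma>, equals 1
    at \<open>e1\<close> and is at most cos (pi/n) at \<open>e2\<close>.\<close>
  have "\<exists>z\<in>\<sigma>. Re z / norm z = cos (pi / n)"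
  proof -
    have "continuous_on \<sigma> (\<lambda>z. Re z / norm z)"
      using \<open>0 \<notin> \<sigma>\<close> by (intro continuous_on_divide continuous_intros) auto
    then have "connected ((\<lambda>z. Re z / norm z) ` \<sigma>)"
      using \<sigma>(2) by (rule connected_continuous_image)
    moreover have "Re e2 / norm e2 \<in> (\<lambda>z. Re z / norm z) ` \<sigma>"
      by (rule image_eqI[OF _ e2(1)]) simp
    moreover have "1 \<in> (\<lambda>z. Re z / norm z) ` \<sigma>"
      by (rule image_eqI[OF _ e1(1)]) (use e1 in \<open>simp add: norm_complex_def\<close>)
    ultimately have "cos (pi / n) \<in> (\<lambda>z. Re z / norm z) ` \<sigma>"
      by (rule connectedD_interval[OF _ _ _ e2(2) cos_le_one])
    then show ?thesis by auto
  qed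
  then obtain z where z: "z \<in> \<sigma>" "Re z / norm z = cos (pi / n)" by blast
  have "norm z \<noteq> 0" using z \<sigma> by auto
  with z(2) have "Re z = norm z * cos (pi / n)"
    by (metis nonzero_eq_divide_eq mult.commute)
  then have "{norm z * cis (pi / n), norm z * cis (- (pi / n))} = {z, cnj z}"
    by (rule two_polar_points)
  then have "{norm z * cis (pi / n), norm z * cis (- (pi / n))} \<subseteq> S"
    using z by (auto simp: S_def)
  then obtain r where r: "r * cis (pi / n) \<in> S" "r * cis (- (pi / n)) \<in> S"
    by blast
  \<comment> \<open>The ray at angle pi/n in one rotate of \<open>S\<close> is the ray at angle
    -pi/n in the next, and \<open>S\<close> meets both rays at the same radius r; hence consecutive
    rotates share a point.\<close>
  have meet: "\<omega> ^ k * (r * cis (pi / n)) \<in> (\<lambda>z. \<omega> ^ k * z) ` S \<inter> (\<lambda>z. \<omega> ^ Suc k * z) ` S" for k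
  proof -
    have "\<omega> * cis (- (pi / n)) = cis (pi / n)"
      by (simp add: \<omega>_def cis_mult field_simps)
    then have "\<omega> ^ k * (r * cis (pi / n)) = \<omega> ^ Suc k * (r * cis (- (pi / n)))"
      by (simp add: algebra_simps)
    then show ?thesis using r by blast
  qed
  have "connected (\<Union>k<m. (\<lambda>z. \<omega> ^ k * z) ` S)" for m
  proof (induction m)
    case (Suc m)
    show ?case
    proof (cases "m = 0")
      case False
      then obtain k where k: "m = Suc k" by (cases m) auto
      have "connected ((\<lambda>z. \<omega> ^ m * z) ` S)"
        by (intro connected_continuous_image continuous_intros connS)
      moreover have "(\<lambda>z. \<omega> ^ m * z) ` S \<inter> (\<Union>k<m. (\<lambda>z. \<omega> ^ k * z) ` S) \<noteq> {}"
        using meet[of k] by (auto simp: k)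
      ultimately show ?thesis
        using Suc by (simp add: lessThan_Suc connected_Un)
    qed (use connS in \<open>simp add: lessThan_Suc\<close>)
  qed auto
  then have connK: "connected K" by (simp add: K_def)
  have compK: "compact K"
    unfolding K_def by (intro compact_UN compact_continuous_image continuous_intros compS) auto
  have K01: "K \<subseteq> ball 0 1"
  proof -
    have "norm w < 1" if "w \<in> K" for w
      using that S01 norm\<omega> by (auto simp: K_def)
    then show ?thesis by auto
  qed
  have K0: "0 \<notin> K" using S01 by (auto simp: K_def \<omega>_def)
  have "S \<noteq> {}" using e1 by (auto simp: S_def)
  then have Kne: "K \<noteq> {}" using n unfolding K_def by (auto intro!: exI[of _ 0])
  have rot: "\<omega> * w \<in> K" if w: "w \<in> K" for w
  proof -
    obtain k s where k: "k < n" "s \<in> S" "w = \<omega> ^ k * s" using w unfolding K_def by blast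
    show ?thesis
    proof (cases "Suc k < n")
      case True
      then have "\<omega> * w = \<omega> ^ Suc k * s" "Suc k \<in> {..<n}" using k by simp_all
      then show ?thesis using k unfolding K_def by blast
    next
      case False
      then have "\<omega> * w = \<omega> ^ 0 * s" using k \<omega>n by (metis Suc_lessI mult.assoc power_0 power_Suc)
      moreover have "0 \<in> {..<n}" using n by simp
      ultimately show ?thesis using k unfolding K_def by blast
    qed
  qed
  have in0: "0 \<in> inside K"
    by (rule rotation_invariant_separates_zero[OF compK connK Kne K0 n]) (use rot in \<open>simp add: \<omega>_def\<close>)
  \<comment> \<open>For s in \<open>S\<close>, either s or its conjugate lies in \<sigma>. The
    holomorphic factor reflected in the real axis therefore makes \<open>F\<close> small on all of
    \<open>S\<close>, not only on \<sigma>.\<close>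
  define F where "F z = f z * (cnj \<circ> f \<circ> cnj) z" for z
  have holF: "F holomorphic_on ball 0 1"
  proof -
    have "f holomorphic_on cnj ` ball 0 1"
      by (rule holomorphic_on_subset[OF hol]) auto
    then have "(cnj \<circ> f \<circ> cnj) holomorphic_on ball 0 1"
      by (rule holomorphic_on_compose_cnj_cnj) simp
    then show ?thesis unfolding F_def by (intro holomorphic_intros hol)
  qed
  define H where "H z = (\<Prod>k<n. F (\<omega> ^ k * z))" for z
  have holH: "H holomorphic_on ball 0 1"
    unfolding H_def
  proof (intro holomorphic_intros)
    fix k
    have "(F \<circ> (\<lambda>z. \<omega> ^ k * z)) holomorphic_on ball 0 1"
      by (intro holomorphic_on_compose holomorphic_intros holomorphic_on_subset[OF holF]) (auto simp: norm\<omega>)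
    then show "(\<lambda>z. F (\<omega> ^ k * z)) holomorphic_on ball 0 1" by (simp add: o_def)
  qed
  have M0: "0 \<le> M" by (meson M centre_in_ball norm_ge_zero order_trans zero_less_one)
  have F_le: "norm (F z) \<le> M\<^sup>2" if "norm z < 1" for z
    using M[of z] M[of "cnj z"] that M0 by (simp add: F_def norm_mult power2_eq_square mult_mono)
  have F_S: "norm (F s) \<le> \<epsilon> * M" if "s \<in> S" for s
  proof -
    have s1: "norm s < 1" using that S01 by auto
    have "norm (f s) \<le> \<epsilon> \<or> norm (f (cnj s)) \<le> \<epsilon>" using that small by (auto simp: S_def)
    moreover have "norm (f s) \<le> M" "norm (f (cnj s)) \<le> M" using M s1 by auto
    moreover have "0 \<le> \<epsilon>" using small[OF e1(1)] norm_ge_zero order_trans by blast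
    ultimately show ?thesis
      using M0 unfolding F_def norm_mult o_def complex_mod_cnj
      by (metis mult.commute mult_mono norm_ge_zero)
  qed
  have H_K: "norm (H w) \<le> \<epsilon> * M * (M\<^sup>2) ^ (n - 1)" if w: "w \<in> K" for w
  proof -
    obtain k s where k: "k < n" "s \<in> S" "w = \<omega> ^ k * s" using w unfolding K_def by blast
    \<comment> \<open>Rotation number \<open>j\<close> undoes rotation number \<open>k\<close>; the
      case \<open>k = 0\<close> is separate because \<open>n - 0\<close> is not an index below
      \<open>n\<close>.\<close>
    define j where "j = (if k = 0 then 0 else n - k)"
    have j: "j < n" "\<omega> ^ j * w = s"
      using k \<omega>n n by (auto simp: j_def simp flip: power_add mult.assoc)
    have "norm (H w) = norm (F (\<omega> ^ j * w)) * (\<Prod>i\<in>{..<n} - {j}. norm (F (\<omega> ^ i * w)))"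
      unfolding H_def using j(1) by (subst prod.remove[of _ j]) (simp_all add: norm_mult prod_norm)
    also have "\<dots> \<le> (\<epsilon> * M) * (\<Prod>i\<in>{..<n} - {j}. M\<^sup>2)"
    proof (intro mult_mono prod_mono conjI)
      show "norm (F (\<omega> ^ j * w)) \<le> \<epsilon> * M" unfolding j(2) by (rule F_S[OF k(2)])
      then show "0 \<le> \<epsilon> * M" using norm_ge_zero order_trans by blast
      have "norm w < 1" using w K01 by auto
      then show "norm (F (\<omega> ^ i * w)) \<le> M\<^sup>2" for i by (intro F_le) (simp add: norm\<omega>)
    qed (auto intro: prod_nonneg)
    also have "(\<Prod>i\<in>{..<n} - {j}. M\<^sup>2) = (M\<^sup>2) ^ (n - 1)" using j by simp
    finally show ?thesis .
  qed
  have inK: "inside K \<subseteq> ball 0 1" using outside_subset_convex[OF convex_ball K01] inside_Int_outside[of K] by blast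
  have clK: "closure (inside K) \<subseteq> ball 0 1"
    using inK K01 frontier_inside_subset[OF compact_imp_closed[OF compK]] closure_Un_frontier[of "inside K"] by blast
  have "norm (H 0) \<le> \<epsilon> * M * (M\<^sup>2) ^ (n - 1)"
  proof (rule maximum_modulus_frontier[of H "inside K"])
    show "H holomorphic_on interior (inside K)"
      by (rule holomorphic_on_subset[OF holH]) (use inK interior_subset in blast)
    show "continuous_on (closure (inside K)) H"
      by (rule continuous_on_subset[OF holomorphic_on_imp_continuous_on[OF holH] clK])
    show "bounded (inside K)" using inK bounded_ball bounded_subset by blast
    show "norm (H z) \<le> \<epsilon> * M * (M\<^sup>2) ^ (n - 1)" if "z \<in> frontier (inside K)" for z
      using that frontier_inside_subset[OF compact_imp_closed[OF compK]] H_K by blast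
  qed (rule in0)
  moreover have "norm (H 0) = norm (f 0) ^ (2 * n)"
    by (simp add: H_def F_def norm_mult norm_power power_mult power2_eq_square)
  ultimately show ?thesis by simp
qed

section \<open>The Schoenflies theorem\<close>

lemma simple_loop_from:
  assumes "simple_path c" "pathfinish c = pathstart c" "w \<in> path_image c"
  obtains c' where "simple_path c'" "pathstart c' = w" "pathfinish c' = w" "path_image c' = path_image c"
proof -
  obtain t where t: "t \<in> {0..1}" "w = c t" using assms by (auto simp: path_image_def)
  show thesis
    by (rule that[of "shiftpath t c"])
      (use assms t in \<open>simp_all add: simple_path_shiftpath pathstart_shiftpath pathfinish_shiftpath path_image_shiftpath\<close>)
qed

lemma simple_loop_inj_on:
  assumes "simple_path c" "pathstart c = w" "pathfinish c = w"
    and "s \<in> {0..1}" "t \<in> {0..1}" "c s = c t"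
  shows "s = t \<or> s = 0 \<and> t = 1 \<or> s = 1 \<and> t = 0"
  using assms unfolding simple_path_def loop_free_def by blast

text \<open>With \<open>w\<close> as base point, \<open>L\<close> is what remains of the loop when
  short parameter intervals at both ends are dropped. It will be the connected intersection that
  Janiszewski's theorem asks for.\<close>

lemma simple_loop_split_at_point:
  fixes c :: "real \<Rightarrow> 'a::metric_space"
  assumes "simple_path c" "pathfinish c = pathstart c" "w \<in> path_image c" "\<epsilon> > 0"
  obtains L where "compact L" "connected L" "w \<notin> L" "L \<subseteq> path_image c" "path_image c \<subseteq> ball w \<epsilon> \<union> L"
proof -
  obtain c' where c': "simple_path c'" "pathstart c' = w" "pathfinish c' = w" "path_image c' = path_image c"
    using simple_loop_from assms by blast
  have im: "c' ` {0..1} = path_image c" using c'(4) by (simp add: path_image_def)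
  have cont: "continuous_on {0..1} c'" using c'(1) by (simp add: simple_path_def path_def)
  have w: "c' 0 = w" "c' 1 = w" using c' by (auto simp: pathstart_def pathfinish_def)
  obtain d0 where d0: "d0 > 0" "\<And>t. t \<in> {0..1} \<Longrightarrow> dist t 0 < d0 \<Longrightarrow> dist (c' t) (c' 0) < \<epsilon>"
    using cont \<open>\<epsilon> > 0\<close> unfolding continuous_on_iff by (metis atLeastAtMost_iff order_refl zero_le_one)
  obtain d1 where d1: "d1 > 0" "\<And>t. t \<in> {0..1} \<Longrightarrow> dist t 1 < d1 \<Longrightarrow> dist (c' t) (c' 1) < \<epsilon>"
    using cont \<open>\<epsilon> > 0\<close> unfolding continuous_on_iff by (metis atLeastAtMost_iff order_refl zero_le_one)
  define d where "d = min (1/2) (min d0 d1) / 2"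
  have d: "0 < d" "d < 1/2" "d < d0" "d < d1" using d0(1) d1(1) by (auto simp: d_def min_def)
  define L where "L = c' ` {d..1-d}"
  show thesis
  proof (rule that[of L])
    have cont': "continuous_on {d..1-d} c'" by (rule continuous_on_subset[OF cont]) (use d in auto)
    show "compact L" unfolding L_def by (intro compact_continuous_image cont') auto
    show "connected L" unfolding L_def by (intro connected_continuous_image cont') auto
    show "w \<notin> L"
    proof
      assume "w \<in> L"
      then obtain t where t: "t \<in> {d..1-d}" "c' 0 = c' t" using w by (auto simp: L_def)
      with d have "t \<in> {0..1}" by auto
      then show False using simple_loop_inj_on[OF c'(1-3), of 0 t] t d by auto
    qed
    show "L \<subseteq> path_image c"
      unfolding im[symmetric] L_def using d by (intro image_mono) auto
    show "path_image c \<subseteq> ball w \<epsilon> \<union> L"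
    proof
      fix x assume "x \<in> path_image c"
      then obtain t where t: "t \<in> {0..1}" "x = c' t" unfolding im[symmetric] by blast
      consider "t < d" | "t \<in> {d..1-d}" | "1 - d < t" using t by fastforce
      then show "x \<in> ball w \<epsilon> \<union> L"
      proof cases
        case 1 then show ?thesis using d0(2)[of t] t d w by (auto simp: dist_commute dist_real_def)
      next
        case 2 then show ?thesis using t by (auto simp: L_def)
      next
        case 3 then show ?thesis using d1(2)[of t] t d w by (auto simp: dist_commute dist_real_def)
      qed
    qed
  qed
qed

text \<open>Two inside points close to \<open>w\<close> are separated neither by the curve nor by
  \<open>sphere w \<epsilon> \<union> L\<close>, and these closed sets meet in a connected set. By
  Janiszewski's theorem their union does not separate the points either, and a path that avoids the
  union can leave neither the inside nor the ball.\<close>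

lemma inside_loop_locally_connected_at_boundary:
  fixes c :: "real \<Rightarrow> complex"
  assumes c: "simple_path c" "pathfinish c = pathstart c" and w: "w \<in> path_image c" and "\<epsilon> > 0"
  obtains \<delta> where "\<delta> > 0"
    "\<And>x y. x \<in> inside (path_image c) \<inter> ball w \<delta> \<Longrightarrow> y \<in> inside (path_image c) \<inter> ball w \<delta> \<Longrightarrow>
      \<exists>K. compact K \<and> connected K \<and> x \<in> K \<and> y \<in> K \<and> K \<subseteq> inside (path_image c) \<inter> ball w \<epsilon>"
proof -
  obtain L where L: "compact L" "connected L" "w \<notin> L" "L \<subseteq> path_image c" "path_image c \<subseteq> ball w \<epsilon> \<union> L"
    using simple_loop_split_at_point[OF c w \<open>\<epsilon> > 0\<close>] by blast
  have "open (- L)" using L(1) by (simp add: compact_imp_closed open_Compl)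
  then obtain \<rho> where \<rho>: "\<rho> > 0" "ball w \<rho> \<subseteq> - L" using L(3) by (meson ComplI open_contains_ball)
  define \<delta> where "\<delta> = min \<rho> \<epsilon>"
  have \<delta>: "\<delta> > 0" "ball w \<delta> \<inter> L = {}" "\<delta> \<le> \<epsilon>" using \<rho> \<open>\<epsilon> > 0\<close> by (auto simp: \<delta>_def)
  have compJ: "compact (path_image c)" using c by (simp add: compact_simple_path_image)
  show thesis
  proof (rule that[OF \<delta>(1)])
    fix x y
    assume x: "x \<in> inside (path_image c) \<inter> ball w \<delta>" and y: "y \<in> inside (path_image c) \<inter> ball w \<delta>"
    let ?T = "sphere w \<epsilon> \<union> L"
    have clT: "closed ?T" using L(1) by (simp add: closed_Un compact_imp_closed)
    have "connected_component (- (path_image c \<union> ?T)) x y"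
    proof (rule Janiszewski[OF compJ])
      show "closed ?T" by (rule clT)
      \<comment> \<open>Outside the open ball the curve runs in \<open>L\<close>, so the circle
        contributes no further common point.\<close>
      have "path_image c \<inter> ?T = L" using L(4,5) by auto
      then show "connected (path_image c \<inter> ?T)" using L(2) by simp
      show "connected_component (- path_image c) x y"
        unfolding connected_component_def
      proof (intro exI conjI)
        show "connected (inside (path_image c))" using Jordan_inside_outside[OF c] by simp
        show "inside (path_image c) \<subseteq> - path_image c" using inside_no_overlap[of "path_image c"] by blast
      qed (use x y in auto)
      show "connected_component (- ?T) x y"
        unfolding connected_component_def
        using x y \<delta> by (intro exI[of _ "ball w \<delta>"]) auto
    qed
    moreover have op: "open (- (path_image c \<union> ?T))"
      by (intro open_Compl closed_Un compact_imp_closed[OF compJ] clT)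
    ultimately have "path_component (- (path_image c \<union> ?T)) x y"
      by (simp only: open_path_connected_component[OF op])
    then obtain \<gamma> where \<gamma>: "path \<gamma>" "path_image \<gamma> \<subseteq> - (path_image c \<union> ?T)" "pathstart \<gamma> = x" "pathfinish \<gamma> = y"
      unfolding path_component_def by blast
    let ?K = "path_image \<gamma>"
    have xy: "x \<in> ?K" "y \<in> ?K" using \<gamma> by (metis pathstart_in_path_image pathfinish_in_path_image)+
    have conn: "connected ?K" using \<gamma> by (simp add: connected_path_image)
    have "?K \<subseteq> inside (path_image c)"
    proof
      fix z assume "z \<in> ?K"
      then have "connected_component (- path_image c) x z"
        unfolding connected_component_def using conn xy \<gamma>(2) by blast
      then show "z \<in> inside (path_image c)" using inside_same_component x by blast
    qed
    moreover have "?K \<subseteq> ball w \<epsilon>"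
    proof (rule ccontr)
      assume "\<not> ?K \<subseteq> ball w \<epsilon>"
      then have "?K \<inter> frontier (ball w \<epsilon>) \<noteq> {}"
        using xy x \<delta> by (intro connected_Int_frontier[OF conn]) auto
      then show False using \<gamma>(2) \<open>\<epsilon> > 0\<close> by auto
    qed
    ultimately show "\<exists>K. compact K \<and> connected K \<and> x \<in> K \<and> y \<in> K \<and> K \<subseteq> inside (path_image c) \<inter> ball w \<epsilon>"
      using conn xy \<gamma>(1) compact_path_image by blast
  qed
qed

text \<open>Law of cosines. The radial difference accounts for at most a quarter of e^2, so
  \<open>norm a * norm b - Re (cnj a * b)\<close> is at least 3/8 of e^2, and dividing by a product
  of norms below 1 only helps. The bound depends on \<open>e\<close> alone and so can determine a
  number of rotations.\<close>

lemma angle_bound_of_dist: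
  fixes a b :: complex
  assumes "a \<noteq> 0" "b \<noteq> 0" "norm a < 1" "norm b < 1" "\<bar>norm a - norm b\<bar> \<le> e / 2" "e \<le> norm (a - b)" "0 < e"
  shows "Re (cnj a * b) / (norm a * norm b) \<le> 1 - e\<^sup>2 / 4"
proof -
  have "(norm (a - b))\<^sup>2 = (norm a)\<^sup>2 + (norm b)\<^sup>2 - 2 * Re (cnj a * b)"
    unfolding cmod_power2 by (simp add: power2_eq_square algebra_simps)
  also have "\<dots> = (norm a - norm b)\<^sup>2 + 2 * (norm a * norm b - Re (cnj a * b))"
    by (simp add: power2_eq_square algebra_simps)
  finally have eq: "(norm (a - b))\<^sup>2 = (norm a - norm b)\<^sup>2 + 2 * (norm a * norm b - Re (cnj a * b))" .
  have "e\<^sup>2 \<le> (norm (a - b))\<^sup>2" using assms by (intro power_mono) auto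
  moreover have "(norm a - norm b)\<^sup>2 \<le> (e / 2)\<^sup>2" using assms by (intro abs_le_square_iff[THEN iffD1]) auto
  ultimately have "e\<^sup>2 * (3 / 8) \<le> norm a * norm b - Re (cnj a * b)"
    using eq by (simp add: power_divide)
  then have 1: "Re (cnj a * b) \<le> norm a * norm b - e\<^sup>2 * (3 / 8)" by simp
  have ab: "0 < norm a * norm b" "norm a * norm b \<le> 1"
    using assms by (auto intro: mult_le_one)
  have "norm a * norm b * (e\<^sup>2 / 4) \<le> 1 * (e\<^sup>2 / 4)" using ab by (intro mult_right_mono) auto
  also have "\<dots> \<le> e\<^sup>2 * (3 / 8)" by simp
  finally have "Re (cnj a * b) \<le> (1 - e\<^sup>2 / 4) * (norm a * norm b)"
    using 1 by (simp add: algebra_simps)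
  then show ?thesis using ab by (simp add: pos_divide_le_eq)
qed

lemma ex_cos_pi_div_ge:
  assumes "r < 1"
  obtains n :: nat where "2 \<le> n" "r \<le> cos (pi / n)"
proof -
  have "(\<lambda>n. cos (pi / real n)) \<longlonglongrightarrow> cos 0"
    by (intro tendsto_cos tendsto_divide_0[OF tendsto_const] filterlim_at_top_imp_at_infinity filterlim_real_sequentially)
  then have "eventually (\<lambda>n. r < cos (pi / real n)) sequentially"
    using assms by (simp add: order_tendstoD)
  then have "eventually (\<lambda>n. r < cos (pi / real n) \<and> 2 \<le> n) sequentially"
    using eventually_ge_at_top eventually_conj by blast
  then show thesis using that by (metis (mono_tags, lifting) eventually_sequentially less_imp_le order_refl)
qed

section \<open>Continuity of the Riemann map at the boundary\<close>

locale jordan_domain_map =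
  fixes c :: "real \<Rightarrow> complex" and f g :: "complex \<Rightarrow> complex"
  assumes c: "simple_path c" "pathfinish c = pathstart c"
    and holf: "f holomorphic_on ball 0 1" and holg: "g holomorphic_on inside (path_image c)"
    and f_in: "\<And>z. z \<in> ball 0 1 \<Longrightarrow> f z \<in> inside (path_image c)"
    and g_in: "\<And>z. z \<in> inside (path_image c) \<Longrightarrow> g z \<in> ball 0 1"
    and gf: "\<And>z. z \<in> ball 0 1 \<Longrightarrow> g (f z) = z" and fg: "\<And>z. z \<in> inside (path_image c) \<Longrightarrow> f (g z) = z"
begin

abbreviation "J \<equiv> path_image c"
abbreviation "U \<equiv> inside (path_image c)"

lemmas Jordan = Jordan_inside_outside[OF c]

lemma J_U: "J \<inter> U = {}" using inside_no_overlap[of J] by blast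

text \<open>The map \<open>f\<close> sends the closed disc of radius r to a compact subset of
  \<open>U\<close>, and a whole ball about the boundary point \<open>w\<close> misses that
  set.\<close>

lemma g_proper:
  assumes "w \<in> J" "r < 1"
  obtains \<delta> where "\<delta> > 0" "\<And>x. x \<in> U \<inter> ball w \<delta> \<Longrightarrow> r < norm (g x)"
proof -
  have "compact (f ` cball 0 r)"
    by (intro compact_continuous_image holomorphic_on_imp_continuous_on holomorphic_on_subset[OF holf])
      (use assms in auto)
  then have "open (- f ` cball 0 r)" by (simp add: compact_imp_closed open_Compl)
  moreover have "w \<in> - f ` cball 0 r"
    using assms f_in J_U by fastforce
  ultimately obtain \<delta> where \<delta>: "\<delta> > 0" "ball w \<delta> \<subseteq> - f ` cball 0 r"
    using open_contains_ball by blast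
  show thesis
  proof (rule that[OF \<delta>(1)])
    fix x assume x: "x \<in> U \<inter> ball w \<delta>"
    show "r < norm (g x)"
    proof (rule ccontr)
      assume "\<not> r < norm (g x)"
      then have "f (g x) \<in> f ` cball 0 r" by (intro imageI) auto
      then show False using x \<delta>(2) fg[of x] by auto
    qed
  qed
qed

text \<open>The order of the choices carries the argument: \<open>e\<close> determines
  \<open>n\<close>; then \<open>n\<close>, the size of \<open>U\<close> and the distance from
  \<open>f 0\<close> to \<open>w\<close> determine \<epsilon>; only then are the points
  \<open>x\<close>, \<open>y\<close> and the continuum \<open>K\<close> taken within \<epsilon> of
  \<open>w\<close>.\<close>

lemma g_cauchy_at_boundary:
  assumes w: "w \<in> J" and e: "e > 0"
  obtains \<delta> where "\<delta> > 0" "\<And>x y. x \<in> U \<inter> ball w \<delta> \<Longrightarrow> y \<in> U \<inter> ball w \<delta> \<Longrightarrow> dist (g x) (g y) < e"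
proof (rule ccontr)
  assume contra: "\<not> thesis"
  obtain n :: nat where n: "2 \<le> n" "1 - e\<^sup>2 / 4 \<le> cos (pi / n)"
    using ex_cos_pi_div_ge[of "1 - e\<^sup>2 / 4"] e by auto
  have "bounded U" using Jordan by blast
  then have "bounded ((\<lambda>z. z - w) ` U)" by (simp add: bounded_translation_minus)
  then obtain M where M: "\<And>z. z \<in> U \<Longrightarrow> norm (z - w) \<le> M"
    unfolding bounded_iff by auto
  have f0: "f 0 \<in> U" using f_in by simp
  then have f0w: "norm (f 0 - w) > 0" using w J_U by auto
  have M0: "M \<ge> 0" using M[OF f0] norm_ge_zero order_trans by blast
  define q where "q = norm (f 0 - w) ^ (2 * n)"
  define C where "C = M * (M\<^sup>2) ^ (n - 1)"
  have q: "q > 0" using f0w by (simp add: q_def)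
  have C: "C \<ge> 0" using M0 by (simp add: C_def)
  \<comment> \<open>The first bound keeps \<open>f 0\<close> out of the continuum, so that
    \<open>g\<close> has no zero on it; the second makes \<epsilon> * C smaller than
    \<open>q\<close>, which contradicts the sector estimate.\<close>
  define \<epsilon> where "\<epsilon> = min (norm (f 0 - w)) (q / (2 * (C + 1)))"
  have \<epsilon>: "\<epsilon> > 0" using q C f0w by (simp add: \<epsilon>_def)
  obtain \<delta>1 where \<delta>1: "\<delta>1 > 0" "\<And>x y. x \<in> U \<inter> ball w \<delta>1 \<Longrightarrow> y \<in> U \<inter> ball w \<delta>1 \<Longrightarrow>
      \<exists>K. compact K \<and> connected K \<and> x \<in> K \<and> y \<in> K \<and> K \<subseteq> U \<inter> ball w \<epsilon>"
    using inside_loop_locally_connected_at_boundary[OF c w \<epsilon>] by blast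
  obtain \<delta>2 where \<delta>2: "\<delta>2 > 0" "\<And>x. x \<in> U \<inter> ball w \<delta>2 \<Longrightarrow> 1 - e / 2 < norm (g x)"
    using g_proper[OF w, of "1 - e / 2"] e by auto
  have "\<exists>x y. x \<in> U \<inter> ball w (min \<delta>1 \<delta>2) \<and> y \<in> U \<inter> ball w (min \<delta>1 \<delta>2) \<and> e \<le> dist (g x) (g y)"
  proof (rule ccontr)
    assume "\<not> ?thesis"
    then have thesis
      using \<delta>1(1) \<delta>2(1) by (intro that[of "min \<delta>1 \<delta>2"]) (simp, metis not_le)
    with contra show False by blast
  qed
  then obtain x y where x: "x \<in> U \<inter> ball w (min \<delta>1 \<delta>2)" and y: "y \<in> U \<inter> ball w (min \<delta>1 \<delta>2)"
    and xy: "e \<le> dist (g x) (g y)"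
    by blast
  obtain K where K: "compact K" "connected K" "x \<in> K" "y \<in> K" "K \<subseteq> U \<inter> ball w \<epsilon>"
    using \<delta>1(2)[of x y] x y by auto
  define a b where "a = g x" and "b = g y"
  have gK: "g z \<noteq> 0" if "z \<in> K" for z
  proof
    assume "g z = 0"
    then have "z = f 0" using fg[of z] that K by auto
    then show False using that K(5) by (auto simp: \<epsilon>_def dist_norm norm_minus_commute)
  qed
  have ab: "a \<noteq> 0" "b \<noteq> 0" "norm a < 1" "norm b < 1" "1 - e / 2 < norm a" "1 - e / 2 < norm b"
    using gK[of x] gK[of y] K x y g_in[of x] g_in[of y] \<delta>2(2)[of x] \<delta>2(2)[of y] by (auto simp: a_def b_def)
  \<comment> \<open>Multiplication by \<open>cnj u\<close> turns \<open>a\<close> onto the positive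
    real axis, where the sector estimate wants one end of \<sigma>; the factor \<open>u\<close>
    inside \<open>F\<close> undoes the turn.\<close>
  define u where "u = sgn a"
  have u: "norm u = 1" using ab by (simp add: u_def norm_sgn)
  have cu: "cnj u * u = 1" using u by (simp add: complex_norm_square[symmetric] mult.commute)
  define \<sigma> where "\<sigma> = (\<lambda>z. cnj u * g z) ` K"
  define F where "F z = f (u * z) - w" for z
  have contg: "continuous_on K g"
    by (rule holomorphic_on_imp_continuous_on[OF holomorphic_on_subset[OF holg]]) (use K in blast)
  have "norm (F 0) ^ (2 * n) \<le> \<epsilon> * M * (M^2) ^ (n - 1)"
  proof (rule norm_at_centre_le_of_small_on_sector_crossing[where \<sigma> = \<sigma>, OF _ _ n(1)])
    have "(f \<circ> (\<lambda>z. u * z)) holomorphic_on ball 0 1"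
      by (intro holomorphic_on_compose holomorphic_intros holomorphic_on_subset[OF holf])
        (use u in \<open>auto simp: norm_mult\<close>)
    then show "F holomorphic_on ball 0 1"
      unfolding F_def o_def by (intro holomorphic_intros)
    show "norm (F z) \<le> M" if "z \<in> ball 0 1" for z
      using that u by (auto simp: F_def norm_mult intro!: M f_in)
    show "compact \<sigma>" unfolding \<sigma>_def by (intro compact_continuous_image continuous_intros contg K)
    show "connected \<sigma>" unfolding \<sigma>_def by (intro connected_continuous_image continuous_intros contg K)
    show "\<sigma> \<subseteq> ball 0 1" using K g_in u by (fastforce simp: \<sigma>_def norm_mult)
    show "0 \<notin> \<sigma>" using gK u by (auto simp: \<sigma>_def)
    show "norm (F z) \<le> \<epsilon>" if z: "z \<in> \<sigma>" for z
    proof -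
      obtain k where k: "k \<in> K" "z = cnj u * g k" using z by (auto simp: \<sigma>_def)
      have "u * z = g k" using cu k by (metis mult.assoc mult.commute mult_1)
      moreover have "f (g k) = k" using K(5) k fg[of k] by blast
      ultimately have "F z = k - w" by (simp add: F_def)
      then show ?thesis using K(5) k by (auto simp: dist_norm norm_minus_commute)
    qed
    show "cnj u * a \<in> \<sigma>" "cnj u * b \<in> \<sigma>" using K by (auto simp: \<sigma>_def a_def b_def)
    have "a = of_real (norm a) * u"
      using ab(1) by (simp add: u_def sgn_div_norm scaleR_conv_of_real)
    then have "cnj u * a = of_real (norm a) * (cnj u * u)" by (metis mult.left_commute)
    then have "cnj u * a = of_real (norm a)" using cu by simp
    then show "Im (cnj u * a) = 0" "Re (cnj u * a) > 0" using ab by simp_all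
    have "cnj u * b = (cnj a * b) /\<^sub>R norm a"
      by (simp add: u_def sgn_div_norm)
    moreover have "norm (cnj u * b) = norm b" using u by (simp add: norm_mult)
    ultimately have "Re (cnj u * b) / norm (cnj u * b) = Re (cnj a * b) / (norm a * norm b)"
      by (simp add: divide_inverse mult_ac)
    also have "\<dots> \<le> 1 - e\<^sup>2 / 4"
    proof (intro angle_bound_of_dist)
      show "\<bar>norm a - norm b\<bar> \<le> e / 2" using ab by linarith
      show "e \<le> norm (a - b)" using xy by (simp add: a_def b_def dist_norm)
    qed (use ab e in auto)
    also have "\<dots> \<le> cos (pi / n)" by (rule n)
    finally show "Re (cnj u * b) / norm (cnj u * b) \<le> cos (pi / n)" .
  qed
  then have "q \<le> \<epsilon> * C" by (simp add: q_def C_def F_def mult.assoc)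
  also have "\<dots> \<le> q / (2 * (C + 1)) * C" using C by (intro mult_right_mono) (auto simp: \<epsilon>_def)
  also have "\<dots> < q" using q C add_nonneg_pos[of "C * q" "q * 2"] by (simp add: field_simps)
  finally show False by simp
qed

end

section \<open>Extension of the Riemann map to the closure, and its injectivity\<close>

lemma norm_cis_diff_le: "norm (cis a - cis b) \<le> \<bar>a - b\<bar>"
proof -
  have "cis a - cis b = cis b * (cis (a - b) - 1)"
    by (simp add: algebra_simps cis_mult)
  then have "norm (cis a - cis b) = norm (exp (\<i> * of_real (a - b)) - 1)"
    by (simp add: norm_mult cis_conv_exp)
  also have "\<dots> = 2 * \<bar>sin ((a - b) / 2)\<bar>" by (rule dist_exp_i_1)
  also have "\<dots> \<le> \<bar>a - b\<bar>" using abs_sin_x_le_abs_x[of "(a - b) / 2"] by simp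
  finally show ?thesis .
qed

text \<open>The angle from \<open>u\<close> to \<open>v\<close> is rounded down to a multiple of 2
  pi/n. The error is at most one step, and a chord is no longer than its arc.\<close>

lemma ex_rotation_close:
  fixes u v :: complex and n :: nat
  assumes "norm u = norm v" "n > 0"
  obtains k where "k < n" "norm (cis (2 * pi / n) ^ k * u - v) \<le> norm v * (2 * pi / n)"
proof (cases "v = 0")
  case True
  then show thesis using assms that[of 0] by simp
next
  case False
  define x where "x = Arg2pi (v / u)"
  have x: "0 \<le> x" "x < 2 * pi" by (simp_all add: x_def Arg2pi_ge_0 Arg2pi_lt_2pi)
  have "u \<noteq> 0" "norm (v / u) = 1" using assms False by (auto simp: norm_divide)
  then have "v / u = cis x" using Arg2pi_eq[of "v / u"] by (simp add: x_def cis_conv_exp)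
  then have v: "v = cis x * u" using \<open>u \<noteq> 0\<close> by (simp add: field_simps)
  define k where "k = nat \<lfloor>x * n / (2 * pi)\<rfloor>"
  have "0 \<le> x * n / (2 * pi)" using x by simp
  then have k: "real k \<le> x * n / (2 * pi)" "x * n / (2 * pi) < real k + 1"
    by (auto simp: k_def)
  have "x * n / (2 * pi) < n" using x assms(2) by (simp add: field_simps)
  then have "k < n" using k(1) by linarith
  have 1: "real k * (2 * pi / n) \<le> x" "x < (real k + 1) * (2 * pi / n)"
    using k assms(2) by (simp_all add: field_simps)
  define h where "h = 2 * pi / n"
  have "0 \<le> h" "real k * h \<le> x" "x < real k * h + h" using 1 by (simp_all add: h_def distrib_right add_divide_distrib)
  then have "\<bar>real k * h - x\<bar> \<le> h" by linarith
  then have "\<bar>real k * (2 * pi / n) - x\<bar> \<le> 2 * pi / n" by (simp only: h_def)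
  then have "norm (cis (real k * (2 * pi / n)) - cis x) \<le> 2 * pi / n"
    using norm_cis_diff_le order_trans by blast
  moreover have "cis (2 * pi / n) ^ k * u - v = (cis (real k * (2 * pi / n)) - cis x) * u"
    unfolding v Complex.DeMoivre by (simp add: algebra_simps)
  ultimately have "norm (cis (2 * pi / n) ^ k * u - v) \<le> (2 * pi / n) * norm u"
    by (metis norm_mult mult_right_mono norm_ge_zero)
  with \<open>k < n\<close> show thesis using that assms(1) by (simp add: mult.commute)
qed

context jordan_domain_map
begin

lemma closure_U: "closure U = U \<union> J"
  using Jordan by (simp add: closure_Un_frontier)

lemma compact_closure_U: "compact (closure U)"
  using Jordan compact_closure by blast

text \<open>Every point of the compact closure has a ball on which \<open>g\<close> oscillates by
  less than \<open>e\<close>, at interior points by continuity and at boundary points by Koebe's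
  estimate; a Lebesgue number of this cover works for all points at once.\<close>

lemma uniformly_continuous_g: "uniformly_continuous_on U g"
  unfolding uniformly_continuous_on_def
proof (intro allI impI)
  fix e :: real assume e: "e > 0"
  have "\<exists>\<delta>>0. \<forall>x y. x \<in> U \<inter> ball w \<delta> \<longrightarrow> y \<in> U \<inter> ball w \<delta> \<longrightarrow> dist (g x) (g y) < e"
    if w: "w \<in> closure U" for w
  proof (cases "w \<in> U")
    case False
    then have "w \<in> J" using w closure_U by auto
    then show ?thesis using g_cauchy_at_boundary[OF _ e] by metis
  next
    case True
    have "continuous_on U g" using holg by (rule holomorphic_on_imp_continuous_on)
    then obtain d where d: "d > 0" "\<And>x. x \<in> U \<Longrightarrow> dist x w < d \<Longrightarrow> dist (g x) (g w) < e / 2"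
      using True e unfolding continuous_on_iff by (meson half_gt_zero)
    have "dist (g x) (g y) < e" if "x \<in> U \<inter> ball w d" "y \<in> U \<inter> ball w d" for x y
      using d(2)[of x] d(2)[of y] that dist_triangle_half_l[of "g x" "g w" e "g y"]
      by (auto simp: dist_commute)
    then show ?thesis using d(1) by blast
  qed
  then obtain \<delta> where \<delta>: "\<And>w. w \<in> closure U \<Longrightarrow> \<delta> w > 0"
    "\<And>w x y. w \<in> closure U \<Longrightarrow> x \<in> U \<inter> ball w (\<delta> w) \<Longrightarrow> y \<in> U \<inter> ball w (\<delta> w) \<Longrightarrow> dist (g x) (g y) < e"
    by metis
  obtain d where d: "d > 0" "\<And>x. x \<in> closure U \<Longrightarrow> \<exists>G \<in> (\<lambda>w. ball w (\<delta> w)) ` closure U. ball x d \<subseteq> G"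
    by (rule Heine_Borel_lemma[OF compact_closure_U, of "(\<lambda>w. ball w (\<delta> w)) ` closure U"])
      (use \<delta>(1) in auto)
  show "\<exists>d>0. \<forall>x\<in>U. \<forall>x'\<in>U. dist x' x < d \<longrightarrow> dist (g x') (g x) < e"
  proof (intro exI conjI ballI impI, rule d(1))
    fix x y assume xy: "x \<in> U" "y \<in> U" "dist y x < d"
    then obtain w where w: "w \<in> closure U" "ball x d \<subseteq> ball w (\<delta> w)"
      using d(2)[of x] closure_subset by blast
    have "x \<in> ball x d" "y \<in> ball x d" using xy d(1) by (auto simp: dist_commute)
    then have "x \<in> U \<inter> ball w (\<delta> w)" "y \<in> U \<inter> ball w (\<delta> w)" using w(2) xy by blast+
    then show "dist (g y) (g x) < e" using \<delta>(2)[OF w(1)] by blast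
  qed
qed

text \<open>One of the two open arcs of the curve between \<open>w1\<close> and \<open>w2\<close>
  must lie in \<open>P\<close>, since a missing point on each of them would disconnect
  \<open>P\<close>. The rest of the curve is closed and misses the middle of that arc, which gives
  the ball.\<close>

lemma fibre_contains_boundary_piece:
  assumes P: "connected P" "P \<subseteq> J" "w1 \<in> P" "w2 \<in> P" "w1 \<noteq> w2"
  obtains w r where "w \<in> J" "r > 0" "J \<inter> ball w r \<subseteq> P"
proof -
  note goal = that
  obtain c' where c': "simple_path c'" "pathstart c' = w1" "pathfinish c' = w1" "path_image c' = J"
    using simple_loop_from[OF c, of w1] P by blast
  have im: "c' ` {0..1} = J" using c'(4) by (simp add: path_image_def)
  have cont: "continuous_on {0..1} c'" using c'(1) by (simp add: simple_path_def path_def)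
  have w1: "c' 0 = w1" "c' 1 = w1" using c' by (auto simp: pathstart_def pathfinish_def)
  have inj: "s = t \<or> s = 0 \<and> t = 1 \<or> s = 1 \<and> t = 0" if "s \<in> {0..1}" "t \<in> {0..1}" "c' s = c' t" for s t
    using simple_loop_inj_on[OF c'(1-3)] that by blast
  obtain t where t: "t \<in> {0..1}" "w2 = c' t" using P im by blast
  have t01: "0 < t" "t < 1" using t w1 P(5) by (cases "t = 0"; cases "t = 1"; force)+
  have cl: "closed (c' ` {a..b})" if "0 \<le> a" "b \<le> 1" for a b
    by (intro compact_imp_closed compact_continuous_image continuous_on_subset[OF cont]) (use that in auto)
  have piece: thesis if ab: "0 \<le> a" "a < b" "b \<le> 1" and sub: "c' ` {a<..<b} \<subseteq> P" for a b
  proof -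
    define m where "m = (a + b) / 2"
    have m: "a < m" "m < b" "m \<in> {0..1}" using ab by (auto simp: m_def)
    let ?R = "c' ` {0..a} \<union> c' ` {b..1}"
    have "c' m \<noteq> c' s" if "s \<in> {0..a} \<union> {b..1}" for s
    proof
      assume eq: "c' m = c' s"
      have "s \<in> {0..1}" "m \<noteq> 0" "m \<noteq> 1" using that m ab by auto
      then have "m = s" using inj[OF m(3) _ eq] by blast
      then show False using that m by auto
    qed
    then have "c' m \<notin> ?R" by blast
    moreover have "closed ?R" using ab by (intro closed_Un cl) auto
    ultimately obtain r where r: "r > 0" "ball (c' m) r \<subseteq> - ?R"
      by (meson ComplI open_Compl open_contains_ball)
    show thesis
    proof (rule goal[OF _ r(1)])
      show "c' m \<in> J" using im m by blast
      show "J \<inter> ball (c' m) r \<subseteq> P"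
      proof
        fix x assume x: "x \<in> J \<inter> ball (c' m) r"
        then obtain s where s: "s \<in> {0..1}" "x = c' s" using im by blast
        have "\<not> s \<le> a" "\<not> b \<le> s" using x r(2) s by auto
        then show "x \<in> P" using sub s by auto
      qed
    qed
  qed
  show thesis
  proof (cases "c' ` {0<..<t} \<subseteq> P \<or> c' ` {t<..<1} \<subseteq> P")
    case True
    then show thesis using piece[of 0 t] piece[of t 1] t01 by auto
  next
    case False
    then obtain a b where "a \<in> {0<..<t}" "c' a \<notin> P" "b \<in> {t<..<1}" "c' b \<notin> P"
      by blast
    then have a: "0 < a" "a < t" "c' a \<notin> P" and b: "t < b" "b < 1" "c' b \<notin> P"
      by auto
    let ?A = "c' ` {a..b}" and ?B = "c' ` {0..a} \<union> c' ` {b..1}"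
    have "closed ?A" "closed ?B" using a b t01 by (auto intro!: closed_Un cl)
    moreover have "P \<subseteq> ?A \<union> ?B"
    proof
      fix x assume "x \<in> P"
      then obtain s where s: "s \<in> {0..1}" "x = c' s" using P im by blast
      then have "s \<in> {a..b} \<or> s \<in> {0..a} \<or> s \<in> {b..1}" by auto
      then show "x \<in> ?A \<union> ?B" using s by blast
    qed
    moreover have "?A \<inter> ?B \<inter> P = {}"
    proof -
      have "c' s \<noteq> c' s'" if "s \<in> {a..b}" "s' \<in> {0..a} \<union> {b..1}" "c' s \<in> P" for s s'
      proof
        assume eq: "c' s = c' s'"
        have "s \<in> {0..1}" "s' \<in> {0..1}" "s \<noteq> 0" "s \<noteq> 1" using that a b t01 by auto
        then have "s = s'" using inj[OF _ _ eq] by auto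
        then have "s = a \<or> s = b" using that by auto
        then show False using that a b by auto
      qed
      then show ?thesis by blast
    qed
    moreover have "w2 \<in> ?A \<inter> P" using t P a b by auto
    moreover have "w1 \<in> ?B \<inter> P" using w1 P a b by force
    ultimately show thesis using connected_closedD[OF P(1), of ?A ?B] by blast
  qed
qed

text \<open>The product of the functions \<open>G - \<zeta>\<close> over the rotations about a point \<open>z0\<close> close to \<open>w\<close> vanishes
  on the frontier of the set of points all of whose rotates are in the domain: some rotate is on the
  curve near \<open>w\<close>, because a circle about \<open>z0\<close> through an outer point has a whole arc outside.\<close>

lemma not_constant_on_boundary_piece:
  assumes G: "continuous_on (closure U) G" "\<And>x. x \<in> U \<Longrightarrow> G x = g x"
    and w: "w \<in> J" "r > 0" and const: "\<And>x. x \<in> J \<inter> ball w r \<Longrightarrow> G x = \<zeta>" and \<zeta>: "norm \<zeta> = 1"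
  shows False
proof -
  have "w \<in> closure U" "w \<in> closure (outside J)"
    using w closure_U Jordan by (auto simp: closure_Un_frontier)
  \<comment> \<open>The quarters give \<rho> < r / 2, so the disc of radius \<rho> about
    \<open>z0\<close> stays in \<open>ball w r\<close>, where \<open>G\<close> has the value \<zeta>
    on the curve.\<close>
  then obtain z0 e where z0: "z0 \<in> U" "dist z0 w < r / 4" and e: "e \<in> outside J" "dist e w < r / 4"
    using w(2) unfolding closure_approachable by (meson divide_pos_pos zero_less_numeral)
  define \<rho> where "\<rho> = norm (e - z0)"
  have "e \<noteq> z0" using z0 e inside_Int_outside[of J] by blast
  then have \<rho>0: "\<rho> > 0" by (simp add: \<rho>_def)
  have "\<rho> < r / 2" using z0 e dist_triangle_half_l[of e w "r / 2" z0] unfolding \<rho>_def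
    by (simp add: dist_norm norm_minus_commute)
  then have sub: "cball z0 \<rho> \<subseteq> ball w r"
    using z0(2) w(2) by (intro cball_subset_ball_iff[THEN iffD2]) (auto simp: dist_commute)
  have "open (outside J)" using Jordan by simp
  then obtain \<eta> where \<eta>: "\<eta> > 0" "ball e \<eta> \<subseteq> outside J"
    using e(1) by (rule openE)
  \<comment> \<open>With steps shorter than \<eta>, some rotate of every point of the circle through
    \<open>e\<close> comes within \<eta> of \<open>e\<close>, that is, outside the curve.\<close>
  obtain n :: nat where n: "n > 0" "\<rho> * (2 * pi / n) < \<eta>"
  proof -
    obtain n :: nat where "\<rho> * (2 * pi) / \<eta> < n" using reals_Archimedean2[of "\<rho> * (2 * pi) / \<eta>"] by blast
    then have lt: "\<rho> * (2 * pi) < n * \<eta>" using \<eta>(1) by (simp add: pos_divide_less_eq)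
    moreover have "0 < \<rho> * (2 * pi)" using \<rho>0 by simp
    ultimately have "0 < n * \<eta>" by linarith
    then have "n > 0" using \<eta>(1) by (simp add: zero_less_mult_iff)
    moreover have "\<rho> * (2 * pi / n) = \<rho> * (2 * pi) / n" by simp
    then have "\<rho> * (2 * pi / n) < \<eta>"
      using lt \<open>n > 0\<close> by (simp add: pos_divide_less_eq mult.commute)
    ultimately have "n > 0" "\<rho> * (2 * pi / n) < \<eta>" by blast+
    then show thesis using that by blast
  qed
  define \<omega> where "\<omega> = cis (2 * pi / n)"
  define R where "R k z = z0 + \<omega> ^ k * (z - z0)" for k z
  have distR: "dist (R k z) z0 = dist z z0" for k z
    by (simp add: R_def dist_norm norm_mult norm_power \<omega>_def)
  have contR: "continuous_on S (R k)" for S k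
    unfolding R_def by (intro continuous_intros)
  have holR: "R k holomorphic_on S" for S k
    unfolding R_def by (intro holomorphic_intros)
  define \<Omega> where "\<Omega> = (\<Inter>k<n. R k -` (U \<inter> ball z0 \<rho>))"
  have op\<Omega>: "open \<Omega>"
    unfolding \<Omega>_def using Jordan contR by (intro open_INT ballI open_vimage) auto
  have z0\<Omega>: "z0 \<in> \<Omega>" using z0 \<rho>0 by (auto simp: \<Omega>_def R_def)
  have "\<Omega> \<subseteq> R 0 -` ball z0 \<rho>" using n(1) unfolding \<Omega>_def by blast
  then have "\<Omega> \<subseteq> ball z0 \<rho>" by (auto simp: R_def)
  then have bd\<Omega>: "bounded \<Omega>" using bounded_ball bounded_subset by blast
  have clR: "R k z \<in> closure U \<inter> cball z0 \<rho>" if "z \<in> closure \<Omega>" "k < n" for k z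
  proof -
    have "closed (R k -` (closure U \<inter> cball z0 \<rho>))"
      using contR by (intro closed_vimage closed_Int) auto
    moreover have "\<Omega> \<subseteq> R k -` (closure U \<inter> cball z0 \<rho>)"
      using that(2) closure_subset[of U] by (force simp: \<Omega>_def)
    ultimately show ?thesis using that(1) closure_minimal by blast
  qed
  define H where "H z = (\<Prod>k<n. (G (R k z) - \<zeta>))" for z
  have "norm (H z0) \<le> 0"
  proof (rule maximum_modulus_frontier[of H \<Omega>, OF _ _ bd\<Omega> _ z0\<Omega>])
    have "(\<lambda>z. G (R k z)) holomorphic_on \<Omega>" if "k < n" for k
    proof -
      have "(g \<circ> R k) holomorphic_on \<Omega>"
        by (intro holomorphic_on_compose holR holomorphic_on_subset[OF holg]) (use that in \<open>auto simp: \<Omega>_def\<close>)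
      moreover have "G (R k z) = (g \<circ> R k) z" if "z \<in> \<Omega>" for z
        using that \<open>k < n\<close> G(2) by (auto simp: \<Omega>_def)
      ultimately show ?thesis by (metis (mono_tags, lifting) holomorphic_transform)
    qed
    then show "H holomorphic_on interior \<Omega>"
      unfolding H_def interior_open[OF op\<Omega>] by (intro holomorphic_intros) auto
    show "continuous_on (closure \<Omega>) H"
      unfolding H_def using clR
      by (intro continuous_intros continuous_on_compose2[OF G(1) contR]) auto
    fix z assume z: "z \<in> frontier \<Omega>"
    then have zcl: "z \<in> closure \<Omega>" and "z \<notin> \<Omega>" using op\<Omega> by (auto simp: frontier_def interior_open)
    have "\<exists>k<n. R k z \<in> J"
    proof (rule ccontr)
      assume "\<not> ?thesis"
      then have inU: "R k z \<in> U" if "k < n" for k using clR[OF zcl that] closure_U that by auto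
      then obtain k where "k < n" "R k z \<notin> ball z0 \<rho>" using \<open>z \<notin> \<Omega>\<close> by (auto simp: \<Omega>_def)
      then have "norm (z - z0) = norm (e - z0)"
        using clR[OF zcl] distR[of k z] by (force simp: \<rho>_def dist_norm norm_minus_commute)
      then obtain j where j: "j < n" "norm (\<omega> ^ j * (z - z0) - (e - z0)) \<le> norm (e - z0) * (2 * pi / n)"
        using ex_rotation_close[of "z - z0" "e - z0" n] n(1) unfolding \<omega>_def by blast
      then have "dist (R j z) e < \<eta>" using n(2) by (simp add: R_def dist_norm \<rho>_def algebra_simps)
      then have "R j z \<in> outside J" using \<eta>(2) by (auto simp: dist_commute)
      then show False using inU[OF j(1)] inside_Int_outside[of J] by blast
    qed
    then obtain k where k: "k < n" "R k z \<in> J" by blast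
    then have "G (R k z) - \<zeta> = 0" using clR[OF zcl k(1)] sub const by auto
    then show "norm (H z) \<le> 0" using k(1) by (auto simp: H_def)
  qed
  \<comment> \<open>The centre \<open>z0\<close> is fixed by all rotations, so all factors of
    \<open>H z0\<close> are equal and the interior value \<open>g z0\<close> would have norm
    1.\<close>
  then obtain k where "G (R k z0) = \<zeta>" by (auto simp: H_def)
  then have "g z0 = \<zeta>" using G(2) z0 by (simp add: R_def)
  then show False using g_in[OF z0(1)] \<zeta> by auto
qed

lemma extension_homeomorphism:
  obtains G :: "complex \<Rightarrow> complex" where "continuous_on (U \<union> J) G" "inj_on G (U \<union> J)" "G ` (U \<union> J) = cball 0 1" "G ` J = sphere 0 1"
proof -
  obtain G where "uniformly_continuous_on (closure U) G" and Gg: "\<And>x. x \<in> U \<Longrightarrow> g x = G x"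
    using uniformly_continuous_on_extension_on_closure[OF uniformly_continuous_g] by metis
  then have contG: "continuous_on (closure U) G" by (simp add: uniformly_continuous_imp_continuous)
  have GJ_ge: "norm (G w) \<ge> 1" if w: "w \<in> J" for w
  proof (rule ccontr)
    assume "\<not> norm (G w) \<ge> 1"
    then obtain r where r: "norm (G w) < r" "r < 1" using dense not_le by blast
    obtain \<delta> where \<delta>: "\<delta> > 0" "\<And>x. x \<in> U \<inter> ball w \<delta> \<Longrightarrow> r < norm (g x)"
      using g_proper[OF w r(2)] by blast
    have wU: "w \<in> closure U" using w closure_U by auto
    have "r - norm (G w) > 0" using r by simp
    then obtain d where d: "d > 0" "\<And>x. x \<in> closure U \<Longrightarrow> dist x w < d \<Longrightarrow> dist (G x) (G w) < r - norm (G w)"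
      using contG wU unfolding continuous_on_iff by metis
    obtain x where x: "x \<in> U" "dist x w < min d \<delta>"
      using wU d(1) \<delta>(1) unfolding closure_approachable by (metis min_less_iff_conj)
    have "r < norm (G x)" using \<delta>(2)[of x] x Gg by (auto simp: dist_commute)
    moreover have "dist (G x) (G w) < r - norm (G w)" using d(2)[of x] x closure_U by auto
    ultimately show False using norm_triangle_sub[of "G x" "G w"] by (simp add: dist_norm)
  qed
  have Gcl: "G ` closure U \<subseteq> cball 0 1"
    by (rule image_closure_subset[OF contG]) (use Gg g_in in \<open>auto simp: less_imp_le\<close>)
  then have GJ: "norm (G w) = 1" if "w \<in> J" for w
    using GJ_ge[OF that] that closure_U by force
  have GU: "norm (G w) < 1" if "w \<in> U" for w using g_in Gg that by fastforce
  have onto: "G ` closure U = cball 0 1"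
  proof
    have "ball 0 1 \<subseteq> G ` closure U"
    proof
      fix z :: complex assume "z \<in> ball 0 1"
      then have "z = G (f z)" "f z \<in> U" using gf[of z] Gg f_in by auto
      then show "z \<in> G ` closure U" using closure_subset by blast
    qed
    moreover have "closed (G ` closure U)"
      by (intro compact_imp_closed compact_continuous_image contG compact_closure_U)
    ultimately have "closure (ball 0 1) \<subseteq> G ` closure U" by (rule closure_minimal)
    then show "cball 0 1 \<subseteq> G ` closure U" by simp
  qed (rule Gcl)
  have injJ: "w1 = w2" if w12: "w1 \<in> J" "w2 \<in> J" "G w1 = G w2" for w1 w2
  proof (rule ccontr)
    assume ne: "w1 \<noteq> w2"
    define \<zeta> where "\<zeta> = G w1"
    have \<zeta>: "norm \<zeta> = 1" using GJ w12 by (simp add: \<zeta>_def)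
    \<comment> \<open>The part of the disc near \<zeta> is convex, being an intersection of two
      balls, so its image under \<open>f\<close> is connected. The closures shrink exactly to the
      fibre over \<zeta>.\<close>
    define S where "S n = closure (f ` (ball 0 1 \<inter> ball \<zeta> (inverse (Suc n))))" for n
    define P where "P = {w \<in> closure U. G w = \<zeta>}"
    have SU: "S n \<subseteq> closure U" for n
      unfolding S_def using f_in by (intro closure_mono) auto
    have "P = \<Inter>(range S)"
    proof (intro equalityI subsetI)
      fix w assume "w \<in> P"
      then have w: "w \<in> closure U" "G w = \<zeta>" by (auto simp: P_def)
      have "w \<in> S n" for n
        unfolding S_def closure_approachable
      proof (intro allI impI)
        fix e :: real assume "e > 0"
        have "0 < inverse (real (Suc n))" by simp
        then obtain d where d: "d > 0" "\<And>x. x \<in> closure U \<Longrightarrow> dist x w < d \<Longrightarrow> dist (G x) (G w) < inverse (Suc n)"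
          using contG w(1) unfolding continuous_on_iff by metis
        obtain x where x: "x \<in> U" "dist x w < min d e"
          using w(1) d(1) \<open>e > 0\<close> unfolding closure_approachable by (metis min_less_iff_conj)
        have "g x \<in> ball 0 1 \<inter> ball \<zeta> (inverse (Suc n))"
          using d(2)[of x] x g_in[of x] Gg[of x] w(2) closure_U by (auto simp: dist_commute)
        then have "x \<in> f ` (ball 0 1 \<inter> ball \<zeta> (inverse (Suc n)))"
          using fg[OF x(1)] by (metis imageI)
        then show "\<exists>y\<in>f ` (ball 0 1 \<inter> ball \<zeta> (inverse (Suc n))). dist y w < e" using x(2) by auto
      qed
      then show "w \<in> \<Inter>(range S)" by blast
    next
      fix w assume w: "w \<in> \<Inter>(range S)"
      then have wU: "w \<in> closure U" using SU by blast
      have "dist (G w) \<zeta> \<le> inverse (Suc n)" for n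
      proof -
        have "closedin (top_of_set (closure U)) (closure U \<inter> G -` cball \<zeta> (inverse (Suc n)))"
          by (intro continuous_closedin_preimage contG) simp
        then have "closed (closure U \<inter> G -` cball \<zeta> (inverse (Suc n)))"
          using closedin_closed_trans closed_closure by blast
        moreover have "f ` (ball 0 1 \<inter> ball \<zeta> (inverse (Suc n))) \<subseteq> closure U \<inter> G -` cball \<zeta> (inverse (Suc n))"
        proof clarify
          fix z :: complex assume z: "z \<in> ball 0 1" "z \<in> ball \<zeta> (inverse (Suc n))"
          then have "G (f z) = z" "f z \<in> U" using gf[of z] Gg f_in by auto
          then show "f z \<in> closure U \<inter> G -` cball \<zeta> (inverse (Suc n))"
            using z closure_U by (auto simp: less_imp_le)
        qed
        ultimately have "S n \<subseteq> closure U \<inter> G -` cball \<zeta> (inverse (Suc n))"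
          unfolding S_def by (rule closure_minimal[rotated])
        then show ?thesis using w by (auto simp: dist_commute)
      qed
      then have "(\<lambda>n. inverse (real (Suc n))) \<longlonglongrightarrow> 0 \<Longrightarrow> dist (G w) \<zeta> \<le> 0"
        by (intro LIMSEQ_le_const) auto
      then have "dist (G w) \<zeta> \<le> 0" using LIMSEQ_inverse_real_of_nat by blast
      then show "w \<in> P" using wU by (simp add: P_def)
    qed
    moreover have "connected (\<Inter>(range S))"
    proof (rule connected_nest)
      fix n
      have "bounded (S n)" using SU compact_closure_U compact_imp_bounded bounded_subset by blast
      then show "compact (S n)" by (simp add: compact_eq_bounded_closed S_def)
      show "connected (S n)"
        unfolding S_def
        by (intro connected_imp_connected_closure connected_continuous_image convex_connected convex_Int
            holomorphic_on_imp_continuous_on holomorphic_on_subset[OF holf]) auto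
    next
      fix m n :: nat assume "m \<le> n"
      then have "ball \<zeta> (inverse (Suc n)) \<subseteq> ball \<zeta> (inverse (Suc m))"
        by (intro subset_ball) (simp add: le_imp_inverse_le)
      then show "S n \<subseteq> S m" unfolding S_def by (intro closure_mono image_mono) auto
    qed
    ultimately have connP: "connected P" by simp
    have "P \<subseteq> J"
    proof
      fix w assume "w \<in> P"
      then have "w \<in> U \<union> J" "norm (G w) = 1" using \<zeta> closure_U by (auto simp: P_def)
      then show "w \<in> J" using GU[of w] by auto
    qed
    moreover have "w1 \<in> P" "w2 \<in> P" using w12 closure_U by (auto simp: P_def \<zeta>_def)
    ultimately obtain w r where wr: "w \<in> J" "r > 0" "J \<inter> ball w r \<subseteq> P"
      using fibre_contains_boundary_piece[OF connP] ne by metis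
    then show False
    proof (intro not_constant_on_boundary_piece[OF contG _ wr(1,2) _ \<zeta>])
      show "G x = \<zeta>" if "x \<in> J \<inter> ball w r" for x using that wr(3) unfolding P_def by blast
    qed (simp add: Gg)
  qed
  have inj: "inj_on G (closure U)"
  proof (rule inj_onI)
    fix x y assume xy: "x \<in> closure U" "y \<in> closure U" "G x = G y"
    then consider "x \<in> U" "y \<in> U" | "x \<in> J" "y \<in> J" using closure_U GU GJ by (metis Un_iff less_irrefl)
    then show "x = y"
    proof cases
      case 1 then show ?thesis using xy Gg fg by metis
    next
      case 2 then show ?thesis using injJ xy by blast
    qed
  qed
  have "G ` J = sphere 0 1"
  proof
    show "sphere 0 1 \<subseteq> G ` J"
    proof
      fix z :: complex assume z: "z \<in> sphere 0 1"
      then have "z \<in> G ` closure U" using onto by auto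
      then show "z \<in> G ` J" using z GU closure_U by fastforce
    qed
  qed (use GJ in auto)
  with contG inj onto show thesis
    unfolding closure_U by (rule that)
qed

end

theorem Schoenflies_inside:
  fixes c :: "real \<Rightarrow> complex"
  assumes "simple_path c" "pathfinish c = pathstart c"
  obtains G where "continuous_on (inside (path_image c) \<union> path_image c) G"
    "inj_on G (inside (path_image c) \<union> path_image c)"
    "G ` (inside (path_image c) \<union> path_image c) = cball (0::complex) 1"
    "G ` path_image c = sphere 0 1"
proof -
  have J: "inside (path_image c) \<noteq> {}" "open (inside (path_image c))" "bounded (inside (path_image c))"
    using Jordan_inside_outside[OF assms] by auto
  have "simply_connected (inside (path_image c))"
    using assms(1) by (rule simply_connected_inside_simple_path)
  moreover have "inside (path_image c) \<noteq> UNIV" using J(3) not_bounded_UNIV by metis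
  ultimately obtain g f where "g holomorphic_on inside (path_image c)" "f holomorphic_on ball 0 1"
    "\<forall>z \<in> inside (path_image c). g z \<in> ball 0 1 \<and> f (g z) = z"
    "\<forall>z \<in> ball 0 1. f z \<in> inside (path_image c) \<and> g (f z) = z"
    using Riemann_mapping_theorem[of "inside (path_image c)"] J by auto
  then interpret jordan_domain_map c f g
    using assms by unfold_locales auto
  show thesis using extension_homeomorphism that by blast
qed

section \<open>Discs and their chords\<close>

text \<open>Only the forward map is recorded: from a compact set into a Hausdorff space its inverse
  is automatically continuous, and forward maps are easy to glue.\<close>

definition cont_bij :: "('a::topological_space \<Rightarrow> 'b::topological_space) \<Rightarrow> 'a set \<Rightarrow> 'b set \<Rightarrow> bool" where
  "cont_bij f A B \<longleftrightarrow> continuous_on A f \<and> inj_on f A \<and> f ` A = B"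

definition arc_between :: "'a::topological_space set \<Rightarrow> 'a \<Rightarrow> 'a \<Rightarrow> bool" where
  "arc_between S a b \<longleftrightarrow> (\<exists>\<gamma>. arc \<gamma> \<and> path_image \<gamma> = S \<and> pathstart \<gamma> = a \<and> pathfinish \<gamma> = b)"

text \<open>The boundary circle is part of the data, because maps are prescribed on it and chords
  have their ends on it.\<close>

definition disc :: "'a::topological_space set \<Rightarrow> 'a set \<Rightarrow> bool" where
  "disc D J \<longleftrightarrow> J \<subseteq> D \<and> (\<exists>f g. homeomorphism D (cball (0::complex) 1) f g \<and> f ` J = sphere 0 1)"

lemma cont_bij_comp: "cont_bij f A B \<Longrightarrow> cont_bij g B C \<Longrightarrow> cont_bij (g \<circ> f) A C"
  unfolding cont_bij_def by (metis continuous_on_compose comp_inj_on image_comp)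

lemma cont_bij_subset:
  assumes "cont_bij f A B" "S \<subseteq> A" "f ` S = T"
  shows "cont_bij f S T"
  using assms unfolding cont_bij_def by (auto intro: continuous_on_subset inj_on_subset)

lemma homeomorphism_cont_bij: "homeomorphism A B f g \<Longrightarrow> cont_bij f A B \<and> cont_bij g B A"
  unfolding cont_bij_def homeomorphism_def by (metis inj_on_def)

lemma homeomorphism_image_image:
  assumes "homeomorphism A B f g" "S \<subseteq> A"
  shows "g ` f ` S = S"
proof -
  have "g ` f ` S = (\<lambda>x. x) ` S"
    unfolding image_image using assms unfolding homeomorphism_def by (intro image_cong) auto
  then show ?thesis by simp
qed

lemma cont_bij_homeomorphism:
  fixes f :: "'a::topological_space \<Rightarrow> 'b::t2_space"
  assumes "cont_bij f A B" "compact A"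
  obtains g where "homeomorphism A B f g"
  using homeomorphism_compact assms unfolding cont_bij_def by blast

text \<open>Continuity is the pasting lemma for closed sets. For injectivity across the pieces,
  equal values of \<open>f\<close> and \<open>g\<close> lie in both images; by \<open>sub\<close>
  they come from a point of the overlap, and injectivity of each map identifies both arguments with
  that point.\<close>

lemma cont_bij_glue:
  assumes f: "cont_bij f A A'" and g: "cont_bij g B B'" and cl: "closed A" "closed B"
    and eq: "\<And>x. x \<in> A \<inter> B \<Longrightarrow> f x = g x" and sub: "A' \<inter> B' \<subseteq> f ` (A \<inter> B)"
  obtains h where "cont_bij h (A \<union> B) (A' \<union> B')" "\<And>x. x \<in> A \<Longrightarrow> h x = f x" "\<And>x. x \<in> B \<Longrightarrow> h x = g x"
proof -
  define h where "h x = (if x \<in> A then f x else g x)" for x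
  have hA: "h x = f x" if "x \<in> A" for x using that by (simp add: h_def)
  have hB: "h x = g x" if "x \<in> B" for x using that eq by (simp add: h_def)
  have "continuous_on (A \<union> B) h"
    using f g cl hA hB unfolding cont_bij_def
    by (intro continuous_on_closed_Un) (auto cong: continuous_on_cong)
  moreover have "x = y" if x: "x \<in> A" and y: "y \<in> B" and "f x = g y" for x y
  proof -
    have "f x \<in> A'" "g y \<in> B'" using x y f g unfolding cont_bij_def by auto
    then have "f x \<in> A' \<inter> B'" using \<open>f x = g y\<close> by simp
    then obtain z where z: "z \<in> A \<inter> B" "f x = f z" using sub by auto
    then have "x = z" using f x unfolding cont_bij_def inj_on_def by blast
    moreover have "y = z" using g y z \<open>f x = g y\<close> eq[OF z(1)] unfolding cont_bij_def inj_on_def by auto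
    ultimately show ?thesis by simp
  qed
  then have "inj_on h (A \<union> B)"
    using f g hA hB unfolding cont_bij_def inj_on_def by (metis Un_iff)
  moreover have "h ` (A \<union> B) = A' \<union> B'"
    using f g hA hB unfolding cont_bij_def image_Un by (metis image_cong)
  ultimately show thesis using that hA hB unfolding cont_bij_def by blast
qed

lemma arc_betweenD:
  fixes S :: "'a::t2_space set"
  assumes "arc_between S a b"
  shows "compact S" "closed S" "connected S" "a \<in> S" "b \<in> S" "a \<noteq> b" "arc_between S b a"
proof -
  obtain \<gamma> where \<gamma>: "arc \<gamma>" "path_image \<gamma> = S" "pathstart \<gamma> = a" "pathfinish \<gamma> = b"
    using assms by (auto simp: arc_between_def)
  show "compact S" "connected S" using \<gamma> by (auto simp: compact_arc_image connected_arc_image)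
  then show "closed S" by (simp add: compact_imp_closed)
  show "a \<in> S" "b \<in> S" using \<gamma> by (metis pathstart_in_path_image pathfinish_in_path_image)+
  show "a \<noteq> b" using \<gamma> arc_distinct_ends by blast
  show "arc_between S b a"
    unfolding arc_between_def using \<gamma> by (intro exI[of _ "reversepath \<gamma>"]) (simp add: arc_reversepath)
qed

lemma arc_between_interior:
  fixes S :: "'a::t2_space set"
  assumes "arc_between S a b"
  shows "connected (S - {a, b})" "S - {a, b} \<noteq> {}"
proof -
  obtain \<gamma> where \<gamma>: "arc \<gamma>" "path_image \<gamma> = S" "pathstart \<gamma> = a" "pathfinish \<gamma> = b"
    using assms by (auto simp: arc_between_def)
  have inj: "inj_on \<gamma> {0..1}" and cont: "continuous_on {0..1} \<gamma>" using \<gamma> by (auto simp: arc_def path_def)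
  have im: "\<gamma> ` {0..1} = S" "\<gamma> 0 = a" "\<gamma> 1 = b" using \<gamma> by (auto simp: path_image_def pathstart_def pathfinish_def)
  have "\<gamma> ` ({0..1} - {0, 1}) = \<gamma> ` {0..1} - \<gamma> ` {0, 1}"
    by (rule inj_on_image_set_diff[OF inj]) auto
  moreover have "{0..1} - {0, 1} = {0<..<1::real}" by auto
  ultimately have eq: "S - {a, b} = \<gamma> ` {0<..<1}" using im by auto
  show "connected (S - {a, b})"
    unfolding eq by (intro connected_continuous_image continuous_on_subset[OF cont]) auto
  show "S - {a, b} \<noteq> {}" unfolding eq by simp
qed

lemma arc_between_join:
  fixes S :: "'a::t2_space set"
  assumes "arc_between S a b" "arc_between T b c" "S \<inter> T = {b}"
  shows "arc_between (S \<union> T) a c"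
proof -
  obtain \<gamma> \<delta> where \<gamma>: "arc \<gamma>" "path_image \<gamma> = S" "pathstart \<gamma> = a" "pathfinish \<gamma> = b"
    and \<delta>: "arc \<delta>" "path_image \<delta> = T" "pathstart \<delta> = b" "pathfinish \<delta> = c"
    using assms by (auto simp: arc_between_def)
  show ?thesis
    unfolding arc_between_def
    by (rule exI[of _ "\<gamma> +++ \<delta>"]) (use \<gamma> \<delta> assms(3) in \<open>simp add: arc_join path_image_join\<close>)
qed

lemma arc_between_image:
  fixes f :: "'a::topological_space \<Rightarrow> 'b::topological_space"
  assumes "arc_between S a b" "continuous_on S f" "inj_on f S"
  shows "arc_between (f ` S) (f a) (f b)"
proof -
  obtain \<gamma> where \<gamma>: "arc \<gamma>" "path_image \<gamma> = S" "pathstart \<gamma> = a" "pathfinish \<gamma> = b"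
    using assms by (auto simp: arc_between_def)
  have "path (f \<circ> \<gamma>)"
    by (rule path_continuous_image) (use \<gamma> assms in \<open>simp_all add: arc_imp_path\<close>)
  moreover have "inj_on (f \<circ> \<gamma>) {0..1}"
    by (rule comp_inj_on) (use \<gamma> assms in \<open>simp_all add: arc_def path_image_def\<close>)
  ultimately have "arc (f \<circ> \<gamma>)" by (simp add: arc_def)
  then show ?thesis
    unfolding arc_between_def using \<gamma>
    by (intro exI[of _ "f \<circ> \<gamma>"]) (auto simp: path_image_compose pathstart_compose pathfinish_compose)
qed

lemma arc_between_cont_bij:
  fixes S :: "'a::t2_space set" and T :: "'b::t2_space set"
  assumes "arc_between S a b" "arc_between T c d"
  obtains h where "cont_bij h S T" "h a = c" "h b = d"
proof -
  obtain \<gamma> \<delta> where \<gamma>: "arc \<gamma>" "path_image \<gamma> = S" "pathstart \<gamma> = a" "pathfinish \<gamma> = b"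
    and \<delta>: "arc \<delta>" "path_image \<delta> = T" "pathstart \<delta> = c" "pathfinish \<delta> = d"
    using assms by (auto simp: arc_between_def)
  have "cont_bij \<gamma> {0..1} S" using \<gamma> by (auto simp: cont_bij_def arc_def path_def path_image_def)
  then obtain g where g: "homeomorphism {0..1} S \<gamma> g" using cont_bij_homeomorphism by blast
  then have "cont_bij g S {0..1}" by (simp add: homeomorphism_cont_bij)
  moreover have "cont_bij \<delta> {0..1} T" using \<delta> by (auto simp: cont_bij_def arc_def path_def path_image_def)
  ultimately have "cont_bij (\<delta> \<circ> g) S T" by (rule cont_bij_comp)
  moreover have "g a = 0" "g b = 1" using g \<gamma> by (auto simp: homeomorphism_def pathstart_def pathfinish_def)
  ultimately show thesis using that \<delta> by (auto simp: pathstart_def pathfinish_def)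
qed

section \<open>Cutting discs along chords and extending maps over them\<close>

lemma disc_compact: "disc D J \<Longrightarrow> compact D"
  unfolding disc_def by (metis compact_cball homeomorphic_compactness homeomorphic_def)

lemma disc_image:
  fixes h :: "'a::topological_space \<Rightarrow> 'b::t2_space"
  assumes "disc D J" "continuous_on D h" "inj_on h D"
  shows "disc (h ` D) (h ` J)"
proof -
  obtain f g where fg: "J \<subseteq> D" "homeomorphism D (cball (0::complex) 1) f g" "f ` J = sphere 0 1"
    using assms by (auto simp: disc_def)
  obtain k where k: "homeomorphism D (h ` D) h k"
    using homeomorphism_compact[OF disc_compact[OF assms(1)] assms(2) refl assms(3)] by blast
  have "homeomorphism (h ` D) (cball 0 1) (f \<circ> k) (h \<circ> g)"
    using homeomorphism_compose[OF homeomorphism_symD[OF k] fg(2)] .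
  moreover have "(f \<circ> k) ` h ` J = sphere 0 1"
  proof -
    have "k ` h ` J = J" by (rule homeomorphism_image_image[OF k fg(1)])
    then show ?thesis using fg(3) by (simp only: image_comp[symmetric])
  qed
  ultimately show ?thesis
    unfolding disc_def by (intro conjI image_mono fg(1) exI[of _ "f \<circ> k"] exI[of _ "h \<circ> g"])
qed

lemma circle_map_extends_radially:
  fixes \<phi> :: "complex \<Rightarrow> complex"
  assumes "cont_bij \<phi> (sphere 0 1) (sphere 0 1)"
  obtains F where "cont_bij F (cball 0 1) (cball 0 1)" "\<And>x. x \<in> sphere 0 1 \<Longrightarrow> F x = \<phi> x"
proof -
  \<comment> \<open>Alexander's trick. At 0 the factor \<open>norm z\<close> gives the value 0
    whatever \<phi> is there. \<open>F\<close> preserves the norm, which yields continuity at 0 and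
    reduces injectivity to a single circle.\<close>
  define F where "F z = of_real (norm z) * \<phi> (sgn z)" for z
  have \<phi>1: "norm (\<phi> (sgn z)) = 1" if "z \<noteq> 0" for z
    using assms that unfolding cont_bij_def by (metis dist_0_norm imageI mem_sphere norm_sgn)
  have nF: "norm (F z) = norm z" for z
    using \<phi>1[of z] by (cases "z = 0") (auto simp: F_def norm_mult)
  have "continuous_on (- {0}) F"
    unfolding F_def
    by (intro continuous_intros continuous_on_compose2[of "sphere 0 1" \<phi> "- {0}" sgn])
      (use assms in \<open>auto simp: cont_bij_def norm_sgn split: if_split_asm\<close>)
  moreover have "isCont F 0"
    unfolding isCont_def using nF by (auto simp: LIM_def dist_norm F_def[of 0])
  ultimately have contF: "continuous_on S F" for S
    by (metis ComplI continuous_at_imp_continuous_on continuous_on_eq_continuous_at open_Compl closed_singleton singletonD)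
  have "inj_on F (cball 0 1)"
  proof (rule inj_onI)
    fix x y :: complex assume eq: "F x = F y"
    have n: "norm x = norm y" using nF eq by metis
    show "x = y"
    proof (cases "x = 0")
      case False
      then have "y \<noteq> 0" using n by auto
      have "\<phi> (sgn x) = \<phi> (sgn y)" using eq n False by (auto simp: F_def)
      moreover have "sgn x \<in> sphere 0 1" "sgn y \<in> sphere 0 1" using False \<open>y \<noteq> 0\<close> by (auto simp: norm_sgn)
      ultimately have "sgn x = sgn y" using assms unfolding cont_bij_def inj_on_def by blast
      moreover have "z = of_real (norm z) * sgn z" for z :: complex
        by (cases "z = 0") (simp_all add: sgn_div_norm scaleR_conv_of_real)
      ultimately show ?thesis using n by metis
    qed (use n in auto)
  qed
  moreover have "F ` cball 0 1 = cball 0 1"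
  proof
    show "F ` cball 0 1 \<subseteq> cball 0 1" using nF by auto
    show "cball 0 1 \<subseteq> F ` cball 0 1"
    proof
      fix w :: complex assume w: "w \<in> cball 0 1"
      show "w \<in> F ` cball 0 1"
      proof (cases "w = 0")
        case True then show ?thesis by (intro image_eqI[of _ _ 0]) (auto simp: F_def)
      next
        case False
        then have "sgn w \<in> \<phi> ` sphere 0 1" using assms by (simp add: cont_bij_def norm_sgn)
        then obtain u where u: "norm u = 1" "\<phi> u = sgn w" by auto
        then have "sgn u = u" by (simp add: sgn_div_norm)
        with u have "norm (of_real (norm w) * u) = norm w" "sgn (of_real (norm w) * u) = u"
          using False \<open>sgn u = u\<close> by (auto simp: norm_mult sgn_mult sgn_of_real)
        then have "F (of_real (norm w) * u) = of_real (norm w) * \<phi> u"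
          by (simp only: F_def)
        also have "\<dots> = w"
          using u False by (simp add: sgn_div_norm scaleR_conv_of_real)
        finally have "F (of_real (norm w) * u) = w" .
        then show ?thesis using w u by (intro image_eqI[of _ _ "of_real (norm w) * u"]) (auto simp: norm_mult)
      qed
    qed
  qed
  moreover have "F x = \<phi> x" if "x \<in> sphere 0 1" for x
    using that by (simp add: F_def sgn_div_norm)
  ultimately show thesis using that contF unfolding cont_bij_def by blast
qed

lemma disc_extend_boundary:
  fixes D :: "'a::t2_space set" and D' :: "'b::t2_space set"
  assumes "disc D J" "disc D' J'" "cont_bij \<phi> J J'"
  obtains h where "cont_bij h D D'" "\<And>x. x \<in> J \<Longrightarrow> h x = \<phi> x"
proof -
  obtain f g where f: "J \<subseteq> D" "homeomorphism D (cball (0::complex) 1) f g" "f ` J = sphere 0 1"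
    using assms by (auto simp: disc_def)
  obtain f' g' where f': "J' \<subseteq> D'" "homeomorphism D' (cball (0::complex) 1) f' g'" "f' ` J' = sphere 0 1"
    using assms by (auto simp: disc_def)
  have gf: "g (f x) = x" if "x \<in> D" for x using f(2) that by (simp add: homeomorphism_def)
  have gf': "g' (f' x) = x" if "x \<in> D'" for x using f'(2) that by (simp add: homeomorphism_def)
  note cb = conjunct1[OF homeomorphism_cont_bij[OF f(2)]] conjunct2[OF homeomorphism_cont_bij[OF f(2)]]
  note cb' = conjunct1[OF homeomorphism_cont_bij[OF f'(2)]] conjunct2[OF homeomorphism_cont_bij[OF f'(2)]]
  have "g ` sphere 0 1 = J"
    using homeomorphism_image_image[OF f(2,1)] by (simp only: f(3))
  then have "cont_bij g (sphere 0 1) J"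
    by (rule cont_bij_subset[OF cb(2) sphere_cball])
  moreover have "cont_bij f' J' (sphere 0 1)"
    by (rule cont_bij_subset[OF cb'(1) f'(1,3)])
  ultimately have "cont_bij (f' \<circ> (\<phi> \<circ> g)) (sphere 0 1) (sphere 0 1)"
    using assms(3) by (intro cont_bij_comp)
  then obtain F where F: "cont_bij F (cball 0 1) (cball 0 1)" "\<And>x. x \<in> sphere 0 1 \<Longrightarrow> F x = (f' \<circ> (\<phi> \<circ> g)) x"
    using circle_map_extends_radially by blast
  have "cont_bij (g' \<circ> (F \<circ> f)) D D'"
    by (intro cont_bij_comp[OF _ cb'(2)] cont_bij_comp[OF cb(1)] F(1))
  moreover have "(g' \<circ> (F \<circ> f)) x = \<phi> x" if "x \<in> J" for x
  proof -
    have "f x \<in> sphere 0 1" "\<phi> x \<in> D'" using that f(3) assms(3) f'(1) by (auto simp: cont_bij_def)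
    then show ?thesis using F(2) gf[of x] gf' f(1) that by auto
  qed
  ultimately show thesis using that by blast
qed

lemma inside_loop_disc:
  fixes c :: "real \<Rightarrow> complex"
  assumes c: "simple_path c" "pathfinish c = pathstart c"
  shows "disc (inside (path_image c) \<union> path_image c) (path_image c)"
proof -
  let ?D = "inside (path_image c) \<union> path_image c"
  obtain G where G: "continuous_on ?D G" "inj_on G ?D" "G ` ?D = cball (0::complex) 1" "G ` path_image c = sphere 0 1"
    using Schoenflies_inside[OF c] .
  have "frontier (inside (path_image c)) = path_image c" "bounded (inside (path_image c))"
    using Jordan_inside_outside[OF c] by auto
  then have "compact ?D"
    by (metis closure_Un_frontier compact_closure)
  then obtain g where "homeomorphism ?D (cball 0 1) G g"
    using homeomorphism_compact[OF _ G(1,3,2)] by auto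
  then show ?thesis
    unfolding disc_def by (intro conjI Un_upper2 exI[of _ G] exI[of _ g] G(4))
qed

lemma plane_disc_of_arcs:
  fixes \<alpha> \<beta> :: "complex set"
  assumes "arc_between \<alpha> a b" "arc_between \<beta> a b" "\<alpha> \<inter> \<beta> = {a, b}"
  shows "disc (inside (\<alpha> \<union> \<beta>) \<union> (\<alpha> \<union> \<beta>)) (\<alpha> \<union> \<beta>)"
proof -
  obtain p q where p: "arc p" "path_image p = \<alpha>" "pathstart p = a" "pathfinish p = b"
    and q: "arc q" "path_image q = \<beta>" "pathstart q = b" "pathfinish q = a"
    using assms(1) arc_betweenD(7)[OF assms(2)] by (auto simp: arc_between_def)
  have c: "simple_path (p +++ q)" "pathfinish (p +++ q) = pathstart (p +++ q)" "path_image (p +++ q) = \<alpha> \<union> \<beta>"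
    using p q assms(3) by (auto simp: simple_path_join_loop path_image_join)
  show ?thesis using inside_loop_disc[OF c(1,2)] unfolding c(3) .
qed

lemma inside_unit_circle: "inside (sphere 0 1) = ball (0::complex) 1"
  using inside_frontier_eq_interior[of "cball (0::complex) 1"] by simp

text \<open>Carried over to the unit disc, the chord and the two boundary arcs form a theta curve.
  The open disc is then the disjoint union of the open chord and the insides of the two loops that
  the chord forms with the arcs; by the Schoenflies theorem these loops bound discs, which are
  carried back.\<close>

lemma chord_split:
  fixes D :: "'a::t2_space set"
  assumes D: "disc D (\<alpha> \<union> \<beta>)" and \<alpha>: "arc_between \<alpha> a b" and \<beta>: "arc_between \<beta> a b" and \<alpha>\<beta>: "\<alpha> \<inter> \<beta> = {a, b}"
    and \<gamma>: "arc_between \<gamma> a b" "\<gamma> \<subseteq> D" "\<gamma> \<inter> (\<alpha> \<union> \<beta>) = {a, b}"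
  obtains D1 D2 where "disc D1 (\<alpha> \<union> \<gamma>)" "disc D2 (\<beta> \<union> \<gamma>)" "D1 \<union> D2 = D" "D1 \<inter> D2 = \<gamma>"
proof -
  obtain f g where f: "\<alpha> \<union> \<beta> \<subseteq> D" "homeomorphism D (cball (0::complex) 1) f g" "f ` (\<alpha> \<union> \<beta>) = sphere 0 1"
    using D by (auto simp: disc_def)
  have contf: "continuous_on D f" and injf: "inj_on f D" and fD: "f ` D = cball 0 1"
    and contg: "continuous_on (cball 0 1) g" and injg: "inj_on g (cball 0 1)" and gD: "g ` cball 0 1 = D"
    using homeomorphism_cont_bij[OF f(2)] unfolding cont_bij_def by blast+
  have gf: "g ` f ` S = S" if "S \<subseteq> D" for S
    by (rule homeomorphism_image_image[OF f(2) that])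
  have sub: "\<alpha> \<subseteq> D" "\<beta> \<subseteq> D" "\<gamma> \<subseteq> D" using f(1) \<gamma> by auto
  have arcs: "arc_between (f ` S) (f a) (f b)" if "arc_between S a b" "S \<subseteq> D" for S
    by (rule arc_between_image[OF that(1) continuous_on_subset[OF contf that(2)] inj_on_subset[OF injf that(2)]])
  have Int: "f ` S \<inter> f ` T = f ` (S \<inter> T)" if "S \<subseteq> D" "T \<subseteq> D" for S T
    using inj_on_image_Int[OF injf that] by simp
  have ints: "f ` \<alpha> \<inter> f ` \<beta> = {f a, f b}" "f ` \<alpha> \<inter> f ` \<gamma> = {f a, f b}" "f ` \<beta> \<inter> f ` \<gamma> = {f a, f b}"
  proof -
    have "\<alpha> \<inter> \<gamma> = {a, b}" "\<beta> \<inter> \<gamma> = {a, b}"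
      using \<gamma>(3) arc_betweenD(4,5)[OF \<alpha>] arc_betweenD(4,5)[OF \<beta>] by auto
    then show "f ` \<alpha> \<inter> f ` \<beta> = {f a, f b}" "f ` \<alpha> \<inter> f ` \<gamma> = {f a, f b}" "f ` \<beta> \<inter> f ` \<gamma> = {f a, f b}"
      using Int sub \<alpha>\<beta> by auto
  qed
  obtain p1 where p1: "arc p1" "path_image p1 = f ` \<alpha>" "pathstart p1 = f a" "pathfinish p1 = f b"
    using arcs[OF \<alpha> sub(1)] by (auto simp: arc_between_def)
  obtain p2 where p2: "arc p2" "path_image p2 = f ` \<beta>" "pathstart p2 = f a" "pathfinish p2 = f b"
    using arcs[OF \<beta> sub(2)] by (auto simp: arc_between_def)
  obtain p where p: "arc p" "path_image p = f ` \<gamma>" "pathstart p = f a" "pathfinish p = f b"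
    using arcs[OF \<gamma>(1) sub(3)] by (auto simp: arc_between_def)
  have circ: "f ` \<alpha> \<union> f ` \<beta> = sphere 0 1" using f(3) by auto
  have ball: "f ` \<gamma> - {f a, f b} \<subseteq> ball 0 1"
  proof
    fix z assume z: "z \<in> f ` \<gamma> - {f a, f b}"
    have "z \<notin> sphere 0 1"
    proof
      assume "z \<in> sphere 0 1"
      then have "z \<in> f ` \<alpha> \<inter> f ` \<gamma> \<or> z \<in> f ` \<beta> \<inter> f ` \<gamma>"
        using z unfolding circ[symmetric] by simp
      then show False using z unfolding ints by simp
    qed
    moreover have "z \<in> cball 0 1" using z image_mono[OF sub(3), of f] unfolding fD by auto
    ultimately show "z \<in> ball 0 1" by simp
  qed
  have ab_ne: "f a \<noteq> f b" by (rule arc_betweenD(6)[OF arcs[OF \<gamma>(1) sub(3)]])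
  have "f ` \<gamma> - {f a, f b} \<noteq> {}"
    by (rule arc_between_interior(2)[OF arcs[OF \<gamma>(1) sub(3)]])
  with ball have "f ` \<gamma> \<inter> ball 0 1 \<noteq> {}" by blast
  then have ne: "path_image p \<inter> inside (path_image p1 \<union> path_image p2) \<noteq> {}"
    by (simp add: p1 p2 p circ inside_unit_circle)
  have ins: "inside (f ` \<alpha> \<union> f ` \<gamma>) \<inter> inside (f ` \<beta> \<union> f ` \<gamma>) = {} \<and>
    inside (f ` \<alpha> \<union> f ` \<gamma>) \<union> inside (f ` \<beta> \<union> f ` \<gamma>) \<union> (f ` \<gamma> - {f a, f b}) = inside (f ` \<alpha> \<union> f ` \<beta>)"
    by (rule split_inside_simple_closed_curve[OF arc_imp_simple_path[OF p1(1)] p1(3,4)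
          arc_imp_simple_path[OF p2(1)] p2(3,4) arc_imp_simple_path[OF p(1)] p(3,4) ab_ne _ _ _ ne])
      (simp_all only: p1 p2 p ints simp_thms)
  note ins = conjunct1[OF ins] conjunct2[OF ins]
  note ins(2) [unfolded circ inside_unit_circle]
  note ins = ins(1) this
  define E1 where "E1 = inside (f ` \<alpha> \<union> f ` \<gamma>) \<union> (f ` \<alpha> \<union> f ` \<gamma>)"
  define E2 where "E2 = inside (f ` \<beta> \<union> f ` \<gamma>) \<union> (f ` \<beta> \<union> f ` \<gamma>)"
  have E: "disc E1 (f ` \<alpha> \<union> f ` \<gamma>)" "disc E2 (f ` \<beta> \<union> f ` \<gamma>)"
    unfolding E1_def E2_def
    by (rule plane_disc_of_arcs[OF arcs[OF \<alpha> sub(1)] arcs[OF \<gamma>(1) sub(3)] ints(2)],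
        rule plane_disc_of_arcs[OF arcs[OF \<beta> sub(2)] arcs[OF \<gamma>(1) sub(3)] ints(3)])
  have ab: "f a \<in> f ` \<alpha>" "f b \<in> f ` \<alpha>" "f a \<in> f ` \<beta>" "f b \<in> f ` \<beta>"
    using arc_betweenD(4,5)[OF \<alpha>] arc_betweenD(4,5)[OF \<beta>] by auto
  have EU: "E1 \<union> E2 = cball 0 1"
  proof -
    have "E1 \<union> E2 = ball 0 1 \<union> sphere 0 1"
      unfolding E1_def E2_def ins(2)[symmetric, unfolded circ inside_unit_circle] circ[symmetric]
      using ab by auto
    also have "\<dots> = cball 0 1" by force
    finally show ?thesis .
  qed
  have EI: "E1 \<inter> E2 = f ` \<gamma>"
  proof -
    have 1: "inside (f ` \<alpha> \<union> f ` \<gamma>) \<subseteq> ball 0 1" "inside (f ` \<beta> \<union> f ` \<gamma>) \<subseteq> ball 0 1"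
      using ins(2) unfolding circ inside_unit_circle by auto
    have "ball 0 1 \<inter> (f ` \<alpha> \<union> f ` \<beta>) = {}" unfolding circ by auto
    with 1 have "inside (f ` \<alpha> \<union> f ` \<gamma>) \<inter> f ` \<beta> = {}" "inside (f ` \<beta> \<union> f ` \<gamma>) \<inter> f ` \<alpha> = {}"
      by blast+
    moreover have "inside (f ` \<alpha> \<union> f ` \<gamma>) \<inter> f ` \<gamma> = {}" "inside (f ` \<beta> \<union> f ` \<gamma>) \<inter> f ` \<gamma> = {}"
      by (metis Int_Un_distrib inside_no_overlap sup_eq_bot_iff)+
    moreover have "f ` \<alpha> \<inter> f ` \<beta> \<subseteq> f ` \<gamma>"
      unfolding ints using arc_betweenD(4,5)[OF \<gamma>(1)] by auto
    ultimately show ?thesis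
      unfolding E1_def E2_def using ins(1) by auto
  qed
  have Esub: "E1 \<subseteq> cball 0 1" "E2 \<subseteq> cball 0 1" using EU by auto
  have g_union: "g ` (f ` S \<union> f ` T) = S \<union> T" if "S \<subseteq> D" "T \<subseteq> D" for S T
    using gf that by (metis image_Un Un_least)
  have "disc (g ` E1) (\<alpha> \<union> \<gamma>)"
    using disc_image[OF E(1) continuous_on_subset[OF contg Esub(1)] inj_on_subset[OF injg Esub(1)]]
    unfolding g_union[OF sub(1,3)] .
  moreover have "disc (g ` E2) (\<beta> \<union> \<gamma>)"
    using disc_image[OF E(2) continuous_on_subset[OF contg Esub(2)] inj_on_subset[OF injg Esub(2)]]
    unfolding g_union[OF sub(2,3)] .
  moreover have "g ` E1 \<union> g ` E2 = D" using EU gD by (metis image_Un)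
  moreover have "g ` E1 \<inter> g ` E2 = \<gamma>"
    using inj_on_image_Int[OF injg Esub] EI gf[OF sub(3)] by simp
  ultimately show thesis by (rule that)
qed

lemma connected_in_closed_cover:
  assumes "connected S" "closed A" "closed B" "S \<subseteq> A \<union> B" "S \<inter> (A \<inter> B) = {}"
  shows "S \<subseteq> A \<or> S \<subseteq> B"
proof -
  have "A \<inter> S = {} \<or> B \<inter> S = {}"
    by (rule connected_closedD[OF assms(1) _ assms(4,2,3)]) (use assms(5) in blast)
  then show ?thesis using assms(4) by blast
qed

lemma disc_closed:
  fixes D :: "'a::t2_space set"
  shows "disc D J \<Longrightarrow> closed D"
  by (simp add: disc_compact compact_imp_closed)

text \<open>Any map \<theta> between the chords with matching ends, glued to \<phi>, prescribes a
  map on the boundary of each half. The extensions over the halves agree along the chord because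
  both restrict to \<theta>.\<close>

lemma disc_extend_chord:
  fixes D :: "'a::t2_space set" and D' :: "'b::t2_space set"
  assumes D: "disc D (\<alpha> \<union> \<beta>)" "arc_between \<alpha> a b" "arc_between \<beta> a b" "\<alpha> \<inter> \<beta> = {a, b}"
    and \<gamma>: "arc_between \<gamma> a b" "\<gamma> \<subseteq> D" "\<gamma> \<inter> (\<alpha> \<union> \<beta>) = {a, b}"
    and D': "disc D' (\<alpha>' \<union> \<beta>')" "arc_between \<alpha>' a' b'" "arc_between \<beta>' a' b'" "\<alpha>' \<inter> \<beta>' = {a', b'}"
    and \<gamma>': "arc_between \<gamma>' a' b'" "\<gamma>' \<subseteq> D'" "\<gamma>' \<inter> (\<alpha>' \<union> \<beta>') = {a', b'}"
    and \<phi>: "cont_bij \<phi> (\<alpha> \<union> \<beta>) (\<alpha>' \<union> \<beta>')" "\<phi> ` \<alpha> = \<alpha>'" "\<phi> ` \<beta> = \<beta>'" "\<phi> a = a'" "\<phi> b = b'"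
  obtains h where "cont_bij h D D'" "\<And>x. x \<in> \<alpha> \<union> \<beta> \<Longrightarrow> h x = \<phi> x" "h ` \<gamma> = \<gamma>'"
proof -
  obtain D1 D2 where D12: "disc D1 (\<alpha> \<union> \<gamma>)" "disc D2 (\<beta> \<union> \<gamma>)" "D1 \<union> D2 = D" "D1 \<inter> D2 = \<gamma>"
    by (rule chord_split[OF D \<gamma>])
  obtain E1 E2 where E12: "disc E1 (\<alpha>' \<union> \<gamma>')" "disc E2 (\<beta>' \<union> \<gamma>')" "E1 \<union> E2 = D'" "E1 \<inter> E2 = \<gamma>'"
    by (rule chord_split[OF D' \<gamma>'])
  obtain \<theta> where \<theta>: "cont_bij \<theta> \<gamma> \<gamma>'" "\<theta> a = a'" "\<theta> b = b'"
    by (rule arc_between_cont_bij[OF \<gamma>(1) \<gamma>'(1)])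
  have ext: "\<exists>h. cont_bij h F F' \<and> (\<forall>x\<in>\<sigma>. h x = \<phi> x) \<and> (\<forall>x\<in>\<gamma>. h x = \<theta> x)"
    if F: "disc F (\<sigma> \<union> \<gamma>)" "disc F' (\<sigma>' \<union> \<gamma>')" and \<sigma>: "cont_bij \<phi> \<sigma> \<sigma>'" "closed \<sigma>" "\<sigma> \<inter> \<gamma> = {a, b}" "\<sigma>' \<inter> \<gamma>' = {a', b'}"
    for F F' \<sigma> \<sigma>'
  proof -
    obtain k where k: "cont_bij k (\<sigma> \<union> \<gamma>) (\<sigma>' \<union> \<gamma>')" "\<And>x. x \<in> \<sigma> \<Longrightarrow> k x = \<phi> x" "\<And>x. x \<in> \<gamma> \<Longrightarrow> k x = \<theta> x"
      by (rule cont_bij_glue[OF \<sigma>(1) \<theta>(1) \<sigma>(2) arc_betweenD(2)[OF \<gamma>(1)]]) (use \<sigma> \<phi> \<theta> in auto)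
    obtain h where "cont_bij h F F'" "\<And>x. x \<in> \<sigma> \<union> \<gamma> \<Longrightarrow> h x = k x"
      using disc_extend_boundary[OF F k(1)] by blast
    then show ?thesis using k by auto
  qed
  have ints: "\<alpha> \<inter> \<gamma> = {a, b}" "\<beta> \<inter> \<gamma> = {a, b}" "\<alpha>' \<inter> \<gamma>' = {a', b'}" "\<beta>' \<inter> \<gamma>' = {a', b'}"
    using D(4) \<gamma>(3) D'(4) \<gamma>'(3) by auto
  have "cont_bij \<phi> \<alpha> \<alpha>'" "cont_bij \<phi> \<beta> \<beta>'"
    by (rule cont_bij_subset[OF \<phi>(1)]; use \<phi> in simp)+
  note \<phi>s = this
  obtain h1 where h1: "cont_bij h1 D1 E1" "\<And>x. x \<in> \<alpha> \<Longrightarrow> h1 x = \<phi> x" "\<And>x. x \<in> \<gamma> \<Longrightarrow> h1 x = \<theta> x"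
    using ext[OF D12(1) E12(1) \<phi>s(1) arc_betweenD(2)[OF D(2)] ints(1,3)] by blast
  obtain h2 where h2: "cont_bij h2 D2 E2" "\<And>x. x \<in> \<beta> \<Longrightarrow> h2 x = \<phi> x" "\<And>x. x \<in> \<gamma> \<Longrightarrow> h2 x = \<theta> x"
    using ext[OF D12(2) E12(2) \<phi>s(2) arc_betweenD(2)[OF D(3)] ints(2,4)] by blast
  have h1\<gamma>: "h1 ` \<gamma> = \<gamma>'" using \<theta>(1) h1(3) by (simp add: cont_bij_def)
  obtain h where h: "cont_bij h (D1 \<union> D2) (E1 \<union> E2)" "\<And>x. x \<in> D1 \<Longrightarrow> h x = h1 x" "\<And>x. x \<in> D2 \<Longrightarrow> h x = h2 x"
    by (rule cont_bij_glue[OF h1(1) h2(1)])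
      (use D12 E12 h1 h2 h1\<gamma> in \<open>auto intro: disc_closed\<close>)
  show thesis
  proof (rule that[of h])
    show "cont_bij h D D'" using h(1) D12 E12 by simp
    have "\<alpha> \<subseteq> D1" "\<beta> \<subseteq> D2" "\<gamma> \<subseteq> D1" using D12(1,2) by (auto simp: disc_def)
    then show "h x = \<phi> x" if "x \<in> \<alpha> \<union> \<beta>" for x using that h h1 h2 by auto
    show "h ` \<gamma> = \<gamma>'" using h(2) h1\<gamma> \<open>\<gamma> \<subseteq> D1\<close> by (metis image_cong subsetD)
  qed
qed

text \<open>A Jordan curve cut at four marked points in cyclic order. The marks are part of the
  predicate, so that two curves through the same four points can be compared by giving them the same
  marks.\<close>

definition quad :: "'a::topological_space set \<Rightarrow> 'a set \<Rightarrow> 'a set \<Rightarrow> 'a set \<Rightarrow> 'a \<Rightarrow> 'a \<Rightarrow> 'a \<Rightarrow> 'a \<Rightarrow> bool" where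
  "quad A0 A1 A2 A3 q0 q1 q2 q3 \<longleftrightarrow>
     arc_between A0 q0 q1 \<and> arc_between A1 q1 q2 \<and> arc_between A2 q2 q3 \<and> arc_between A3 q3 q0 \<and>
     A0 \<inter> A1 = {q1} \<and> A1 \<inter> A2 = {q2} \<and> A2 \<inter> A3 = {q3} \<and> A3 \<inter> A0 = {q0} \<and> A0 \<inter> A2 = {} \<and> A1 \<inter> A3 = {}"

lemma quadD:
  fixes A0 :: "'a::t2_space set"
  assumes "quad A0 A1 A2 A3 q0 q1 q2 q3"
  shows "arc_between A0 q0 q1" "arc_between A1 q1 q2" "arc_between A2 q2 q3" "arc_between A3 q3 q0"
    "A0 \<inter> A1 = {q1}" "A1 \<inter> A2 = {q2}" "A2 \<inter> A3 = {q3}" "A3 \<inter> A0 = {q0}" "A0 \<inter> A2 = {}" "A1 \<inter> A3 = {}"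
    "q0 \<in> A0" "q1 \<in> A0" "q1 \<in> A1" "q2 \<in> A1" "q2 \<in> A2" "q3 \<in> A2" "q3 \<in> A3" "q0 \<in> A3"
    "distinct [q0, q1, q2, q3]" "A0 \<inter> A3 = {q0}"
proof -
  show arcs: "arc_between A0 q0 q1" "arc_between A1 q1 q2" "arc_between A2 q2 q3" "arc_between A3 q3 q0"
    and ints: "A0 \<inter> A1 = {q1}" "A1 \<inter> A2 = {q2}" "A2 \<inter> A3 = {q3}" "A3 \<inter> A0 = {q0}" "A0 \<inter> A2 = {}" "A1 \<inter> A3 = {}"
    using assms by (auto simp: quad_def)
  show ends: "q0 \<in> A0" "q1 \<in> A0" "q1 \<in> A1" "q2 \<in> A1" "q2 \<in> A2" "q3 \<in> A2" "q3 \<in> A3" "q0 \<in> A3"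
    using arcs arc_betweenD(4,5) by blast+
  show "distinct [q0, q1, q2, q3]" using ints ends by auto
  show "A0 \<inter> A3 = {q0}" using ints(4) by (simp add: Int_commute)
qed

lemma quad_rotate:
  fixes A0 :: "'a::t2_space set"
  assumes "quad A0 A1 A2 A3 q0 q1 q2 q3"
  shows "quad A1 A2 A3 A0 q1 q2 q3 q0"
  using quadD[OF assms] unfolding quad_def by (simp add: Int_commute)

lemma quad_reverse:
  fixes A0 :: "'a::t2_space set"
  assumes "quad A0 A1 A2 A3 q0 q1 q2 q3"
  shows "quad A3 A2 A1 A0 q0 q3 q2 q1"
proof -
  note q = quadD[OF assms]
  show ?thesis
    unfolding quad_def
    using arc_betweenD(7)[OF q(1)] arc_betweenD(7)[OF q(2)] arc_betweenD(7)[OF q(3)] arc_betweenD(7)[OF q(4)] q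
    by (simp add: Int_commute)
qed

text \<open>These are the two ways in which \<open>chord_split\<close> has to see the curve as a
  pair of arcs: for a chord between opposite corners, and for a chord between neighbouring
  ones.\<close>

lemma quad_halves:
  fixes A0 :: "'a::t2_space set"
  assumes "quad A0 A1 A2 A3 q0 q1 q2 q3"
  shows "arc_between (A0 \<union> A1) q0 q2" "arc_between (A2 \<union> A3) q0 q2" "(A0 \<union> A1) \<inter> (A2 \<union> A3) = {q0, q2}"
    "arc_between (A1 \<union> A2 \<union> A3) q0 q1" "A0 \<inter> (A1 \<union> A2 \<union> A3) = {q0, q1}"
proof -
  note q = quadD[OF assms]
  show "arc_between (A0 \<union> A1) q0 q2" by (rule arc_between_join[OF q(1,2,5)])
  show "arc_between (A2 \<union> A3) q0 q2" by (rule arc_betweenD(7)[OF arc_between_join[OF q(3,4,7)]])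
  show "(A0 \<union> A1) \<inter> (A2 \<union> A3) = {q0, q2}"
    by (simp add: Int_Un_distrib Int_Un_distrib2 q(5-10,20) insert_commute)
  have "(A1 \<union> A2) \<inter> A3 = {q3}"
    by (simp add: Int_Un_distrib2 q(5-10))
  from arc_betweenD(7)[OF arc_between_join[OF arc_between_join[OF q(2,3,6)] q(4) this]]
  show "arc_between (A1 \<union> A2 \<union> A3) q0 q1" .
  show "A0 \<inter> (A1 \<union> A2 \<union> A3) = {q0, q1}"
    by (simp add: Int_Un_distrib q(5-10,20) insert_commute)
qed

text \<open>The chord \<gamma> cuts the disc into halves that contain \<open>q1\<close> and
  \<open>q3\<close> respectively and share only \<gamma>. A connected set that avoids \<gamma> stays
  in one half, so \<open>q1\<close> or \<open>q3\<close> would be in both halves, hence on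
  \<gamma>.\<close>

lemma disc_no_crossing_chords:
  fixes D :: "'a::t2_space set"
  assumes q: "quad A0 A1 A2 A3 q0 q1 q2 q3" and D: "disc D (A0 \<union> A1 \<union> A2 \<union> A3)"
    and \<gamma>: "arc_between \<gamma> q0 q2" "\<gamma> \<subseteq> D" "\<gamma> \<inter> (A0 \<union> A1 \<union> A2 \<union> A3) = {q0, q2}"
    and \<delta>: "connected \<delta>" "\<delta> \<subseteq> D" "q1 \<in> \<delta>" "q3 \<in> \<delta>" "\<gamma> \<inter> \<delta> = {}"
  shows False
proof -
  have eq: "A0 \<union> A1 \<union> A2 \<union> A3 = (A0 \<union> A1) \<union> (A2 \<union> A3)" by blast
  obtain D1 D2 where D12: "disc D1 ((A0 \<union> A1) \<union> \<gamma>)" "disc D2 ((A2 \<union> A3) \<union> \<gamma>)" "D1 \<union> D2 = D" "D1 \<inter> D2 = \<gamma>"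
    using chord_split[OF D[unfolded eq] quad_halves(1-3)[OF q] \<gamma>[unfolded eq]] .
  have "\<delta> \<subseteq> D1 \<or> \<delta> \<subseteq> D2"
    using \<delta> D12(3,4)
    by (intro connected_in_closed_cover disc_closed[OF D12(1)] disc_closed[OF D12(2)]) auto
  moreover have "q1 \<in> D1" "q3 \<in> D2" using D12(1,2) quadD[OF q] by (auto simp: disc_def)
  ultimately have "q1 \<in> \<gamma> \<or> q3 \<in> \<gamma>" using D12(4) \<delta>(3,4) by blast
  then show False using \<delta>(3-5) by blast
qed

text \<open>Maps of the single arcs with prescribed ends are glued one at a time. The last arc
  closes the cycle, so its overlap with the others consists of two corners instead of one.\<close>

lemma quad_cont_bij:
  fixes A0 :: "'a::t2_space set" and B0 :: "'b::t2_space set"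
  assumes A: "quad A0 A1 A2 A3 p0 p1 p2 p3" and B: "quad B0 B1 B2 B3 q0 q1 q2 q3"
  obtains \<phi> where "cont_bij \<phi> (A0 \<union> A1 \<union> A2 \<union> A3) (B0 \<union> B1 \<union> B2 \<union> B3)"
    "\<phi> ` A0 = B0" "\<phi> ` A1 = B1" "\<phi> ` A2 = B2" "\<phi> ` A3 = B3"
    "\<phi> p0 = q0" "\<phi> p1 = q1" "\<phi> p2 = q2" "\<phi> p3 = q3"
proof -
  note a = quadD[OF A] and b = quadD[OF B]
  obtain f0 where f0: "cont_bij f0 A0 B0" "f0 p0 = q0" "f0 p1 = q1"
    by (rule arc_between_cont_bij[OF a(1) b(1)])
  obtain f1 where f1: "cont_bij f1 A1 B1" "f1 p1 = q1" "f1 p2 = q2"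
    by (rule arc_between_cont_bij[OF a(2) b(2)])
  obtain f2 where f2: "cont_bij f2 A2 B2" "f2 p2 = q2" "f2 p3 = q3"
    by (rule arc_between_cont_bij[OF a(3) b(3)])
  obtain f3 where f3: "cont_bij f3 A3 B3" "f3 p3 = q3" "f3 p0 = q0"
    by (rule arc_between_cont_bij[OF a(4) b(4)])
  note cl = arc_betweenD(2)[OF a(1)] arc_betweenD(2)[OF a(2)] arc_betweenD(2)[OF a(3)] arc_betweenD(2)[OF a(4)]
  obtain g1 where g1: "cont_bij g1 (A0 \<union> A1) (B0 \<union> B1)" "\<And>x. x \<in> A0 \<Longrightarrow> g1 x = f0 x" "\<And>x. x \<in> A1 \<Longrightarrow> g1 x = f1 x"
    by (rule cont_bij_glue[OF f0(1) f1(1) cl(1,2)]) (use a b f0 f1 in auto)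
  have I2: "(A0 \<union> A1) \<inter> A2 = {p2}" "(B0 \<union> B1) \<inter> B2 = {q2}"
    by (simp_all add: Int_Un_distrib2 a(5-10) b(5-10))
  obtain g2 where g2: "cont_bij g2 (A0 \<union> A1 \<union> A2) (B0 \<union> B1 \<union> B2)"
    "\<And>x. x \<in> A0 \<union> A1 \<Longrightarrow> g2 x = g1 x" "\<And>x. x \<in> A2 \<Longrightarrow> g2 x = f2 x"
    by (rule cont_bij_glue[OF g1(1) f2(1) closed_Un[OF cl(1,2)] cl(3)], unfold I2)
      (use a f1 f2 g1 in auto)
  have I3: "(A0 \<union> A1 \<union> A2) \<inter> A3 = {p3, p0}" "(B0 \<union> B1 \<union> B2) \<inter> B3 = {q3, q0}"
    by (simp_all add: Int_Un_distrib2 a(5-10,20) b(5-10,20) insert_commute)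
  obtain \<phi> where \<phi>: "cont_bij \<phi> (A0 \<union> A1 \<union> A2 \<union> A3) (B0 \<union> B1 \<union> B2 \<union> B3)"
    "\<And>x. x \<in> A0 \<union> A1 \<union> A2 \<Longrightarrow> \<phi> x = g2 x" "\<And>x. x \<in> A3 \<Longrightarrow> \<phi> x = f3 x"
    by (rule cont_bij_glue[OF g2(1) f3(1) closed_Un[OF closed_Un[OF cl(1,2)] cl(3)] cl(4)], unfold I3)
      (use a f0 f2 f3 g1 g2 in auto)
  have e0: "\<phi> x = f0 x" if "x \<in> A0" for x using that \<phi>(2) g2(2) g1(2) by simp
  have e1: "\<phi> x = f1 x" if "x \<in> A1" for x using that \<phi>(2) g2(2) g1(3) by simp
  have e2: "\<phi> x = f2 x" if "x \<in> A2" for x using that \<phi>(2) g2(3) by simp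
  have e3: "\<phi> x = f3 x" if "x \<in> A3" for x using that \<phi>(3) by simp
  show thesis
    by (rule that[OF \<phi>(1)])
      (use f0 f1 f2 f3 e0 e1 e2 e3 a(11-18) in \<open>simp_all add: cont_bij_def cong: image_cong\<close>)
qed

text \<open>\<open>B\<close> cuts off a region along \<open>A0\<close>, and \<open>C\<close> lies in
  the other one because its end \<open>p2\<close> does. There \<open>C\<close> is the only chord,
  with boundary arcs \<open>A2\<close> and \<open>A1 \<union> B \<union> A3\<close>, which is the
  situation of \<open>disc_extend_chord\<close>.\<close>

lemma disc_cut_off_arc:
  fixes D :: "'a::t2_space set"
  assumes A: "quad A0 A1 A2 A3 p0 p1 p2 p3" and J: "J = A0 \<union> A1 \<union> A2 \<union> A3" and D: "disc D J"
    and B: "arc_between B p0 p1" "B \<subseteq> D" "B \<inter> J = {p0, p1}"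
    and C: "arc_between C p2 p3" "C \<subseteq> D" "C \<inter> J = {p2, p3}" and BC: "B \<inter> C = {}"
  obtains D1 D2 where "disc D1 (A0 \<union> B)" "disc D2 (A2 \<union> (A1 \<union> B \<union> A3))" "D1 \<union> D2 = D" "D1 \<inter> D2 = B" "C \<subseteq> D2"
    "arc_between A2 p2 p3" "arc_between (A1 \<union> B \<union> A3) p2 p3" "A2 \<inter> (A1 \<union> B \<union> A3) = {p2, p3}"
    "C \<inter> (A2 \<union> (A1 \<union> B \<union> A3)) = {p2, p3}" "A0 \<inter> B = {p0, p1}" "(A1 \<union> A2 \<union> A3) \<inter> B = {p0, p1}"
proof -
  note a = quadD[OF A] and hv = quad_halves[OF A]
  note b = arc_betweenD[OF B(1)] and c = arc_betweenD[OF C(1)]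
  have eq: "J = A0 \<union> (A1 \<union> A2 \<union> A3)" using J by (simp add: Un_assoc)
  obtain D1 D2 where D12: "disc D1 (A0 \<union> B)" "disc D2 ((A1 \<union> A2 \<union> A3) \<union> B)" "D1 \<union> D2 = D" "D1 \<inter> D2 = B"
    using chord_split[OF D[unfolded eq] a(1) hv(4,5) B(1,2) B(3)[unfolded eq]] .
  have eq2: "(A1 \<union> A2 \<union> A3) \<union> B = A2 \<union> (A1 \<union> B \<union> A3)" by (simp add: Un_ac)
  have "C \<inter> (D1 \<inter> D2) = {}" using BC D12(4) by (simp add: Int_commute)
  then have "C \<subseteq> D1 \<or> C \<subseteq> D2"
    using C(2) D12(3) by (intro connected_in_closed_cover c(3) disc_closed[OF D12(1)] disc_closed[OF D12(2)]) auto
  moreover have p2: "p2 \<in> D2" using D12(2) a(15) by (auto simp: disc_def)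
  moreover have "p2 \<notin> D1"
  proof
    assume "p2 \<in> D1"
    then have "p2 \<in> B \<inter> C" using p2 D12(4) c(4) by auto
    then show False using BC by simp
  qed
  ultimately have CD2: "C \<subseteq> D2" using c(4) by auto
  have I1: "A0 \<inter> B = {p0, p1}"
  proof
    show "A0 \<inter> B \<subseteq> {p0, p1}" using B(3) unfolding J by auto
    show "{p0, p1} \<subseteq> A0 \<inter> B" using a(11,12) b(4,5) by simp
  qed
  have BA: "B \<inter> A1 \<subseteq> {p0, p1}" "B \<inter> A2 \<subseteq> {p0, p1}" "B \<inter> A3 \<subseteq> {p0, p1}"
    using B(3) unfolding J by auto
  have out: "p0 \<notin> A1" "p0 \<notin> A2" "p1 \<notin> A2" "p1 \<notin> A3"
    using a(5,8,9,10,11,12,13,18,19) by auto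
  have A1B: "A1 \<inter> B = {p1}" using BA(1) out(1) a(13) b(5) by auto
  have BA3: "A3 \<inter> B = {p0}" using BA(3) out(4) a(18) b(4) by auto
  have A2B: "A2 \<inter> B = {}" using BA(2) out(2,3) by auto
  have I2: "(A1 \<union> A2 \<union> A3) \<inter> B = {p0, p1}"
    by (simp add: Int_Un_distrib2 A1B BA3 A2B insert_commute)
  have "(A3 \<union> B) \<inter> A1 = {p1}"
    using A1B a(10) by auto
  from arc_betweenD(7)[OF arc_between_join[OF arc_between_join[OF a(4) B(1) BA3] a(2) this]]
  have arc: "arc_between (A1 \<union> B \<union> A3) p2 p3" by (simp add: Un_ac)
  have I3: "A2 \<inter> (A1 \<union> B \<union> A3) = {p2, p3}"
    using a(6,7) A2B by (simp add: Int_Un_distrib Int_commute insert_commute)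
  have I4: "C \<inter> (A2 \<union> (A1 \<union> B \<union> A3)) = {p2, p3}"
  proof
    have "C \<inter> (A2 \<union> (A1 \<union> B \<union> A3)) \<subseteq> C \<inter> J \<union> C \<inter> B" unfolding J by auto
    then show "C \<inter> (A2 \<union> (A1 \<union> B \<union> A3)) \<subseteq> {p2, p3}" using C(3) BC by (simp add: Int_commute)
    show "{p2, p3} \<subseteq> C \<inter> (A2 \<union> (A1 \<union> B \<union> A3))" using c(4,5) a(15,16) by simp
  qed
  show thesis
    by (rule that[OF D12(1) D12(2)[unfolded eq2] D12(3,4) CD2 a(3) arc I3 I4 I1 I2])
qed

text \<open>The cut along \<open>B\<close> leaves one piece without a chord and one with the single
  chord \<open>C\<close>. Both boundary maps use the same \<theta> on \<open>B\<close>, so the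
  extensions over the two pieces agree along the cut.\<close>

lemma disc_extend_two_chords:
  fixes D :: "'a::t2_space set" and D' :: "'b::t2_space set"
  assumes A: "quad A0 A1 A2 A3 p0 p1 p2 p3" and A': "quad A0' A1' A2' A3' q0 q1 q2 q3"
    and J: "J = A0 \<union> A1 \<union> A2 \<union> A3" and J': "J' = A0' \<union> A1' \<union> A2' \<union> A3'"
    and D: "disc D J" and D': "disc D' J'"
    and B: "arc_between B p0 p1" "B \<subseteq> D" "B \<inter> J = {p0, p1}" "arc_between C p2 p3" "C \<subseteq> D" "C \<inter> J = {p2, p3}" "B \<inter> C = {}"
    and B': "arc_between B' q0 q1" "B' \<subseteq> D'" "B' \<inter> J' = {q0, q1}" "arc_between C' q2 q3" "C' \<subseteq> D'" "C' \<inter> J' = {q2, q3}" "B' \<inter> C' = {}"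
    and \<phi>: "cont_bij \<phi> J J'" "\<phi> ` A0 = A0'" "\<phi> ` A1 = A1'" "\<phi> ` A2 = A2'" "\<phi> ` A3 = A3'"
      "\<phi> p0 = q0" "\<phi> p1 = q1" "\<phi> p2 = q2" "\<phi> p3 = q3"
  obtains h where "cont_bij h D D'" "\<And>x. x \<in> J \<Longrightarrow> h x = \<phi> x" "h ` B = B'" "h ` C = C'"
proof -
  obtain D1 D2 where S: "disc D1 (A0 \<union> B)" "disc D2 (A2 \<union> (A1 \<union> B \<union> A3))" "D1 \<union> D2 = D" "D1 \<inter> D2 = B" "C \<subseteq> D2"
      "arc_between A2 p2 p3" "arc_between (A1 \<union> B \<union> A3) p2 p3" "A2 \<inter> (A1 \<union> B \<union> A3) = {p2, p3}"
      "C \<inter> (A2 \<union> (A1 \<union> B \<union> A3)) = {p2, p3}" "A0 \<inter> B = {p0, p1}" "(A1 \<union> A2 \<union> A3) \<inter> B = {p0, p1}"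
    using disc_cut_off_arc[OF A J D B] .
  obtain D1' D2' where S': "disc D1' (A0' \<union> B')" "disc D2' (A2' \<union> (A1' \<union> B' \<union> A3'))" "D1' \<union> D2' = D'" "D1' \<inter> D2' = B'" "C' \<subseteq> D2'"
      "arc_between A2' q2 q3" "arc_between (A1' \<union> B' \<union> A3') q2 q3" "A2' \<inter> (A1' \<union> B' \<union> A3') = {q2, q3}"
      "C' \<inter> (A2' \<union> (A1' \<union> B' \<union> A3')) = {q2, q3}" "A0' \<inter> B' = {q0, q1}" "(A1' \<union> A2' \<union> A3') \<inter> B' = {q0, q1}"
    using disc_cut_off_arc[OF A' J' D' B'] .
  note a = quadD[OF A]
  obtain \<theta> where \<theta>: "cont_bij \<theta> B B'" "\<theta> p0 = q0" "\<theta> p1 = q1"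
    by (rule arc_between_cont_bij[OF B(1) B'(1)])
  note cl = arc_betweenD(2)[OF a(1)] arc_betweenD(2)[OF a(2)] arc_betweenD(2)[OF a(3)] arc_betweenD(2)[OF a(4)]
    arc_betweenD(2)[OF B(1)]
  have \<phi>0: "cont_bij \<phi> A0 A0'" by (rule cont_bij_subset[OF \<phi>(1)]) (use J \<phi> in auto)
  have \<phi>123: "cont_bij \<phi> (A1 \<union> A2 \<union> A3) (A1' \<union> A2' \<union> A3')"
    by (rule cont_bij_subset[OF \<phi>(1)]) (use J \<phi> in \<open>auto simp: image_Un\<close>)
  obtain k1 where k1: "cont_bij k1 (A0 \<union> B) (A0' \<union> B')" "\<And>x. x \<in> A0 \<Longrightarrow> k1 x = \<phi> x" "\<And>x. x \<in> B \<Longrightarrow> k1 x = \<theta> x"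
    by (rule cont_bij_glue[OF \<phi>0 \<theta>(1) cl(1,5)], unfold S(10) S'(10)) (use \<phi> \<theta> in auto)
  obtain k2 where k2: "cont_bij k2 ((A1 \<union> A2 \<union> A3) \<union> B) ((A1' \<union> A2' \<union> A3') \<union> B')"
    "\<And>x. x \<in> A1 \<union> A2 \<union> A3 \<Longrightarrow> k2 x = \<phi> x" "\<And>x. x \<in> B \<Longrightarrow> k2 x = \<theta> x"
    by (rule cont_bij_glue[OF \<phi>123 \<theta>(1) closed_Un[OF closed_Un[OF cl(2,3)] cl(4)] cl(5)], unfold S(11) S'(11))
      (use \<phi> \<theta> in auto)
  obtain h1 where h1: "cont_bij h1 D1 D1'" "\<And>x. x \<in> A0 \<union> B \<Longrightarrow> h1 x = k1 x"
    using disc_extend_boundary[OF S(1) S'(1) k1(1)] by blast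
  have eq: "(A1 \<union> A2 \<union> A3) \<union> B = A2 \<union> (A1 \<union> B \<union> A3)" "(A1' \<union> A2' \<union> A3') \<union> B' = A2' \<union> (A1' \<union> B' \<union> A3')"
    by blast+
  have k2im: "k2 ` A1 = A1'" "k2 ` A2 = A2'" "k2 ` A3 = A3'" "k2 ` B = B'"
    using k2 \<phi> \<theta>(1) by (simp_all add: cont_bij_def cong: image_cong)
  obtain h2 where h2: "cont_bij h2 D2 D2'" "\<And>x. x \<in> A2 \<union> (A1 \<union> B \<union> A3) \<Longrightarrow> h2 x = k2 x" "h2 ` C = C'"
  proof (rule disc_extend_chord[OF S(2,6,7,8) B(4) S(5,9) S'(2,6,7,8) B'(4) S'(5,9) k2(1)[unfolded eq]])
    show "k2 p2 = q2" "k2 p3 = q3" using k2(2) a(11-18) \<phi> by auto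
  qed (simp_all add: k2im image_Un)
  have h1B: "h1 ` B = B'" using h1(2) k1(3) \<theta>(1) by (simp add: cont_bij_def cong: image_cong)
  obtain h where h: "cont_bij h (D1 \<union> D2) (D1' \<union> D2')" "\<And>x. x \<in> D1 \<Longrightarrow> h x = h1 x" "\<And>x. x \<in> D2 \<Longrightarrow> h x = h2 x"
    by (rule cont_bij_glue[OF h1(1) h2(1) disc_closed[OF S(1)]
          disc_closed[OF S(2)]], unfold S(4) S'(4) h1B)
      (use h1(2) h2(2) k1(3) k2(3) in auto)
  have sub: "A0 \<union> B \<subseteq> D1" "A2 \<union> (A1 \<union> B \<union> A3) \<subseteq> D2" using S(1,2) by (auto simp: disc_def)
  show thesis
  proof (rule that[of h])
    show "cont_bij h D D'" using h(1) S(3) S'(3) by simp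
    show "h x = \<phi> x" if "x \<in> J" for x
    proof (cases "x \<in> A0")
      case True
      then have "h x = h1 x" "h1 x = k1 x" "k1 x = \<phi> x" using sub(1) h(2) h1(2) k1(2) by auto
      then show ?thesis by simp
    next
      case False
      then have x: "x \<in> A1 \<union> A2 \<union> A3" using that J by blast
      then have "h x = h2 x" "h2 x = k2 x" "k2 x = \<phi> x" using sub(2) h(3) h2(2) k2(2) by auto
      then show ?thesis by simp
    qed
    have "h ` B = h1 ` B" using h(2) sub(1) by (intro image_cong) auto
    then show "h ` B = B'" using h1B by simp
    have "h ` C = h2 ` C" using h(3) S(5) by (intro image_cong) auto
    then show "h ` C = C'" using h2(3) by simp
  qed
qed

section \<open>Transversal curves on the sphere\<close>

lemma simple_closed_curve_loop:
  assumes "simple_closed_curve C"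
  obtains c where "simple_path c" "pathfinish c = pathstart c" "path_image c = C"
proof -
  obtain f g where fg: "homeomorphism (sphere (0::complex) 1) C f g"
    using assms homeomorphic_sym unfolding simple_closed_curve_def homeomorphic_def by blast
  let ?c = "f \<circ> circlepath 0 1"
  have im: "path_image (circlepath 0 1) = sphere (0::complex) 1" by simp
  have "cont_bij f (sphere 0 1) C" using homeomorphism_cont_bij[OF fg] by simp
  then have f: "continuous_on (sphere 0 1) f" "inj_on f (sphere 0 1)" "f ` sphere 0 1 = C"
    by (auto simp: cont_bij_def)
  show thesis
  proof (rule that[of ?c])
    show "simple_path ?c"
      by (rule simple_path_continuous_image) (use f in \<open>simp_all add: simple_path_circlepath\<close>)
    show "pathfinish ?c = pathstart ?c" by (simp add: pathfinish_compose pathstart_compose)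
    show "path_image ?c = C" by (simp add: path_image_compose f)
  qed
qed

text \<open>The sphere is simply connected and a circle is not. The missed point serves as centre of
  projection.\<close>

lemma simple_closed_curve_misses_point:
  assumes "simple_closed_curve C"
  obtains q where "q \<in> S2" "q \<notin> C"
proof -
  have "\<not> simply_connected C"
    using assms homeomorphic_simply_connected_eq[of C "sphere (0::complex) 1"]
    by (simp add: simple_closed_curve_def simply_connected_sphere_eq)
  moreover have "simply_connected S2" by (simp add: S2_def simply_connected_sphere)
  ultimately have "C \<noteq> S2" by blast
  then show thesis using assms that unfolding simple_closed_curve_def by blast
qed

lemma stereographic_projection:
  assumes "q \<in> S2"
  obtains s t where "homeomorphism (S2 - {q}) (UNIV::complex set) s t"
proof -
  have "S2 - {q} homeomorphic (UNIV::complex set)"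
    unfolding S2_def by (rule homeomorphic_punctured_sphere_affine) (use assms in \<open>auto simp: S2_def aff_dim_UNIV\<close>)
  then show thesis using that unfolding homeomorphic_def by blast
qed

lemma openin_Diff_closed: "closed K \<Longrightarrow> openin (top_of_set S) (S - K)"
  unfolding openin_open by (intro exI[of _ "- K"]) auto

text \<open>Projection from \<open>q\<close> shows the side \<open>I\<close> without
  \<open>q\<close> as the inside of a plane Jordan curve, and the side with \<open>q\<close>,
  punctured there, as its outside. The last conclusion prepares the comparison with a second
  projection, made from a point of \<open>I\<close>.\<close>

lemma curve_disc_avoiding_point:
  assumes C: "simple_closed_curve C" and q: "q \<in> S2" "q \<notin> C"
  obtains I X where "disc (I \<union> C) C" "connected I" "connected X" "I \<noteq> {}" "X \<noteq> {}" "I \<inter> X = {}"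
    "I \<union> X = S2 - C - {q}" "openin (top_of_set S2) I"
    "\<forall>p\<in>I. connected (I - {p}) \<and> \<not> openin (top_of_set S2) {p}"
proof -
  obtain s t where st: "homeomorphism (S2 - {q}) (UNIV::complex set) s t"
    using stereographic_projection[OF q(1)] .
  note hs = homeomorphism_cont_bij[OF st, THEN conjunct1] and ht = homeomorphism_cont_bij[OF st, THEN conjunct2]
  have t: "continuous_on UNIV t" "inj t" "range t = S2 - {q}" using ht by (auto simp: cont_bij_def)
  have s: "continuous_on (S2 - {q}) s" "inj_on s (S2 - {q})" using hs by (auto simp: cont_bij_def)
  obtain c where c: "simple_path c" "pathfinish c = pathstart c" "path_image c = C"
    using simple_closed_curve_loop[OF C] .
  have sub: "C \<subseteq> S2 - {q}" using C q(2) by (auto simp: simple_closed_curve_def)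
  define d where "d = s \<circ> c"
  have d: "simple_path d" "pathfinish d = pathstart d" "path_image d = s ` C"
    unfolding d_def using c continuous_on_subset[OF s(1) sub] inj_on_subset[OF s(2) sub]
    by (auto intro!: simple_path_continuous_image simp: path_image_compose pathstart_compose pathfinish_compose)
  have tsC: "t ` s ` C = C" by (rule homeomorphism_image_image[OF st sub])
  have J: "inside (s ` C) \<noteq> {}" "open (inside (s ` C))" "connected (inside (s ` C))" "outside (s ` C) \<noteq> {}"
    "connected (outside (s ` C))" "inside (s ` C) \<inter> outside (s ` C) = {}" "inside (s ` C) \<union> outside (s ` C) = - s ` C"
    using Jordan_inside_outside[OF d(1,2)] unfolding d(3) by auto
  have contt: "continuous_on S t" for S by (rule continuous_on_subset[OF t(1)]) simp
  have injt: "inj_on t S" for S by (rule inj_on_subset[OF t(2)]) simp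
  define I where "I = t ` inside (s ` C)"
  define X where "X = t ` outside (s ` C)"
  have "disc (inside (s ` C) \<union> s ` C) (s ` C)"
    using inside_loop_disc[OF d(1,2)] unfolding d(3) .
  then have "disc (t ` (inside (s ` C) \<union> s ` C)) (t ` s ` C)"
    by (rule disc_image[OF _ contt injt])
  then have 1: "disc (I \<union> C) C" by (simp add: image_Un tsC I_def)
  have openI: "openin (top_of_set S2) (t ` W)" if "open W" for W
  proof -
    have "openin (top_of_set (S2 - {q})) (t ` W)"
      by (rule homeomorphism_imp_open_map[OF homeomorphism_symD[OF st]]) (simp add: that)
    moreover have "openin (top_of_set S2) (S2 - {q})"
      by (rule openin_Diff_closed) simp
    ultimately show ?thesis by (rule openin_trans)
  qed
  show thesis
  proof (rule that[of I X, OF 1])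
    show "connected I" "connected X" unfolding I_def X_def by (intro connected_continuous_image contt J)+
    show "I \<noteq> {}" "X \<noteq> {}" using J by (auto simp: I_def X_def)
    show "I \<inter> X = {}" unfolding I_def X_def by (simp add: J(6) flip: image_Int[OF t(2)])
    have "I \<union> X = t ` (UNIV - s ` C)" unfolding I_def X_def by (simp add: J(7) Compl_eq_Diff_UNIV flip: image_Un)
    also have "\<dots> = t ` UNIV - t ` s ` C" by (rule image_set_diff[OF t(2)])
    also have "\<dots> = S2 - C - {q}" unfolding tsC t(3) by blast
    finally show "I \<union> X = S2 - C - {q}" .
    show "openin (top_of_set S2) I" unfolding I_def by (rule openI[OF J(2)])
    have "connected (I - {p})" "\<not> openin (top_of_set S2) {p}" if p: "p \<in> I" for p
    proof -
    obtain z where z: "z \<in> inside (s ` C)" "p = t z" using p by (auto simp: I_def)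
    have "I - {p} = t ` (inside (s ` C) - {z})"
      unfolding I_def z(2) using image_set_diff[OF t(2), of "inside (s ` C)" "{z}"] by simp
    moreover have "connected (inside (s ` C) - {z})"
      by (rule connected_open_delete[OF J(2,3)]) simp
    ultimately show "connected (I - {p})" by (simp add: connected_continuous_image contt)
    show "\<not> openin (top_of_set S2) {p}"
    proof
      assume op: "openin (top_of_set S2) {p}"
      have "p \<in> S2 - {q}" using z t(3) by blast
      then have "openin (top_of_set (S2 - {q})) {p}"
        using op by (auto intro: openin_subset_trans)
      then have "openin (top_of_set UNIV) (s ` {p})" by (rule homeomorphism_imp_open_map[OF st])
      then show False by (simp add: not_open_singleton)
    qed
    qed
    then show "\<forall>p\<in>I. connected (I - {p}) \<and> \<not> openin (top_of_set S2) {p}" by blast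
  qed
qed

text \<open>One projection shows only one side to be a disc. The second is made from a point
  \<open>p\<close> of that side, and its inner region \<open>I'\<close> has to be identified with
  the remaining side \<open>W\<close>. This follows because each of the connected sets
  \<open>I - {p}\<close>, \<open>I'\<close> and \<open>X'\<close> lies on a single side of the
  decomposition from the other projection.\<close>

lemma simple_closed_curve_two_discs:
  assumes C: "simple_closed_curve C"
  obtains D E where "disc D C" "disc E C" "D \<union> E = S2" "D \<inter> E = C"
proof -
  have CS: "C \<subseteq> S2" using C by (simp add: simple_closed_curve_def)
  obtain q where q: "q \<in> S2" "q \<notin> C" using simple_closed_curve_misses_point[OF C] .
  obtain I X where I: "disc (I \<union> C) C" "connected I" "connected X" "I \<noteq> {}" "X \<noteq> {}" "I \<inter> X = {}"
    "I \<union> X = S2 - C - {q}" "openin (top_of_set S2) I"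
    "\<forall>p\<in>I. connected (I - {p}) \<and> \<not> openin (top_of_set S2) {p}"
    using curve_disc_avoiding_point[OF C q] .
  obtain p where p: "p \<in> I" using I(4) by blast
  then have p': "p \<in> S2" "p \<notin> C" using I(7) by auto
  obtain I' X' where I': "disc (I' \<union> C) C" "connected I'" "connected X'" "I' \<noteq> {}" "X' \<noteq> {}" "I' \<inter> X' = {}"
    "I' \<union> X' = S2 - C - {p}" "openin (top_of_set S2) I'"
    by (rule curve_disc_avoiding_point[OF C p'])
  define W where "W = S2 - (I \<union> C)"
  have IS: "I \<subseteq> S2" "I \<inter> C = {}" "I' \<subseteq> S2" "I' \<inter> C = {}" using I(7) I'(7) by auto
  have openW: "openin (top_of_set S2) W"
    unfolding W_def by (rule openin_Diff_closed[OF disc_closed[OF I(1)]])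
  have sideW: "S \<subseteq> I \<or> S \<subseteq> W" if S: "connected S" "S \<subseteq> S2 - C" for S
  proof (rule ccontr)
    assume not: "\<not> ?thesis"
    obtain P Q where PQ: "open P" "I = S2 \<inter> P" "open Q" "W = S2 \<inter> Q"
      using I(8) openW by (auto simp: openin_open)
    have "S \<subseteq> P \<union> Q" "P \<inter> Q \<inter> S = {}" "P \<inter> S \<noteq> {}" "Q \<inter> S \<noteq> {}"
      using not S(2) PQ(2,4) unfolding W_def by auto
    then show False using connectedD[OF S(1) PQ(1,3)] by blast
  qed
  have sideI': "S \<subseteq> I' \<or> S \<subseteq> X'" if S: "connected S" "S \<subseteq> S2 - C - {p}" for S
  proof (rule ccontr)
    assume not: "\<not> ?thesis"
    have "openin (top_of_set S2) (S2 - (I' \<union> C))"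
      by (rule openin_Diff_closed[OF disc_closed[OF I'(1)]])
    then obtain P Q where PQ: "open P" "I' = S2 \<inter> P" "open Q" "S2 - (I' \<union> C) = S2 \<inter> Q"
      using I'(8) by (auto simp: openin_open)
    have "S \<subseteq> P \<union> Q" "P \<inter> Q \<inter> S = {}" "P \<inter> S \<noteq> {}" "Q \<inter> S \<noteq> {}"
      using not S(2) PQ(2,4) I'(7) by auto
    then show False using connectedD[OF S(1) PQ(1,3)] by blast
  qed
  have punct: "I - {p} \<subseteq> I' \<or> I - {p} \<subseteq> X'"
    by (rule sideI'[OF conjunct1[OF bspec[OF I(9) p]]]) (use IS in auto)
  have ne: "I - {p} \<noteq> {}"
  proof
    assume "I - {p} = {}"
    then have "I = {p}" using p by blast
    then show False using I(8) I(9) p by simp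
  qed
  \<comment> \<open>Otherwise \<open>I'\<close> would be \<open>I - {p}\<close>, and p would be all
    that is left of the open set \<open>I\<close> after removal of the closed set
    \<open>I' \<union> C\<close>: a relatively open point.\<close>
  have "\<not> I' \<subseteq> I"
  proof
    assume sub: "I' \<subseteq> I"
    have "p \<notin> I'" using I'(7) by blast
    then have "I' \<subseteq> I - {p}" using sub by blast
    then have "I - {p} = I'" using punct I'(4,6) by blast
    then have "{p} = I \<inter> (S2 - (I' \<union> C))" using p IS p' by auto
    moreover have "openin (top_of_set S2) (S2 - (I' \<union> C))"
      by (rule openin_Diff_closed[OF disc_closed[OF I'(1)]])
    ultimately have "openin (top_of_set S2) {p}" using openin_Int[OF I(8)] by simp
    then show False using I(9) p by simp
  qed
  then have I'W: "I' \<subseteq> W" using sideW[OF I'(2)] IS by blast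
  then have "I - {p} \<subseteq> X'" using punct ne unfolding W_def by blast
  moreover have "X' \<subseteq> I \<or> X' \<subseteq> W" by (rule sideW[OF I'(3)]) (use I'(7) in blast)
  ultimately have "X' \<subseteq> I" using ne unfolding W_def by blast
  then have "W \<subseteq> I'" using I'(7) p unfolding W_def by blast
  then have W: "W = I'" using I'W by blast
  show thesis
  proof (rule that[OF I(1) I'(1)])
    show "I \<union> C \<union> (I' \<union> C) = S2" using IS CS unfolding W[symmetric] W_def by blast
    show "(I \<union> C) \<inter> (I' \<union> C) = C" unfolding W[symmetric] W_def by blast
  qed
qed

lemma card_3_sorted:
  fixes T :: "real set"
  assumes "card T = 3"
  obtains t1 t2 t3 where "T = {t1, t2, t3}" "t1 < t2" "t2 < t3"
proof -
  have fin: "finite T" using assms card.infinite by fastforce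
  let ?xs = "sorted_list_of_set T"
  have xs: "sorted_wrt (<) ?xs" "set ?xs = T" "length ?xs = 3"
    using fin assms by (auto simp: strict_sorted_list_of_set)
  then obtain a b c where "?xs = [a, b, c]"
    by (metis (no_types, opaque_lifting) length_0_conv length_Suc_conv numeral_3_eq_3)
  then show thesis using xs that by auto
qed

text \<open>The loop is started at the prescribed \<open>q0\<close>, so that two curves through the
  same points can be marked from a common corner; the other corners are taken in the order of their
  parameters.\<close>

lemma quad_through_four_points:
  assumes C: "simple_closed_curve C" and Q: "Q \<subseteq> C" "card Q = 4" "q0 \<in> Q"
  obtains A0 A1 A2 A3 q1 q2 q3 where "quad A0 A1 A2 A3 q0 q1 q2 q3" "C = A0 \<union> A1 \<union> A2 \<union> A3" "Q = {q0, q1, q2, q3}"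
proof -
  obtain c0 where c0: "simple_path c0" "pathfinish c0 = pathstart c0" "path_image c0 = C"
    using simple_closed_curve_loop[OF C] .
  have "q0 \<in> path_image c0" using Q c0(3) by blast
  then obtain c where c: "simple_path c" "pathstart c = q0" "pathfinish c = q0" "path_image c = C"
    using simple_loop_from[OF c0(1,2)] unfolding c0(3) by metis
  have im: "c ` {0..1} = C" and c01: "c 0 = q0" "c 1 = q0"
    using c by (auto simp: path_image_def pathstart_def pathfinish_def)
  have inj: "u = v \<or> u = 0 \<and> v = 1 \<or> u = 1 \<and> v = 0" if "u \<in> {0..1}" "v \<in> {0..1}" "c u = c v" for u v
    using simple_loop_inj_on[OF c(1-3)] that by blast
  define T where "T = {t \<in> {0<..<1}. c t \<in> Q}"
  have "inj_on c T"
  proof (rule inj_onI)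
    fix u v assume "u \<in> T" "v \<in> T" "c u = c v"
    then show "u = v" using inj[of u v] by (auto simp: T_def)
  qed
  moreover have cT: "c ` T = Q - {q0}"
  proof
    show "c ` T \<subseteq> Q - {q0}"
    proof
      fix x assume "x \<in> c ` T"
      then obtain t where t: "0 < t" "t < 1" "c t \<in> Q" "x = c t" by (auto simp: T_def)
      have "c t \<noteq> c 0" using inj[of t 0] t by auto
      then show "x \<in> Q - {q0}" using t c01 by simp
    qed
    show "Q - {q0} \<subseteq> c ` T"
    proof
      fix x assume x: "x \<in> Q - {q0}"
      then obtain t where t: "t \<in> {0..1}" "x = c t" using Q(1) im by blast
      then have "t \<noteq> 0" "t \<noteq> 1" using x c01 by auto
      then show "x \<in> c ` T" using t x by (auto simp: T_def)
    qed
  qed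
  ultimately have "card T = card (Q - {q0})" using card_image by metis
  also have "\<dots> = 3" using Q by simp
  finally obtain t1 t2 t3 where T: "T = {t1, t2, t3}" "t1 < t2" "t2 < t3"
    by (rule card_3_sorted)
  have t: "0 < t1" "t3 < 1" using T by (auto simp: T_def)
  \<comment> \<open>Parameters 0 and 1 are the only two with the same image. The last side
    condition, here and in the next two facts, keeps them from occurring together.\<close>
  have arc: "arc_between (c ` {u..v}) (c u) (c v)" if "0 \<le> u" "u < v" "v \<le> 1" "0 < u \<or> v < 1" for u v
  proof -
    have "c u \<noteq> c v" using inj[of u v] that by auto
    then have "arc (subpath u v c)" using that by (intro arc_simple_path_subpath c(1)) auto
    moreover have "path_image (subpath u v c) = c ` {u..v}" using that by (simp add: path_image_subpath)
    ultimately show ?thesis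
      unfolding arc_between_def by (intro exI[of _ "subpath u v c"]) (simp add: pathstart_subpath pathfinish_subpath)
  qed
  have meet: "c ` {u..v} \<inter> c ` {v..w} = {c v}" if "0 \<le> u" "u \<le> v" "v \<le> w" "w \<le> 1" "0 < u \<or> w < 1" for u v w
  proof
    show "c ` {u..v} \<inter> c ` {v..w} \<subseteq> {c v}"
    proof
      fix x assume "x \<in> c ` {u..v} \<inter> c ` {v..w}"
      then obtain r r' where r: "r \<in> {u..v}" "r' \<in> {v..w}" "x = c r" "x = c r'" by auto
      then have "r = r' \<or> r = 0 \<and> r' = 1 \<or> r = 1 \<and> r' = 0" using that by (intro inj) auto
      then have "r = v \<or> r' = v" using r that by auto
      then show "x \<in> {c v}" using r by auto
    qed
    show "{c v} \<subseteq> c ` {u..v} \<inter> c ` {v..w}" using that by auto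
  qed
  have disj: "c ` {u..v} \<inter> c ` {u'..v'} = {}" if "0 \<le> u" "v < u'" "v' \<le> 1" "0 < u \<or> v' < 1" "u \<le> v" "u' \<le> v'" for u v u' v'
  proof (rule ccontr)
    assume "\<not> ?thesis"
    then obtain x where "x \<in> c ` {u..v}" "x \<in> c ` {u'..v'}" by blast
    then obtain r r' where r: "r \<in> {u..v}" "r' \<in> {u'..v'}" "c r = c r'" by (metis imageE)
    then have "r = r' \<or> r = 0 \<and> r' = 1 \<or> r = 1 \<and> r' = 0" using that by (intro inj) auto
    then show False using r that by auto
  qed
  have last: "c ` {t3..1} \<inter> c ` {0..t1} = {c 0}"
  proof
    show "c ` {t3..1} \<inter> c ` {0..t1} \<subseteq> {c 0}"
    proof
      fix x assume "x \<in> c ` {t3..1} \<inter> c ` {0..t1}"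
      then obtain r r' where r: "r \<in> {t3..1}" "r' \<in> {0..t1}" "x = c r" "x = c r'" by auto
      then have "r = r' \<or> r = 0 \<and> r' = 1 \<or> r = 1 \<and> r' = 0" using t T by (intro inj) auto
      then show "x \<in> {c 0}" using r t T c01 by auto
    qed
    show "{c 0} \<subseteq> c ` {t3..1} \<inter> c ` {0..t1}"
    proof -
      have "c 0 = c 1" using c01 by simp
      then have "c 0 \<in> c ` {t3..1}" using t by (intro image_eqI[of _ c 1]) auto
      moreover have "c 0 \<in> c ` {0..t1}" using t by auto
      ultimately show ?thesis by simp
    qed
  qed
  have "quad (c ` {0..t1}) (c ` {t1..t2}) (c ` {t2..t3}) (c ` {t3..1}) (c 0) (c t1) (c t2) (c t3)"
    unfolding quad_def
  proof (intro conjI)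
    show "arc_between (c ` {t3..1}) (c t3) (c 0)" using arc[of t3 1] c01 t T by simp
    show "c ` {t3..1} \<inter> c ` {0..t1} = {c 0}" by (rule last)
  qed (rule arc meet disj; use t T in simp)+
  moreover have "C = c ` {0..t1} \<union> c ` {t1..t2} \<union> c ` {t2..t3} \<union> c ` {t3..1}"
  proof -
    have "{0..1} = {0..t1} \<union> {t1..t2} \<union> {t2..t3} \<union> {t3..1}" using t T by auto
    then show ?thesis unfolding im[symmetric] by (metis image_Un)
  qed
  moreover have "Q = {c 0, c t1, c t2, c t3}" using cT Q(3) c01 unfolding T by auto
  ultimately show thesis using that c01 by metis
qed

text \<open>In the model disc the boundary point is moved a little along its radius towards the
  centre.\<close>

lemma disc_boundary_limit:
  fixes D :: "'a::t2_space set"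
  assumes "disc D J" "q \<in> J" "open V" "q \<in> V"
  obtains x where "x \<in> V" "x \<in> D - J"
proof -
  obtain f g where f: "J \<subseteq> D" "homeomorphism D (cball (0::complex) 1) f g" "f ` J = sphere 0 1"
    using assms(1) by (auto simp: disc_def)
  have contg: "continuous_on (cball 0 1) g" and gD: "g ` cball 0 1 = D"
    and gf: "\<And>x. x \<in> D \<Longrightarrow> g (f x) = x" and fg: "\<And>x. x \<in> cball 0 1 \<Longrightarrow> f (g x) = x"
    using f(2) by (auto simp: homeomorphism_def)
  have fq: "norm (f q) = 1" "g (f q) = q" using assms(2) f(1,3) gf by auto
  obtain T where T: "open T" "T \<inter> cball 0 1 = g -` V \<inter> cball 0 1"
    using contg assms(3) unfolding continuous_on_open_invariant by blast
  have "f q \<in> g -` V \<inter> cball 0 1" using fq assms(4) by simp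
  then have "f q \<in> T" unfolding T(2)[symmetric] by simp
  then obtain e where e: "e > 0" "ball (f q) e \<subseteq> T" using openE[OF T(1)] by blast
  define r where "r = min (1/2) (e / 2)"
  have r: "0 < r" "r < 1" "r < e" using e(1) by (auto simp: r_def min_def)
  define z where "z = (1 - r) *\<^sub>R f q"
  have nz: "norm z = 1 - r" using r fq by (simp add: z_def)
  have "f q - z = r *\<^sub>R f q" by (simp add: z_def scaleR_diff_left)
  then have "dist (f q) z = r" using r fq by (simp add: dist_norm)
  then have "z \<in> T" using r e(2) by auto
  then have "z \<in> T \<inter> cball 0 1" using nz r by simp
  then have zV: "g z \<in> V" unfolding T(2) by simp
  have "f (g z) = z" using fg nz r by simp
  have "g z \<notin> J"
  proof
    assume "g z \<in> J"
    then have "f (g z) \<in> sphere 0 1" using f(3) by blast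
    then show False using \<open>f (g z) = z\<close> nz r by simp
  qed
  moreover have "g z \<in> D" using gD nz r by (metis diff_le_eq imageI le_add_same_cancel1 less_imp_le mem_cball_0)
  ultimately show thesis using that[OF zV] by simp
qed

text \<open>In a transversal chart \<open>C1\<close> is the real axis, so each open half disc misses
  \<open>C1\<close> and lies entirely in \<open>D\<close> or in \<open>E\<close>. Points of
  \<open>D\<close> off \<open>C1\<close> accumulate at \<open>q\<close>, hence one half lies in
  \<open>D\<close>; and \<open>C2\<close>, the imaginary axis, enters either half arbitrarily close
  to \<open>q\<close>.\<close>

lemma transversal_crosses:
  assumes CDE: "C1 = D \<inter> E" "D \<union> E = S2" "disc D C1" "disc E C1" and q: "q \<in> C1"
    and tr: "transversal_at C1 C2 q" and V: "open V" "q \<in> V"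
  obtains x where "x \<in> C2" "x \<in> V" "x \<in> D" "x \<notin> C1"
proof -
  obtain U \<phi> \<psi> where U: "openin (top_of_set S2) U" "q \<in> U" and h: "homeomorphism U (ball (0::complex) 1) \<phi> \<psi>"
    and \<phi>0: "\<phi> q = 0" and im1: "\<phi> ` (C1 \<inter> U) = {z \<in> ball 0 1. Im z = 0}" and im2: "\<phi> ` (C2 \<inter> U) = {z \<in> ball 0 1. Re z = 0}"
    using tr unfolding transversal_at_def by blast
  have cont\<psi>: "continuous_on (ball 0 1) \<psi>" and \<psi>U: "\<psi> ` ball 0 1 = U" and \<phi>U: "\<phi> ` U = ball 0 1"
    and \<psi>\<phi>: "\<And>x. x \<in> U \<Longrightarrow> \<psi> (\<phi> x) = x" and \<phi>\<psi>: "\<And>z. z \<in> ball 0 1 \<Longrightarrow> \<phi> (\<psi> z) = z"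
    using h by (auto simp: homeomorphism_def)
  have US: "U \<subseteq> S2" using U(1) openin_imp_subset by blast
  have not1: "\<psi> z \<notin> C1" if z: "z \<in> ball 0 1" "Im z \<noteq> 0" for z
  proof
    assume "\<psi> z \<in> C1"
    moreover have "\<psi> z \<in> U" using z \<psi>U by blast
    ultimately have "\<phi> (\<psi> z) \<in> {z \<in> ball 0 1. Im z = 0}" using im1 by blast
    then show False using z \<phi>\<psi> by simp
  qed
  have in2: "\<psi> z \<in> C2" if z: "z \<in> ball 0 1" "Re z = 0" for z
  proof -
    have "z \<in> \<phi> ` (C2 \<inter> U)" using z im2 by simp
    then obtain x where "x \<in> C2" "x \<in> U" "z = \<phi> x" by blast
    then show ?thesis using \<psi>\<phi> by simp
  qed
  define half where "half \<epsilon> = {z \<in> ball 0 1. 0 < \<epsilon> * Im z}" for \<epsilon> :: real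
  have side: "\<psi> ` half \<epsilon> \<subseteq> D \<or> \<psi> ` half \<epsilon> \<subseteq> E" for \<epsilon>
  proof (rule connected_in_closed_cover)
    have "half \<epsilon> = ball 0 1 \<inter> {z. inner (\<i> * of_real \<epsilon>) z > 0}"
      by (auto simp: half_def inner_complex_def)
    then have "convex (half \<epsilon>)" by (simp add: convex_Int convex_halfspace_gt)
    moreover have "half \<epsilon> \<subseteq> ball 0 1" by (auto simp: half_def)
    ultimately show "connected (\<psi> ` half \<epsilon>)"
      using continuous_on_subset[OF cont\<psi>] convex_connected connected_continuous_image by blast
    show "\<psi> ` half \<epsilon> \<subseteq> D \<union> E" unfolding CDE(2) using \<psi>U US \<open>half \<epsilon> \<subseteq> ball 0 1\<close> by blast
    show "\<psi> ` half \<epsilon> \<inter> (D \<inter> E) = {}"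
      unfolding CDE(1)[symmetric] using not1 by (fastforce simp: half_def)
  qed (use CDE disc_closed in blast)+
  obtain T where T: "open T" "U = S2 \<inter> T" using U(1) by (auto simp: openin_open)
  have qT: "q \<in> T" using U(2) T(2) by simp
  obtain y where y: "y \<in> T" "y \<in> D - C1" using disc_boundary_limit[OF CDE(3) q T(1) qT] by blast
  have "y \<in> U" using y T(2) CDE(2) by blast
  then have y1: "\<phi> y \<in> ball 0 1" "\<psi> (\<phi> y) = y" using \<phi>U \<psi>\<phi> by auto
  have "Im (\<phi> y) \<noteq> 0"
  proof
    assume "Im (\<phi> y) = 0"
    then have "\<phi> y \<in> \<phi> ` (C1 \<inter> U)" unfolding im1 using y1(1) by simp
    then obtain x where "x \<in> C1" "x \<in> U" "\<phi> y = \<phi> x" by blast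
    then have "y = x" using y1(2) \<psi>\<phi> by metis
    then show False using \<open>x \<in> C1\<close> y by simp
  qed
  \<comment> \<open>The sign selects the half disc that contains the image of \<open>y\<close>:
    upper for 1, lower for -1.\<close>
  then obtain \<epsilon> :: real where \<epsilon>: "\<epsilon> = 1 \<or> \<epsilon> = -1" "0 < \<epsilon> * Im (\<phi> y)"
    by (metis linorder_neqE_linordered_idom mult_1 mult_minus1 neg_0_less_iff_less)
  then have "y \<in> \<psi> ` half \<epsilon>" using y1 by (metis (no_types, lifting) half_def image_eqI mem_Collect_eq)
  moreover have "y \<notin> E" using y CDE(1) by blast
  ultimately have sub: "\<psi> ` half \<epsilon> \<subseteq> D" using side by blast
  have "\<psi> 0 = q" using \<psi>\<phi>[OF U(2)] \<phi>0 by simp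
  obtain W where W: "open W" "W \<inter> ball 0 1 = \<psi> -` V \<inter> ball 0 1"
    using cont\<psi> V(1) unfolding continuous_on_open_invariant by blast
  have "0 \<in> \<psi> -` V \<inter> ball 0 1" using \<open>\<psi> 0 = q\<close> V(2) by simp
  then have "0 \<in> W" unfolding W(2)[symmetric] by simp
  then obtain e where e: "e > 0" "ball 0 e \<subseteq> W" using openE[OF W(1)] by blast
  define r where "r = min (1/2) (e / 2)"
  have r: "0 < r" "r < 1" "r < e" using e(1) by (auto simp: r_def min_def)
  define z where "z = Complex 0 (\<epsilon> * r)"
  have nz: "norm z = r" using \<epsilon>(1) r by (auto simp: z_def norm_complex_def)
  have zb: "z \<in> ball 0 1" "z \<in> W" using nz r e(2) by auto
  have zI: "0 < \<epsilon> * Im z" using \<epsilon>(1) r(1) by (auto simp: z_def)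
  show thesis
  proof (rule that[of "\<psi> z"])
    show "\<psi> z \<in> C2" by (rule in2[OF zb(1)]) (simp add: z_def)
    have "z \<in> W \<inter> ball 0 1" using zb by simp
    then show "\<psi> z \<in> V" unfolding W(2) by simp
    show "\<psi> z \<in> D" using sub zb(1) zI by (auto simp: half_def)
    show "\<psi> z \<notin> C1" by (rule not1[OF zb(1)]) (use zI in auto)
  qed
qed

text \<open>\<open>R\<close> will be the union of the two arcs of \<open>C2\<close> that do not end
  at \<open>q\<close>; the two arcs that do end there then cannot lie in the same disc.\<close>

lemma transversal_not_one_sided:
  assumes CDE: "C1 = D \<inter> E" "D \<union> E = S2" "disc D C1" "disc E C1" and q: "q \<in> C1"
    and tr: "transversal_at C1 C2 q" and R: "closed R" "q \<notin> R"
  shows "\<not> C2 \<subseteq> D \<union> R" "\<not> C2 \<subseteq> E \<union> R"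
proof -
  have V: "open (- R)" "q \<in> - R" using R by auto
  obtain x where x: "x \<in> C2" "x \<in> - R" "x \<in> D" "x \<notin> C1"
    using transversal_crosses[OF CDE q tr V] .
  then show "\<not> C2 \<subseteq> E \<union> R" using CDE(1) by blast
  have CED: "C1 = E \<inter> D" "E \<union> D = S2" using CDE(1,2) by auto
  obtain x where x: "x \<in> C2" "x \<in> - R" "x \<in> E" "x \<notin> C1"
    using transversal_crosses[OF CED CDE(4,3) q tr V] .
  then show "\<not> C2 \<subseteq> D \<union> R" using CDE(1) by blast
qed

lemma arc_on_one_side:
  fixes B :: "'a::t2_space set"
  assumes B: "arc_between B a b" "B \<subseteq> D \<union> E" "B \<inter> (D \<inter> E) = {a, b}" and "closed D" "closed E"
  shows "B \<subseteq> D \<or> B \<subseteq> E"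
proof -
  have "B - {a, b} \<subseteq> D \<or> B - {a, b} \<subseteq> E"
    using B by (intro connected_in_closed_cover arc_between_interior(1)[OF B(1)] assms(4,5)) auto
  moreover have "a \<in> D \<inter> E" "b \<in> D \<inter> E" using B(3) by auto
  ultimately show ?thesis by auto
qed

lemma quad_corners:
  fixes A0 :: "'a::t2_space set"
  assumes "quad A0 A1 A2 A3 q0 q1 q2 q3"
  shows "A0 \<inter> {q0, q1, q2, q3} = {q0, q1}" "A1 \<inter> {q0, q1, q2, q3} = {q1, q2}"
    "A2 \<inter> {q0, q1, q2, q3} = {q2, q3}" "A3 \<inter> {q0, q1, q2, q3} = {q3, q0}"
  using quadD[OF assms] by auto

section \<open>The order of the crossings, and the equivalence of any two configurations\<close>

lemma configuration_normal_form:
  assumes "(C1, C2) \<in> configurations 4"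
  obtains A0 A1 A2 A3 B0 B1 B2 B3 q0 q1 q2 q3 D E where
    "quad A0 A1 A2 A3 q0 q1 q2 q3" "quad B0 B1 B2 B3 q0 q1 q2 q3"
    "C1 = A0 \<union> A1 \<union> A2 \<union> A3" "C2 = B0 \<union> B1 \<union> B2 \<union> B3"
    "disc D C1" "disc E C1" "D \<union> E = S2" "D \<inter> E = C1"
    "B0 \<subseteq> D" "B1 \<subseteq> E" "B2 \<subseteq> D" "B3 \<subseteq> E"
    "B0 \<inter> C1 = {q0, q1}" "B1 \<inter> C1 = {q1, q2}" "B2 \<inter> C1 = {q2, q3}" "B3 \<inter> C1 = {q3, q0}"
proof -
  have C: "simple_closed_curve C1" "simple_closed_curve C2" and card: "card (C1 \<inter> C2) = 4"
    and tr: "\<And>p. p \<in> C1 \<inter> C2 \<Longrightarrow> transversal_at C1 C2 p"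
    using assms by (auto simp: configurations_def)
  \<comment> \<open>Both curves are marked from the same crossing, so only the order of the other
    three has to be settled.\<close>
  obtain q0 where q0: "q0 \<in> C1 \<inter> C2" using card by (metis card.empty ex_in_conv zero_neq_numeral)
  obtain B0 B1 B2 B3 q1 q2 q3 where B: "quad B0 B1 B2 B3 q0 q1 q2 q3" and C2: "C2 = B0 \<union> B1 \<union> B2 \<union> B3"
    and Q: "C1 \<inter> C2 = {q0, q1, q2, q3}"
    using quad_through_four_points[OF C(2) Int_lower2 card q0] .
  obtain A0 A1 A2 A3 r1 r2 r3 where A: "quad A0 A1 A2 A3 q0 r1 r2 r3" and C1: "C1 = A0 \<union> A1 \<union> A2 \<union> A3"
    and R: "C1 \<inter> C2 = {q0, r1, r2, r3}"
    using quad_through_four_points[OF C(1) Int_lower1 card q0] .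
  note b = quadD[OF B]
  have BC: "B0 \<inter> C1 = {q0, q1}" "B1 \<inter> C1 = {q1, q2}" "B2 \<inter> C1 = {q2, q3}" "B3 \<inter> C1 = {q3, q0}"
  proof -
    have eq: "S \<inter> C1 = S \<inter> {q0, q1, q2, q3}" if "S \<subseteq> C2" for S
      unfolding Q[symmetric] using that by auto
    have "B0 \<subseteq> C2" "B1 \<subseteq> C2" "B2 \<subseteq> C2" "B3 \<subseteq> C2" unfolding C2 by auto
    then show "B0 \<inter> C1 = {q0, q1}" "B1 \<inter> C1 = {q1, q2}" "B2 \<inter> C1 = {q2, q3}" "B3 \<inter> C1 = {q3, q0}"
      using quad_corners[OF B] by (simp_all only: eq)
  qed
  have "\<exists>D E. disc D C1 \<and> disc E C1 \<and> D \<union> E = S2 \<and> D \<inter> E = C1 \<and> B0 \<subseteq> D \<and> B1 \<subseteq> E \<and> B2 \<subseteq> D \<and> B3 \<subseteq> E"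
  proof -
    obtain D E where DE: "disc D C1" "disc E C1" "D \<union> E = S2" "D \<inter> E = C1"
      using simple_closed_curve_two_discs[OF C(1)] .
    have sub: "B0 \<subseteq> D \<union> E" "B1 \<subseteq> D \<union> E" "B2 \<subseteq> D \<union> E" "B3 \<subseteq> D \<union> E"
      using C(2) unfolding DE(3) simple_closed_curve_def C2 by blast+
    note cD = disc_closed[OF DE(1)] and cE = disc_closed[OF DE(2)]
    have side: "B0 \<subseteq> D \<or> B0 \<subseteq> E" "B1 \<subseteq> D \<or> B1 \<subseteq> E" "B2 \<subseteq> D \<or> B2 \<subseteq> E" "B3 \<subseteq> D \<or> B3 \<subseteq> E"
      by (rule arc_on_one_side[OF b(1) sub(1) _ cD cE] arc_on_one_side[OF b(2) sub(2) _ cD cE]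
            arc_on_one_side[OF b(3) sub(3) _ cD cE] arc_on_one_side[OF b(4) sub(4) _ cD cE],
          simp only: DE(4) BC)+
    have nos: "\<not> (C2 \<subseteq> D \<union> R)" "\<not> (C2 \<subseteq> E \<union> R)" if "q \<in> C1 \<inter> C2" "closed R" "q \<notin> R" for q R
      by (rule transversal_not_one_sided[OF DE(4)[symmetric] DE(3,1,2) IntD1[OF that(1)] tr[OF that(1)] that(2,3)])+
    note cl = arc_betweenD(2)[OF b(1)] arc_betweenD(2)[OF b(2)] arc_betweenD(2)[OF b(3)] arc_betweenD(2)[OF b(4)]
    have q: "q1 \<in> C1 \<inter> C2" "q2 \<in> C1 \<inter> C2" "q3 \<in> C1 \<inter> C2" unfolding Q by simp_all
    have out: "q1 \<notin> B2 \<union> B3" "q2 \<notin> B3 \<union> B0" "q3 \<notin> B0 \<union> B1"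
      using b(9,10) b(12-17) by blast+
    have 01: "\<not> (B0 \<subseteq> D \<and> B1 \<subseteq> D)" "\<not> (B0 \<subseteq> E \<and> B1 \<subseteq> E)"
      using nos[OF q(1) closed_Un[OF cl(3,4)] out(1)] unfolding C2 by blast+
    have 12: "\<not> (B1 \<subseteq> D \<and> B2 \<subseteq> D)" "\<not> (B1 \<subseteq> E \<and> B2 \<subseteq> E)"
      using nos[OF q(2) closed_Un[OF cl(4,1)] out(2)] unfolding C2 by blast+
    have 23: "\<not> (B2 \<subseteq> D \<and> B3 \<subseteq> D)" "\<not> (B2 \<subseteq> E \<and> B3 \<subseteq> E)"
      using nos[OF q(3) closed_Un[OF cl(1,2)] out(3)] unfolding C2 by blast+
    \<comment> \<open>The names of the discs are free: the one that contains \<open>B0\<close> is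
      called \<open>D\<close> in the conclusion.\<close>
    show ?thesis
    proof (cases "B0 \<subseteq> D")
      case True
      then have "B1 \<subseteq> E" "B2 \<subseteq> D" "B3 \<subseteq> E" using 01 12 23 side by auto
      then show ?thesis using DE True by (intro exI[of _ D] exI[of _ E]) simp
    next
      case False
      then have "B0 \<subseteq> E" "B1 \<subseteq> D" "B2 \<subseteq> E" "B3 \<subseteq> D" using 01 12 23 side by auto
      then show ?thesis using DE by (intro exI[of _ E] exI[of _ D]) (simp add: Un_commute Int_commute)
    qed
  qed
  then obtain D E where DE: "disc D C1" "disc E C1" "D \<union> E = S2" "D \<inter> E = C1"
    "B0 \<subseteq> D" "B1 \<subseteq> E" "B2 \<subseteq> D" "B3 \<subseteq> E" by (elim exE conjE)
  have rq: "{r1, r2, r3} = {q1, q2, q3}"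
  proof -
    have "{q0, r1, r2, r3} - {q0} = {q0, q1, q2, q3} - {q0}" using Q R by simp
    then show ?thesis using quadD(19)[OF A] b(19) by auto
  qed
  have dr: "distinct [q0, r1, r2, r3]" by (rule quadD(19)[OF A])
  have r123: "r2 \<in> {q1, q2, q3}" and r13: "r1 \<in> {q1, q2, q3}" "r3 \<in> {q1, q2, q3}"
    unfolding rq[symmetric] by simp_all
  \<comment> \<open>The crossing opposite to \<open>q0\<close> must be the same on both curves. If
    on \<open>C1\<close> it were \<open>q1\<close>, then \<open>B0\<close> would join opposite
    corners of \<open>C1\<close> in \<open>D\<close>, while the disjoint arc \<open>B2\<close> in
    \<open>D\<close> joins the other two; if it were \<open>q3\<close>, the same would happen with
    \<open>B3\<close> and \<open>B1\<close> in \<open>E\<close>.\<close>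
  have "r2 = q2"
  proof (rule ccontr)
    assume "r2 \<noteq> q2"
    then consider "r2 = q1" | "r2 = q3" using r123 by blast
    then show False
    proof cases
      case 1
      have "r1 \<in> {q2, q3}" "r3 \<in> {q2, q3}" using r13 dr 1 by auto
      then have r: "r1 \<in> B2" "r3 \<in> B2" using b(15,16) by auto
      have \<gamma>: "arc_between B0 q0 r2" "B0 \<inter> (A0 \<union> A1 \<union> A2 \<union> A3) = {q0, r2}"
        using b(1) BC(1) unfolding 1 C1 by simp_all
      show False
        by (rule disc_no_crossing_chords[OF A DE(1)[unfolded C1] \<gamma>(1) DE(5) \<gamma>(2)
              arc_betweenD(3)[OF b(3)] DE(7) r b(9)])
    next
      case 2
      have "r1 \<in> {q1, q2}" "r3 \<in> {q1, q2}" using r13 dr 2 by auto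
      then have r: "r1 \<in> B1" "r3 \<in> B1" using b(13,14) by auto
      have \<gamma>: "arc_between B3 q0 r2" "B3 \<inter> (A0 \<union> A1 \<union> A2 \<union> A3) = {q0, r2}"
        using arc_betweenD(7)[OF b(4)] BC(4) unfolding 2 C1 by (simp_all add: insert_commute)
      have "B3 \<inter> B1 = {}" using b(10) by blast
      then show False
        by (rule disc_no_crossing_chords[OF A DE(2)[unfolded C1] \<gamma>(1) DE(8) \<gamma>(2)
              arc_betweenD(3)[OF b(2)] DE(6) r])
    qed
  qed
  \<comment> \<open>The only freedom left is the direction in which \<open>C1\<close> is traversed,
    and the second case reverses it.\<close>
  with r13 dr have "r1 = q1 \<and> r3 = q3 \<or> r1 = q3 \<and> r3 = q1" by auto
  then have "\<exists>A0 A1 A2 A3. quad A0 A1 A2 A3 q0 q1 q2 q3 \<and> C1 = A0 \<union> A1 \<union> A2 \<union> A3"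
  proof
    assume "r1 = q1 \<and> r3 = q3"
    then show ?thesis using A C1 \<open>r2 = q2\<close> by blast
  next
    assume "r1 = q3 \<and> r3 = q1"
    then have "quad A3 A2 A1 A0 q0 q1 q2 q3" using quad_reverse[OF A] \<open>r2 = q2\<close> by simp
    moreover have "C1 = A3 \<union> A2 \<union> A1 \<union> A0" using C1 by (simp add: Un_ac)
    ultimately show ?thesis by blast
  qed
  then obtain A0' A1' A2' A3' where A': "quad A0' A1' A2' A3' q0 q1 q2 q3" "C1 = A0' \<union> A1' \<union> A2' \<union> A3'"
    by (elim exE conjE)
  show thesis by (rule that[OF A'(1) B A'(2) C2 DE BC])
qed

lemma configurations_4_equivalent:
  assumes "(C1, C2) \<in> configurations 4" "(C1', C2') \<in> configurations 4"
  obtains h h' where "homeomorphism S2 S2 h h'" "h ` (C1 \<union> C2) = C1' \<union> C2'"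
proof -
  obtain A0 A1 A2 A3 B0 B1 B2 B3 p0 p1 p2 p3 D E where
    A: "quad A0 A1 A2 A3 p0 p1 p2 p3" and B: "quad B0 B1 B2 B3 p0 p1 p2 p3" and
    C1: "C1 = A0 \<union> A1 \<union> A2 \<union> A3" and C2: "C2 = B0 \<union> B1 \<union> B2 \<union> B3" and
    DE: "disc D C1" "disc E C1" "D \<union> E = S2" "D \<inter> E = C1" and
    BDE: "B0 \<subseteq> D" "B1 \<subseteq> E" "B2 \<subseteq> D" "B3 \<subseteq> E" and
    BC: "B0 \<inter> C1 = {p0, p1}" "B1 \<inter> C1 = {p1, p2}" "B2 \<inter> C1 = {p2, p3}" "B3 \<inter> C1 = {p3, p0}"
    using configuration_normal_form[OF assms(1)] .
  obtain A0' A1' A2' A3' B0' B1' B2' B3' q0 q1 q2 q3 D' E' where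
    A': "quad A0' A1' A2' A3' q0 q1 q2 q3" and B': "quad B0' B1' B2' B3' q0 q1 q2 q3" and
    C1': "C1' = A0' \<union> A1' \<union> A2' \<union> A3'" and C2': "C2' = B0' \<union> B1' \<union> B2' \<union> B3'" and
    DE': "disc D' C1'" "disc E' C1'" "D' \<union> E' = S2" "D' \<inter> E' = C1'" and
    BDE': "B0' \<subseteq> D'" "B1' \<subseteq> E'" "B2' \<subseteq> D'" "B3' \<subseteq> E'" and
    BC': "B0' \<inter> C1' = {q0, q1}" "B1' \<inter> C1' = {q1, q2}" "B2' \<inter> C1' = {q2, q3}" "B3' \<inter> C1' = {q3, q0}"
    using configuration_normal_form[OF assms(2)] .
  obtain \<phi> where \<phi>': "cont_bij \<phi> (A0 \<union> A1 \<union> A2 \<union> A3) (A0' \<union> A1' \<union> A2' \<union> A3')"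
    and \<phi>A: "\<phi> ` A0 = A0'" "\<phi> ` A1 = A1'" "\<phi> ` A2 = A2'" "\<phi> ` A3 = A3'"
    and \<phi>p: "\<phi> p0 = q0" "\<phi> p1 = q1" "\<phi> p2 = q2" "\<phi> p3 = q3"
    using quad_cont_bij[OF A A'] .
  have \<phi>: "cont_bij \<phi> C1 C1'" unfolding C1 C1' by (rule \<phi>')
  note b = quadD[OF B] and b' = quadD[OF B']
  obtain hD where hD: "cont_bij hD D D'" "\<And>x. x \<in> C1 \<Longrightarrow> hD x = \<phi> x" "hD ` B0 = B0'" "hD ` B2 = B2'"
    using disc_extend_two_chords[OF A A' C1 C1' DE(1) DE'(1) b(1) BDE(1) BC(1) b(3) BDE(3) BC(3) b(9)
        b'(1) BDE'(1) BC'(1) b'(3) BDE'(3) BC'(3) b'(9) \<phi> \<phi>A \<phi>p] by blast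
  \<comment> \<open>The chords in \<open>E\<close> end at \<open>p1\<close>, \<open>p2\<close> and
    at \<open>p3\<close>, \<open>p0\<close>, so the marking of the curve is shifted by one corner
    before the same extension lemma applies. Both extensions restrict to \<phi> on \<open>C1\<close>
    and can therefore be glued.\<close>
  have R: "C1 = A1 \<union> A2 \<union> A3 \<union> A0" "C1' = A1' \<union> A2' \<union> A3' \<union> A0'" using C1 C1' by (simp_all add: Un_ac)
  obtain hE where hE: "cont_bij hE E E'" "\<And>x. x \<in> C1 \<Longrightarrow> hE x = \<phi> x" "hE ` B1 = B1'" "hE ` B3 = B3'"
    using disc_extend_two_chords[OF quad_rotate[OF A] quad_rotate[OF A'] R DE(2) DE'(2) b(2) BDE(2) BC(2) b(4) BDE(4) BC(4) b(10)
        b'(2) BDE'(2) BC'(2) b'(4) BDE'(4) BC'(4) b'(10) \<phi> \<phi>A(2,3,4,1) \<phi>p(2,3,4,1)] by blast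
  have hDC: "hD ` C1 = C1'" using \<phi> hD(2) by (simp add: cont_bij_def)
  obtain h where h: "cont_bij h (D \<union> E) (D' \<union> E')" "\<And>x. x \<in> D \<Longrightarrow> h x = hD x" "\<And>x. x \<in> E \<Longrightarrow> h x = hE x"
    by (rule cont_bij_glue[OF hD(1) hE(1) disc_closed[OF DE(1)] disc_closed[OF DE(2)]], unfold DE(4) DE'(4) hDC)
      (use hD(2) hE(2) in auto)
  have "cont_bij h S2 S2" using h(1) DE(3) DE'(3) by simp
  moreover have "compact S2" by (simp add: S2_def)
  ultimately obtain h' where "homeomorphism S2 S2 h h'" using cont_bij_homeomorphism by blast
  moreover have "h ` (C1 \<union> C2) = C1' \<union> C2'"
  proof -
    have "h ` S = hD ` S" if "S \<subseteq> D" for S using h(2) that by (intro image_cong) auto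
    moreover have "h ` S = hE ` S" if "S \<subseteq> E" for S using h(3) that by (intro image_cong) auto
    moreover have "C1 \<subseteq> D" using DE(4) by blast
    ultimately show ?thesis
      unfolding C2 C2' image_Un using BDE hD(3,4) hE(3,4) hDC by simp
  qed
  ultimately show thesis by (rule that)
qed

section \<open>A configuration with four crossings\<close>

text \<open>Rectangles are chosen because a wide one and a tall one cross inside their sides, where
  both run parallel to the axes; a translation followed by a scaling then straightens the
  crossing.\<close>

definition rect_curve :: "real \<Rightarrow> real \<Rightarrow> complex set" where
  "rect_curve a b = {z. \<bar>Re z\<bar> \<le> a \<and> \<bar>Im z\<bar> \<le> b \<and> (\<bar>Re z\<bar> = a \<or> \<bar>Im z\<bar> = b)}"

text \<open>Both curves are frontiers of bounded convex sets of full dimension in the plane.\<close>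

lemma rect_curve_homeomorphic_circle:
  assumes "a > 0" "b > 0"
  shows "rect_curve a b homeomorphic sphere (0::complex) 1"
proof -
  let ?R = "cbox (Complex (-a) (-b)) (Complex a b)"
  have int: "interior ?R = box (Complex (-a) (-b)) (Complex a b)" by (rule interior_cbox)
  have ne: "interior ?R \<noteq> {}"
    unfolding int using assms by (intro ex_in_conv[THEN iffD1] exI[of _ 0]) (simp add: in_box_complex_iff)
  have "frontier ?R = rect_curve a b"
    unfolding frontier_def int closure_cbox rect_curve_def
    using assms by (auto simp: in_box_complex_iff in_cbox_complex_iff abs_if split: if_splits)
  then have 1: "rel_frontier ?R = rect_curve a b" using rel_frontier_nonempty_interior[OF ne] by simp
  have 2: "rel_frontier (cball 0 1) = sphere (0::complex) 1"
    by (simp add: rel_frontier_nonempty_interior)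
  have "rel_frontier ?R homeomorphic rel_frontier (cball (0::complex) 1)"
  proof (rule homeomorphic_rel_frontiers_convex_bounded_sets)
    show "aff_dim ?R = aff_dim (cball (0::complex) 1)"
      using aff_dim_nonempty_interior[OF ne] by (simp add: aff_dim_nonempty_interior)
  qed auto
  then show ?thesis by (simp only: 1 2)
qed

lemma rect_curves_intersection:
  "rect_curve 2 1 \<inter> rect_curve 1 2 = {Complex 1 1, Complex 1 (-1), Complex (-1) 1, Complex (-1) (-1)}"
proof -
  have "z \<in> rect_curve 2 1 \<inter> rect_curve 1 2 \<longleftrightarrow> (Re z = 1 \<or> Re z = -1) \<and> (Im z = 1 \<or> Im z = -1)" for z
    unfolding rect_curve_def Int_iff mem_Collect_eq by linarith
  moreover have "z \<in> {Complex 1 1, Complex 1 (-1), Complex (-1) 1, Complex (-1) (-1)} \<longleftrightarrow>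
      (Re z = 1 \<or> Re z = -1) \<and> (Im z = 1 \<or> Im z = -1)" for z
    unfolding insert_iff empty_iff complex_eq_iff complex.sel by blast
  ultimately show ?thesis by blast
qed

text \<open>Within 1/2 of a crossing the coordinates keep their signs and stay below 3/2 in absolute
  value, so only one side of each rectangle is in sight, and neither of its ends.\<close>

lemma rect_curves_near_crossing:
  assumes "\<bar>Re p\<bar> = 1" "\<bar>Im p\<bar> = 1" "z \<in> ball p (1/2)"
  shows "z \<in> rect_curve 2 1 \<longleftrightarrow> Im z = Im p" "z \<in> rect_curve 1 2 \<longleftrightarrow> Re z = Re p"
proof -
  have "norm (z - p) < 1/2" using assms(3) by (simp add: dist_norm norm_minus_commute)
  then have "\<bar>Re z - Re p\<bar> < 1/2" "\<bar>Im z - Im p\<bar> < 1/2"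
    using abs_Re_le_cmod[of "z - p"] abs_Im_le_cmod[of "z - p"] by auto
  then show "z \<in> rect_curve 2 1 \<longleftrightarrow> Im z = Im p" "z \<in> rect_curve 1 2 \<longleftrightarrow> Re z = Re p"
    using assms(1,2) unfolding rect_curve_def mem_Collect_eq by linarith+
qed

text \<open>This excludes the value 0 for the count: an empty set of configurations would have no
  classes.\<close>

lemma configurations_4_nonempty: "configurations 4 \<noteq> {}"
proof -
  define q :: "real^3" where "q = axis 1 1"
  have q: "q \<in> S2" by (simp add: q_def S2_def norm_axis_1)
  obtain s t where st: "homeomorphism (S2 - {q}) (UNIV::complex set) s t"
    using stereographic_projection[OF q] .
  have t: "continuous_on UNIV t" "inj t" "range t = S2 - {q}"
    using homeomorphism_cont_bij[OF st] by (auto simp: cont_bij_def)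
  have st_id: "s (t z) = z" for z using st by (simp add: homeomorphism_def)
  have contt: "continuous_on S t" for S by (rule continuous_on_subset[OF t(1)]) simp
  have injt: "inj_on t S" for S by (rule inj_on_subset[OF t(2)]) simp
  have tS2: "t z \<in> S2" for z using t(3) by blast
  have opent: "openin (top_of_set S2) (t ` W)" if "open W" for W
  proof -
    have "openin (top_of_set (S2 - {q})) (t ` W)"
      by (rule homeomorphism_imp_open_map[OF homeomorphism_symD[OF st]]) (simp add: that)
    moreover have "openin (top_of_set S2) (S2 - {q})" by (rule openin_Diff_closed) simp
    ultimately show ?thesis by (rule openin_trans)
  qed
  define C1 where "C1 = t ` rect_curve 2 1"
  define C2 where "C2 = t ` rect_curve 1 2"
  have scc: "simple_closed_curve (t ` rect_curve a b)" if ab: "a > 0" "b > 0" for a b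
  proof -
    have "homeomorphism (t ` rect_curve a b) (rect_curve a b) s t"
      using homeomorphism_of_subsets[OF st, of "t ` rect_curve a b" "rect_curve a b"] tS2 t(3)
      by (auto simp: image_image st_id)
    then have "t ` rect_curve a b homeomorphic rect_curve a b" unfolding homeomorphic_def by blast
    then show ?thesis
      unfolding simple_closed_curve_def
      using rect_curve_homeomorphic_circle[OF ab] tS2 homeomorphic_trans by blast
  qed
  have int: "C1 \<inter> C2 = t ` {Complex 1 1, Complex 1 (-1), Complex (-1) 1, Complex (-1) (-1)}"
    unfolding C1_def C2_def image_Int[OF t(2), symmetric] rect_curves_intersection ..
  have "card (C1 \<inter> C2) = 4"
    unfolding int card_image[OF injt] by (simp add: complex_eq_iff)
  moreover have "transversal_at C1 C2 p" if p: "p \<in> C1 \<inter> C2" for p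
  proof -
    obtain w where w: "p = t w" "\<bar>Re w\<bar> = 1" "\<bar>Im w\<bar> = 1" using p unfolding int by auto
    define U where "U = t ` ball w (1/2)"
    \<comment> \<open>The factor 2 enlarges the ball of radius 1/2, in which both rectangles are
      straight, to the unit ball of the chart.\<close>
    define \<phi> where "\<phi> x = 2 * (s x - w)" for x
    define \<psi> where "\<psi> z = t (z / 2 + w)" for z
    have ball: "z / 2 + w \<in> ball w (1/2)" if "z \<in> ball 0 1" for z
      using that by (simp add: dist_norm norm_divide)
    have ball': "2 * (z - w) \<in> ball 0 1" if "z \<in> ball w (1/2)" for z
    proof -
      have "norm (2 * (z - w)) = 2 * norm (z - w)" by (simp only: norm_mult norm_numeral)
      then show ?thesis using that by (simp only: mem_ball dist_norm) (simp add: norm_minus_commute)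
    qed
    have \<phi>t: "\<phi> (t z) = 2 * (z - w)" for z by (simp add: \<phi>_def st_id)
    have \<psi>\<phi>t: "\<psi> (\<phi> (t z)) = t z" for z by (simp add: \<phi>t \<psi>_def diff_divide_distrib)
    have \<phi>\<psi>: "\<phi> (\<psi> z) = z" for z by (simp add: \<phi>t \<psi>_def)
    have hom: "homeomorphism U (ball 0 1) \<phi> \<psi>"
      unfolding homeomorphism_def
    proof (intro conjI ballI)
      show "\<phi> ` U = ball 0 1"
      proof
        show "\<phi> ` U \<subseteq> ball 0 1" using ball' by (auto simp: U_def \<phi>t simp del: mem_ball)
        show "ball 0 1 \<subseteq> \<phi> ` U"
        proof
          fix z :: complex assume "z \<in> ball 0 1"
          then have "\<psi> z \<in> U" using ball unfolding U_def \<psi>_def by blast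
          then show "z \<in> \<phi> ` U" using \<phi>\<psi> by (metis imageI)
        qed
      qed
      moreover have "\<psi> ` \<phi> ` U = U" unfolding U_def image_image \<psi>\<phi>t ..
      ultimately show "\<psi> ` ball 0 1 = U" by simp
      have "continuous_on (S2 - {q}) s" using st by (simp add: homeomorphism_def)
      then have "continuous_on U s" by (rule continuous_on_subset) (use t(3) in \<open>auto simp: U_def\<close>)
      then show "continuous_on U \<phi>" unfolding \<phi>_def by (intro continuous_intros)
      show "continuous_on (ball 0 1) \<psi>"
        unfolding \<psi>_def by (intro continuous_on_compose2[OF t(1)] continuous_intros) auto
    qed (auto simp: U_def \<psi>\<phi>t \<phi>\<psi>)
    have im: "\<phi> ` (t ` R \<inter> U) = {z \<in> ball 0 1. P z}"
      if R: "\<And>z. z \<in> ball w (1/2) \<Longrightarrow> z \<in> R \<longleftrightarrow> P (2 * (z - w))" for R P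
    proof -
      have "t ` R \<inter> U = t ` (R \<inter> ball w (1/2))" unfolding U_def by (rule image_Int[OF t(2), symmetric])
      then have "\<phi> ` (t ` R \<inter> U) = (\<lambda>z. 2 * (z - w)) ` (R \<inter> ball w (1/2))"
        by (simp add: image_image \<phi>t)
      also have "\<dots> = {z \<in> ball 0 1. P z}"
      proof (intro equalityI subsetI)
        fix z assume "z \<in> (\<lambda>z. 2 * (z - w)) ` (R \<inter> ball w (1/2))"
        then show "z \<in> {z \<in> ball 0 1. P z}" using R ball' by (auto simp del: mem_ball)
      next
        fix z assume z: "z \<in> {z \<in> ball 0 1. P z}"
        then have "z / 2 + w \<in> R \<inter> ball w (1/2)" using R[of "z / 2 + w"] ball[of z] by simp
        moreover have "z = 2 * ((z / 2 + w) - w)" by simp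
        ultimately show "z \<in> (\<lambda>z. 2 * (z - w)) ` (R \<inter> ball w (1/2))" by (rule image_eqI[rotated])
      qed
      finally show ?thesis .
    qed
    show ?thesis
      unfolding transversal_at_def
    proof (intro exI conjI)
      show "openin (top_of_set S2) U" unfolding U_def by (rule opent) simp
      show "p \<in> U" by (simp add: U_def w)
      show "homeomorphism U (ball 0 1) \<phi> \<psi>" by (rule hom)
      show "\<phi> p = 0" by (simp add: w \<phi>t)
      show "\<phi> ` (C1 \<inter> U) = {z \<in> ball 0 1. Im z = 0}"
        unfolding C1_def by (rule im) (simp add: rect_curves_near_crossing(1)[OF w(2,3)] del: mem_ball)
      show "\<phi> ` (C2 \<inter> U) = {z \<in> ball 0 1. Re z = 0}"
        unfolding C2_def by (rule im) (simp add: rect_curves_near_crossing(2)[OF w(2,3)] del: mem_ball)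
    qed
  qed
  moreover have "finite (C1 \<inter> C2)" unfolding int by simp
  ultimately have "(C1, C2) \<in> configurations 4"
    unfolding configurations_def C1_def C2_def using scc by simp
  then show ?thesis by blast
qed

theorem theorem2:
  shows "N 4 = 1"
proof -
  \<comment> \<open>Every class is the whole set of configurations, so the quotient can be computed
    directly, without first establishing that the relation is an equivalence.\<close>
  have cls: "config_equiv 4 `` {x} = configurations 4" if x: "x \<in> configurations 4" for x
  proof (intro equalityI subsetI)
    fix y assume "y \<in> config_equiv 4 `` {x}"
    then show "y \<in> configurations 4" by (auto simp: config_equiv_def)
  next
    fix y assume y: "y \<in> configurations 4"
    obtain C1 C2 D1 D2 where xy: "x = (C1, C2)" "y = (D1, D2)" by (metis surj_pair)
    obtain h h' where "homeomorphism S2 S2 h h'" "h ` (C1 \<union> C2) = D1 \<union> D2"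
      using configurations_4_equivalent x y unfolding xy .
    then show "y \<in> config_equiv 4 `` {x}" using x y unfolding xy config_equiv_def by blast
  qed
  have "configurations 4 // config_equiv 4 = {configurations 4}"
    using cls configurations_4_nonempty unfolding quotient_def by auto
  then show ?thesis by (simp add: N_def)
qed

end
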